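(* Let $k\in\mathbb{N}$, let $\mathbb{D}_Q\subset\mathbb{M}^d$ be an NC operator ball, and let $P\in M_k(\mathbb{C}\langle Z\rangle)$ be a $Q$-stable atom. Then $$\sup_{0\le r<1}\big\|\big(P^{(r)}\big)^{-1}P\big\|_Q<\infty\qquad\text{and}\qquad \sup_{0\le r<1}\big\|P\big(P^{(r)}\big)^{-1}\big\|_Q<\infty .$$
   Context: Fix $d\in\mathbb{N}$. Write $M_n$ for the complex $n\times n$ matrices, $M_n^d$ for $d$-tuples of such matrices, and $\mathbb{M}^d=\bigsqcup_{n\ge1}M_n^d$. Let $\mathcal{H}$ be a Hilbert space, let $\mathcal{E}\subseteq B(\mathcal{H})$ be a $d$-dimensional linear subspace (operator space) with basis $Q_1,\dots,Q_d$, and put $Q(X)=\sum_{j=1}^d Q_j\otimes X_j\in B(\mathcal{H}\otimes\mathbb{C}^n)$ for $X=(X_1,\dots,X_d)\in M_n^d$. The associated NC operator ball is $\mathbb{D}_Q=\{X\in\mathbb{M}^d:\|Q(X)\|<1\}$ (operator norm). $\mathbb{C}\langle Z\rangle$ is the algebra of polynomials over $\mathbb{C}$ in $d$ freely non-commuting variables $Z_1,\dots,Z_d$. An element $P\in M_k(\mathbb{C}\langle Z\rangle)$ is written $P=\sum_w C_wZ^w$ (finite sum over words $w$ in $\{1,\dots,d\}$, with $C_w\in M_k$) and is evaluated at $X\in M_n^d$ by $P(X)=\sum_w C_w\otimes X^w\in M_k(M_n)$. For $0\le r<1$, $P^{(r)}(X):=P(rX)$. $P$ is $Q$-stable if $\det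 P(X)\ne0$ for all $X\in\mathbb{D}_Q$. For a matrix-valued function $F$ on $\mathbb{D}_Q$, $\|F\|_Q:=\sup_{X\in\mathbb{D}_Q}\|F(X)\|$ (operator norm); products and inverses of such functions are taken pointwise, e.g. $((P^{(r)})^{-1}P)(X)=P(rX)^{-1}P(X)$. $GL_k(\mathbb{C}\langle Z\rangle)$ is the set of $P\in M_k(\mathbb{C}\langle Z\rangle)$ having an inverse in $M_k(\mathbb{C}\langle Z\rangle)$. $P\in M_k(\mathbb{C}\langle Z\rangle)$ is an atom if it is not a product of two elements $F,G\in M_k(\mathbb{C}\langle Z\rangle)$ with $F,G\notin GL_k(\mathbb{C}\langle Z\rangle)$. *)

theory Defs
  imports
    "Jordan_Normal_Form.Determinant"
    "Jordan_Normal_Form.Gauss_Jordan_Elimination"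
    "HOL-Library.Poly_Mapping"
    "HOL-Library.Extended_Nonnegative_Real"
    "HOL-Analysis.L2_Norm"
begin

section \<open>Complex Hilbert spaces and operator spaces\<close>

text \<open>The norm and its completeness are those of \<^class>\<open>banach\<close>; the inner product is linear in its
  first argument. The scalar law for \<open>scaleR\<close> also yields \<open>scaleC 1 x = x\<close>.\<close>

class complex_hilbert = banach +
  fixes scaleC :: "complex \<Rightarrow> 'a \<Rightarrow> 'a"
    and cinner :: "'a \<Rightarrow> 'a \<Rightarrow> complex"
  assumes scaleC_add_right: "scaleC a (x + y) = scaleC a x + scaleC a y"
    and scaleC_add_left: "scaleC (a + b) x = scaleC a x + scaleC b x"
    and scaleC_scaleC: "scaleC a (scaleC b x) = scaleC (a * b) x"
    and scaleR_eq_scaleC: "scaleR r x = scaleC (complex_of_real r) x"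
    and cinner_commute: "cinner x y = cnj (cinner y x)"
    and cinner_add_left: "cinner (x + y) z = cinner x z + cinner y z"
    and cinner_scaleC_left: "cinner (scaleC a x) y = a * cinner x y"
    and cinner_self: "cinner x x = complex_of_real ((norm x)\<^sup>2)"

instantiation complex :: complex_hilbert
begin

definition scaleC_complex :: "complex \<Rightarrow> complex \<Rightarrow> complex" where
  "scaleC_complex a x = a * x"

definition cinner_complex :: "complex \<Rightarrow> complex \<Rightarrow> complex" where
  "cinner_complex x y = x * cnj y"

instance
  by standard (simp_all add: scaleC_complex_def cinner_complex_def algebra_simps
      scaleR_conv_of_real complex_norm_square flip: of_real_power)

end

definition bounded_clinear_op :: "('h::complex_hilbert \<Rightarrow> 'h) \<Rightarrow> bool" where
  "bounded_clinear_op T \<longleftrightarrow> bounded_linear T \<and> (\<forall>a x. T (scaleC a x) = scaleC a (T x))"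

text \<open>\<open>Q\<close> is a basis, indexed by \<open>'d\<close>, of the linear space \<open>\<E>\<close> of bounded operators;
  the dimension \<open>d\<close> is \<open>CARD('d)\<close>.\<close>

definition operator_space_basis ::
  "('h::complex_hilbert \<Rightarrow> 'h) set \<Rightarrow> ('d::finite \<Rightarrow> 'h \<Rightarrow> 'h) \<Rightarrow> bool" where
  "operator_space_basis \<E> Q \<longleftrightarrow>
     (\<forall>j. bounded_clinear_op (Q j)) \<and>
     \<E> = range (\<lambda>c x. \<Sum>j\<in>UNIV. scaleC (c j) (Q j x)) \<and>
     (\<forall>c. (\<forall>x. (\<Sum>j\<in>UNIV. scaleC (c j) (Q j x)) = 0) \<longrightarrow> (\<forall>j. c j = 0))"


section \<open>Noncommutative polynomials\<close>

datatype 'd nc_word = NCWord (letters: "'d list")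

instantiation nc_word :: (type) monoid_add
begin

definition zero_nc_word :: "'a nc_word" where
  "0 = NCWord []"

definition plus_nc_word :: "'a nc_word \<Rightarrow> 'a nc_word \<Rightarrow> 'a nc_word" where
  "u + v = NCWord (letters u @ letters v)"

instance
  by standard (simp_all add: zero_nc_word_def plus_nc_word_def)

end

text \<open>The free algebra is the monoid algebra of the free monoid; the product of
  \<^type>\<open>poly_mapping\<close> is convolution with respect to concatenation of words.\<close>

type_synonym 'd nc_poly = "'d nc_word \<Rightarrow>\<^sub>0 complex"

text \<open>Matrices over the free algebra of size \<open>k\<close> are the elements of \<open>carrier_mat k k\<close>, and those in
  \<open>GL\<^sub>k\<close> are the ones satisfying \<^const>\<open>invertible_mat\<close> (two-sided invertibility over the free algebra).
  As in the source, no non-unit condition is imposed on atoms.\<close>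

definition nc_atom :: "nat \<Rightarrow> 'd nc_poly mat \<Rightarrow> bool" where
  "nc_atom k P \<longleftrightarrow> P \<in> carrier_mat k k \<and>
     \<not> (\<exists>F \<in> carrier_mat k k. \<exists>G \<in> carrier_mat k k.
          P = F * G \<and> \<not> invertible_mat F \<and> \<not> invertible_mat G)"


section \<open>Evaluation on matrix tuples\<close>

text \<open>A point of the noncommutative universe carries its matrix size as first component.\<close>

type_synonym 'd nc_point = "nat \<times> ('d \<Rightarrow> complex mat)"

definition nc_universe :: "'d nc_point set" where
  "nc_universe = (SIGMA n:{1..}. {X. \<forall>j. X j \<in> carrier_mat n n})"

definition word_eval :: "nat \<Rightarrow> ('d \<Rightarrow> complex mat) \<Rightarrow> 'd nc_word \<Rightarrow> complex mat" where
  "word_eval n X w = foldr (\<lambda>j A. X j * A) (letters w) (1\<^sub>m n)"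

definition kronecker :: "complex mat \<Rightarrow> complex mat \<Rightarrow> complex mat" where
  "kronecker A B = mat (dim_row A * dim_row B) (dim_col A * dim_col B)
     (\<lambda>(i, j). A $$ (i div dim_row B, j div dim_col B) * B $$ (i mod dim_row B, j mod dim_col B))"

definition mat_coeff :: "'d nc_poly mat \<Rightarrow> 'd nc_word \<Rightarrow> complex mat" where
  "mat_coeff P w = map_mat (\<lambda>p. Poly_Mapping.lookup p w) P"

definition mat_words :: "'d nc_poly mat \<Rightarrow> 'd nc_word set" where
  "mat_words P = (\<Union>p\<in>elements_mat P. Poly_Mapping.keys p)"

text \<open>The sum of the matrices \<open>kronecker C\<^sub>w X\<^sup>w\<close> is taken entrywise, since \<^type>\<open>mat\<close> has no
  size-independent zero.\<close>

fun nc_eval :: "'d nc_poly mat \<Rightarrow> 'd nc_point \<Rightarrow> complex mat" where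
  "nc_eval P (n, X) = mat (dim_row P * n) (dim_col P * n)
     (\<lambda>ij. \<Sum>w\<in>mat_words P. kronecker (mat_coeff P w) (word_eval n X w) $$ ij)"

fun scale_point :: "real \<Rightarrow> 'd nc_point \<Rightarrow> 'd nc_point" where
  "scale_point r (n, X) = (n, \<lambda>j. complex_of_real r \<cdot>\<^sub>m X j)"

definition nc_dilate :: "real \<Rightarrow> ('d nc_point \<Rightarrow> complex mat) \<Rightarrow> 'd nc_point \<Rightarrow> complex mat" where
  "nc_dilate r F X = F (scale_point r X)"

definition pointwise_mult ::
  "('d nc_point \<Rightarrow> complex mat) \<Rightarrow> ('d nc_point \<Rightarrow> complex mat) \<Rightarrow> 'd nc_point \<Rightarrow> complex mat" where
  "pointwise_mult F G X = F X * G X"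

definition pointwise_inverse :: "('d nc_point \<Rightarrow> complex mat) \<Rightarrow> 'd nc_point \<Rightarrow> complex mat" where
  "pointwise_inverse F X = the (mat_inverse (F X))"


section \<open>Operator balls and norms\<close>

text \<open>The Hilbert space tensor product of \<open>\<H>\<close> with \<open>\<complex>\<^sup>n\<close> is identified with the \<open>n\<close>-fold
  direct sum of \<open>\<H>\<close>, whose vectors are the families \<open>v 0, \<dots>, v (n - 1)\<close> normed by \<^const>\<open>L2_set\<close>.
  The operator tensor product of \<open>T\<close> with a matrix \<open>A\<close> then maps \<open>v\<close> to the family
  with \<open>i\<close>-th member \<open>\<Sum>b<n. A\<^sub>i\<^sub>b T (v b)\<close>.\<close>

fun pencil ::
  "('d::finite \<Rightarrow> 'h::complex_hilbert \<Rightarrow> 'h) \<Rightarrow> 'd nc_point \<Rightarrow> (nat \<Rightarrow> 'h) \<Rightarrow> nat \<Rightarrow> 'h" where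
  "pencil Q (n, X) v i = (\<Sum>j\<in>UNIV. \<Sum>b<n. scaleC (X j $$ (i, b)) (Q j (v b)))"

definition pencil_norm :: "('d::finite \<Rightarrow> 'h::complex_hilbert \<Rightarrow> 'h) \<Rightarrow> 'd nc_point \<Rightarrow> real" where
  "pencil_norm Q X =
     (SUP v\<in>{v. L2_set (\<lambda>i. norm (v i)) {..<fst X} \<le> 1}.
        L2_set (\<lambda>i. norm (pencil Q X v i)) {..<fst X})"

definition nc_ball :: "('d::finite \<Rightarrow> 'h::complex_hilbert \<Rightarrow> 'h) \<Rightarrow> 'd nc_point set" where
  "nc_ball Q = {X \<in> nc_universe. pencil_norm Q X < 1}"

definition cvec_norm :: "complex vec \<Rightarrow> real" where
  "cvec_norm v = L2_set (\<lambda>i. norm (v $ i)) {..<dim_vec v}"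

definition mat_op_norm :: "complex mat \<Rightarrow> real" where
  "mat_op_norm A = (SUP v\<in>{v \<in> carrier_vec (dim_col A). cvec_norm v \<le> 1}. cvec_norm (A *\<^sub>v v))"

definition ball_norm ::
  "('d::finite \<Rightarrow> 'h::complex_hilbert \<Rightarrow> 'h) \<Rightarrow> ('d nc_point \<Rightarrow> complex mat) \<Rightarrow> ennreal" where
  "ball_norm Q F = (SUP X\<in>nc_ball Q. ennreal (mat_op_norm (F X)))"

definition Q_stable :: "('d::finite \<Rightarrow> 'h::complex_hilbert \<Rightarrow> 'h) \<Rightarrow> 'd nc_poly mat \<Rightarrow> bool" where
  "Q_stable Q P \<longleftrightarrow> (\<forall>X\<in>nc_ball Q. det (nc_eval P X) \<noteq> 0)"

end

theory Submission
  imports Defs "Jordan_Normal_Form.Spectral_Radius"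
begin

text \<open>
For a monic linear pencil \<open>L = 1 - A(Z)\<close> whose resolvent satisfies
\<open>\<parallel>L(rX)\<^sup>-\<^sup>1\<parallel> \<le> C / (1 - r)\<close> on the ball, the claim is immediate, because
\<open>L(rX)\<^sup>-\<^sup>1 L(X) = 1 - (1 - r) L(rX)\<^sup>-\<^sup>1 A(X)\<close>. The proof passes from \<open>P\<close> to such a
pencil, with \<open>A\<close> an irreducible tuple of scalar matrices, and then derives the resolvent bound from
irreducibility.

Passage to a pencil. By Higman's trick \<open>P \<oplus> 1 = E (L \<oplus> 1) F\<close> with \<open>E\<close> and \<open>F\<close> invertible over the
free algebra. The outer factors are harmless: \<open>E(rX)\<^sup>-\<^sup>1 E(X)\<close> differs from \<open>1\<close> by a term of norm
\<open>O(1 - r)\<close>, which compensates the growth of the resolvent (\<open>dilation_estimates\<close>). Among all such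
representations take one in which \<open>A\<close> has least size. If \<open>A\<close> had a nontrivial invariant subspace,
\<open>L\<close> would be a product of two block matrices, hence \<open>P \<oplus> 1\<close> would be a product. Cohn's weak
algorithm completes unimodular rows over the free algebra to invertible matrices, and this turns the
factorization of \<open>P \<oplus> 1\<close> into one of \<open>P\<close> itself (\<open>atom_stably_atom\<close>). As \<open>P\<close> is an atom, one
factor is invertible, and the other one yields a smaller pencil. So \<open>A\<close> is irreducible
(\<open>irreducible_linearization\<close>).

The resolvent bound. Stability says that \<open>A(X)\<close> does not have the eigenvalue \<open>1\<close> for \<open>X\<close> in the
ball, so by homogeneity all eigenvalues of \<open>A(X)\<close> lie in the closed unit disc. Placing points
\<open>X\<^sub>1, \<dots>, X\<^sub>l\<close> in a cyclic block matrix gives the same for every product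
\<open>A(X\<^sub>1) \<cdots> A(X\<^sub>l)\<close> (\<open>product_no_large_eigenvalue\<close>). Let \<open>T = A(X)\<^sup>l\<close>, let \<open>\<xi>\<close>, \<open>\<eta>\<close> be unit vectors
of \<open>\<complex>\<^sup>n\<close>, and let \<open>T\<^bsub>\<xi>\<eta>\<^esub>\<close> be the matrix \<open>(1 \<otimes> \<eta>\<^sup>*) T (1 \<otimes> \<xi>)\<close> of the size of \<open>A\<close>. For a small
constant \<open>d\<close> and every word \<open>w\<close> the eigenvalues of \<open>d\<^sup>|\<^sup>w\<^sup>| T\<^bsub>\<xi>\<eta>\<^esub> A\<^sup>w\<close> are eigenvalues of a product of
the above kind, so the trace of \<open>T\<^bsub>\<xi>\<eta>\<^esub> A\<^sup>w\<close> is bounded by a constant that depends only on \<open>A\<close>, \<open>d\<close> and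
\<open>w\<close>. By Burnside's theorem finitely many \<open>A\<^sup>w\<close> span all matrices, so the entries of \<open>T\<^bsub>\<xi>\<eta>\<^esub>\<close> are bounded
uniformly in \<open>\<xi>\<close>, \<open>\<eta>\<close>, \<open>X\<close>, \<open>l\<close> and the size \<open>n\<close> of \<open>X\<close>. Thus the powers of \<open>A(X)\<close> are uniformly
bounded (\<open>irreducible_power_bounded\<close>), and a geometric series gives the bound for the resolvent.
\<close>

section \<open>Stable association of square matrices\<close>

lemma invertible_matI:
  assumes "A \<in> carrier_mat n n" "B \<in> carrier_mat n n" "A * B = 1\<^sub>m n" "B * A = 1\<^sub>m n"
  shows "invertible_mat A"
  using assms unfolding invertible_mat_def inverts_mat_def by auto

lemma invertible_matE:
  assumes "invertible_mat A" "A \<in> carrier_mat n n"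
  obtains B where "B \<in> carrier_mat n n" "A * B = 1\<^sub>m n" "B * A = 1\<^sub>m n"
proof -
  obtain B where B: "A * B = 1\<^sub>m (dim_row A)" "B * A = 1\<^sub>m (dim_row B)"
    using assms(1) unfolding invertible_mat_def inverts_mat_def by auto
  have "dim_col (A * B) = n" "dim_col (B * A) = dim_row B"
    using B assms(2) by auto
  then have "B \<in> carrier_mat n n" using assms(2) by auto
  with B assms(2) that show ?thesis by auto
qed

lemmas mult_square_blocks =
  mult_four_block_mat[where ?nr1.0 = n and ?n1.0 = n and ?n2.0 = m and ?nr2.0 = m and ?nc1.0 = n and ?nc2.0 = m]
  for n m

lemma invertible_mat_one: "invertible_mat (1\<^sub>m n)"
  by (rule invertible_matI[where n = n and B = "1\<^sub>m n"]) auto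

lemma mult_mat_cancel_middle:
  assumes "A \<in> carrier_mat n n" "B \<in> carrier_mat n n" "C \<in> carrier_mat n n" "D \<in> carrier_mat n n"
    and "B * C = 1\<^sub>m n"
  shows "(A * B) * (C * D) = A * (D :: 'a::ring_1 mat)"
proof -
  have "(A * B) * (C * D) = A * ((B * C) * D)"
    using assms(1-4) by (smt (verit) assoc_mult_mat mult_carrier_mat)
  then show ?thesis using assms by simp
qed

lemma invertible_mat_mult:
  fixes A B :: "'a::ring_1 mat"
  assumes A: "invertible_mat A" "A \<in> carrier_mat n n" and B: "invertible_mat B" "B \<in> carrier_mat n n"
  shows "invertible_mat (A * B)"
proof -
  obtain A' where A': "A' \<in> carrier_mat n n" "A * A' = 1\<^sub>m n" "A' * A = 1\<^sub>m n"
    using invertible_matE[OF A] .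
  obtain B' where B': "B' \<in> carrier_mat n n" "B * B' = 1\<^sub>m n" "B' * B = 1\<^sub>m n"
    using invertible_matE[OF B] .
  show ?thesis
    by (rule invertible_matI[where n = n and B = "B' * A'"])
      (use A B A' B' in \<open>auto simp: mult_mat_cancel_middle[where n = n]\<close>)
qed

lemma invertible_mat_cancel_right:
  fixes A B :: "'a::ring_1 mat"
  assumes AB: "invertible_mat (A * B)" and A: "A \<in> carrier_mat n n"
    and B: "invertible_mat B" "B \<in> carrier_mat n n"
  shows "invertible_mat A"
proof -
  obtain B' where B': "B' \<in> carrier_mat n n" "B * B' = 1\<^sub>m n" "B' * B = 1\<^sub>m n"
    using invertible_matE[OF B] .
  have "invertible_mat B'" by (rule invertible_matI[OF B'(1) B(2) B'(3,2)])
  then have "invertible_mat (A * B * B')"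
    using invertible_mat_mult[OF AB _ _ B'(1)] A B by auto
  moreover have "A * B * B' = A" using assoc_mult_mat[OF A B(2) B'(1)] B' A by simp
  ultimately show ?thesis by simp
qed

lemma invertible_mat_cancel_left:
  fixes A B :: "'a::ring_1 mat"
  assumes AB: "invertible_mat (A * B)" and A: "invertible_mat A" "A \<in> carrier_mat n n"
    and B: "B \<in> carrier_mat n n"
  shows "invertible_mat B"
proof -
  obtain A' where A': "A' \<in> carrier_mat n n" "A * A' = 1\<^sub>m n" "A' * A = 1\<^sub>m n"
    using invertible_matE[OF A] .
  have "invertible_mat A'" by (rule invertible_matI[OF A'(1) A(2) A'(3,2)])
  then have "invertible_mat (A' * (A * B))"
    using invertible_mat_mult[OF _ A'(1) AB] A B by auto
  moreover have "A' * (A * B) = B" using assoc_mult_mat[OF A'(1) A(2) B] A' B by simp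
  ultimately show ?thesis by simp
qed

text \<open>The direct sum of a square matrix with an identity matrix, described by the total size \<open>N\<close>: then
  padding twice is padding once, and the sizes of the identity blocks need no bookkeeping.\<close>

definition pad :: "nat \<Rightarrow> 'a::{zero,one} mat \<Rightarrow> 'a mat" where
  "pad N A = mat N N (\<lambda>(i, j). if i < dim_row A \<and> j < dim_row A then A $$ (i, j)
     else if i = j then 1 else 0)"

lemma pad_carrier[simp]: "pad N A \<in> carrier_mat N N"
  by (simp add: pad_def)

lemma dim_pad[simp]: "dim_row (pad N A) = N" "dim_col (pad N A) = N"
  by (simp_all add: pad_def)

lemma pad_conv_four_block:
  assumes "A \<in> carrier_mat n n"
  shows "pad (n + m) A = four_block_mat A (0\<^sub>m n m) (0\<^sub>m m n) (1\<^sub>m m)"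
  by (rule eq_matI) (use assms in \<open>auto simp: pad_def\<close>)

lemma pad_same: "A \<in> carrier_mat n n \<Longrightarrow> pad n A = A"
  by (rule eq_matI) (auto simp: pad_def)

lemma pad_one: "n \<le> N \<Longrightarrow> pad N (1\<^sub>m n) = 1\<^sub>m N"
  by (rule eq_matI) (auto simp: pad_def)

lemma pad_pad: "dim_row A \<le> M \<Longrightarrow> M \<le> N \<Longrightarrow> pad N (pad M A) = pad N A"
  by (rule eq_matI) (auto simp: pad_def)

lemma pad_mult:
  fixes A B :: "'a::ring_1 mat"
  assumes "A \<in> carrier_mat n n" "B \<in> carrier_mat n n" "n \<le> N"
  shows "pad N (A * B) = pad N A * pad N B"
proof -
  obtain m where N: "N = n + m" using assms(3) le_Suc_ex by blast
  show ?thesis unfolding N using assms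
    by (subst (1 2 3) pad_conv_four_block[where n = n])
      (auto simp: mult_square_blocks[where n = n and m = m])
qed

lemma invertible_mat_pad:
  fixes A :: "'a::ring_1 mat"
  assumes "A \<in> carrier_mat n n" "n \<le> N"
  shows "invertible_mat (pad N A) \<longleftrightarrow> invertible_mat A"
proof
  assume "invertible_mat A"
  then obtain B where B: "B \<in> carrier_mat n n" "A * B = 1\<^sub>m n" "B * A = 1\<^sub>m n"
    using assms by (elim invertible_matE)
  show "invertible_mat (pad N A)"
    by (rule invertible_matI[where n = N and B = "pad N B"])
      (use assms B in \<open>auto simp: pad_one simp flip: pad_mult\<close>)
next
  assume "invertible_mat (pad N A)"
  then obtain B where B: "B \<in> carrier_mat N N" "pad N A * B = 1\<^sub>m N" "B * pad N A = 1\<^sub>m N"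
    by (elim invertible_matE[where n = N]) auto
  obtain m where N: "N = n + m" using assms(2) le_Suc_ex by blast
  obtain b1 b2 b3 b4 where "split_block B n n = (b1, b2, b3, b4)"
    by (cases "split_block B n n") auto
  from split_block[OF this] B(1) N
  have b: "b1 \<in> carrier_mat n n" "b2 \<in> carrier_mat n m" "b3 \<in> carrier_mat m n" "b4 \<in> carrier_mat m m"
    "B = four_block_mat b1 b2 b3 b4" by auto
  have "pad N A * B = four_block_mat (A * b1) (A * b2) b3 b4"
    unfolding N b(5) pad_conv_four_block[OF assms(1)]
    by (subst mult_square_blocks[where n = n and m = m])
      (use b assms in auto)
  then have 1: "four_block_mat (A * b1) (A * b2) b3 b4 = 1\<^sub>m N" using B by simp
  have "B * pad N A = four_block_mat (b1 * A) b2 (b3 * A) b4"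
    unfolding N b(5) pad_conv_four_block[OF assms(1)]
    by (subst mult_square_blocks[where n = n and m = m])
      (use b assms in auto)
  then have 2: "four_block_mat (b1 * A) b2 (b3 * A) b4 = 1\<^sub>m N" using B by simp
  have "A * b1 = 1\<^sub>m n"
  proof (rule eq_matI)
    fix i j assume ij: "i < dim_row (1\<^sub>m n :: 'a mat)" "j < dim_col (1\<^sub>m n :: 'a mat)"
    have "four_block_mat (A * b1) (A * b2) b3 b4 $$ (i, j) = 1\<^sub>m N $$ (i, j)" using 1 by simp
    then show "(A * b1) $$ (i, j) = 1\<^sub>m n $$ (i, j)" using ij b assms(1) N by (simp del: index_mult_mat(1))
  qed (use assms b in auto)
  moreover have "b1 * A = 1\<^sub>m n"
  proof (rule eq_matI)
    fix i j assume ij: "i < dim_row (1\<^sub>m n :: 'a mat)" "j < dim_col (1\<^sub>m n :: 'a mat)"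
    have "four_block_mat (b1 * A) b2 (b3 * A) b4 $$ (i, j) = 1\<^sub>m N $$ (i, j)" using 2 by simp
    then show "(b1 * A) $$ (i, j) = 1\<^sub>m n $$ (i, j)" using ij b assms(1) N by (simp del: index_mult_mat(1))
  qed (use assms b in auto)
  ultimately show "invertible_mat A" using assms(1) b(1) by (intro invertible_matI[where n = n])
qed

text \<open>Stable association in the sense of Cohn, for square matrices: \<open>A \<oplus> 1\<close> and \<open>B \<oplus> 1\<close> agree up to
  invertible factors for suitable identity summands.\<close>

definition stably_assoc :: "'a::ring_1 mat \<Rightarrow> 'a mat \<Rightarrow> bool" where
  "stably_assoc A B \<longleftrightarrow> (\<exists>N E F. dim_row A \<le> N \<and> dim_row B \<le> N \<and>
     E \<in> carrier_mat N N \<and> F \<in> carrier_mat N N \<and> invertible_mat E \<and> invertible_mat F \<and>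
     pad N A = E * pad N B * F)"

lemma stably_assocI:
  fixes A B :: "'a::ring_1 mat"
  assumes "E \<in> carrier_mat N N" "F \<in> carrier_mat N N" "invertible_mat E" "invertible_mat F"
    "dim_row A \<le> N" "dim_row B \<le> N" "pad N A = E * pad N B * F"
  shows "stably_assoc A B"
  using assms unfolding stably_assoc_def by blast

lemma stably_assoc_enlarge:
  fixes A B :: "'a::ring_1 mat"
  assumes "stably_assoc A B"
  obtains N where "dim_row A \<le> N" "dim_row B \<le> N"
    "\<And>M. N \<le> M \<Longrightarrow> \<exists>E F. E \<in> carrier_mat M M \<and> F \<in> carrier_mat M M \<and> invertible_mat E \<and>
       invertible_mat F \<and> pad M A = E * pad M B * F"
proof -
  obtain N E F where NEF: "dim_row A \<le> N" "dim_row B \<le> N" "E \<in> carrier_mat N N" "F \<in> carrier_mat N N"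
    "invertible_mat E" "invertible_mat F" "pad N A = E * pad N B * F"
    using assms unfolding stably_assoc_def by blast
  have "\<exists>E F. E \<in> carrier_mat M M \<and> F \<in> carrier_mat M M \<and> invertible_mat E \<and>
       invertible_mat F \<and> pad M A = E * pad M B * F" if "N \<le> M" for M
  proof (intro exI conjI)
    have "pad M A = pad M (pad N A)" using NEF(1) that by (simp add: pad_pad)
    also have "\<dots> = pad M E * pad M (pad N B) * pad M F" unfolding NEF(7)
      using NEF that pad_mult[of "E * pad N B" N F M] pad_mult[of E N "pad N B" M]
        mult_carrier_mat[OF NEF(3) pad_carrier[of N B]] by simp
    also have "pad M (pad N B) = pad M B" using NEF(2) that by (simp add: pad_pad)
    finally show "pad M A = pad M E * pad M B * pad M F" .
  qed (use NEF that in \<open>auto simp: invertible_mat_pad[where n = N]\<close>)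
  with NEF that show ?thesis by blast
qed

lemma stably_assoc_trans:
  fixes A B C :: "'a::ring_1 mat"
  assumes "stably_assoc A B" "stably_assoc B C"
  shows "stably_assoc A C"
proof -
  obtain N where N: "dim_row A \<le> N" "dim_row B \<le> N"
    "\<And>M. N \<le> M \<Longrightarrow> \<exists>E F. E \<in> carrier_mat M M \<and> F \<in> carrier_mat M M \<and> invertible_mat E \<and>
       invertible_mat F \<and> pad M A = E * pad M B * F"
    using stably_assoc_enlarge[OF assms(1)] by metis
  obtain N' where N': "dim_row B \<le> N'" "dim_row C \<le> N'"
    "\<And>M. N' \<le> M \<Longrightarrow> \<exists>E F. E \<in> carrier_mat M M \<and> F \<in> carrier_mat M M \<and> invertible_mat E \<and>
       invertible_mat F \<and> pad M B = E * pad M C * F"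
    using stably_assoc_enlarge[OF assms(2)] by metis
  define M where "M = max N N'"
  obtain E F where EF: "E \<in> carrier_mat M M" "F \<in> carrier_mat M M" "invertible_mat E"
       "invertible_mat F" "pad M A = E * pad M B * F" using N(3)[of M] M_def by auto
  obtain E' F' where EF': "E' \<in> carrier_mat M M" "F' \<in> carrier_mat M M" "invertible_mat E'"
       "invertible_mat F'" "pad M B = E' * pad M C * F'" using N'(3)[of M] M_def by auto
  show ?thesis
  proof (rule stably_assocI[where N = M and E = "E * E'" and F = "F' * F"])
    have "pad M A = E * (E' * pad M C * F') * F" using EF EF' by simp
    also have "\<dots> = (E * E') * pad M C * (F' * F)"
      using EF(1,2) EF'(1,2) pad_carrier[of M C] by (smt (verit) assoc_mult_mat mult_carrier_mat)
    finally show "pad M A = (E * E') * pad M C * (F' * F)" .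
  qed (use EF EF' N N' M_def in \<open>auto intro: invertible_mat_mult\<close>)
qed

lemma stably_assoc_mult:
  fixes B :: "'a::ring_1 mat"
  assumes "B \<in> carrier_mat n n" "E \<in> carrier_mat n n" "F \<in> carrier_mat n n"
    "invertible_mat E" "invertible_mat F" "A = E * B * F"
  shows "stably_assoc A B"
  by (rule stably_assocI[of E n F]) (use assms in \<open>auto simp: pad_same[where n = n]\<close>)

lemma stably_assoc_pad:
  fixes A :: "'a::ring_1 mat"
  assumes "A \<in> carrier_mat n n" "n \<le> N"
  shows "stably_assoc A (pad N A)" "stably_assoc (pad N A) A"
  by (rule stably_assocI[of "1\<^sub>m N" N "1\<^sub>m N"];
      use assms in \<open>auto simp: pad_pad invertible_mat_one left_mult_one_mat[of _ N N] right_mult_one_mat[of _ N N]\<close>)+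

section \<open>The free algebra and its evaluations\<close>

abbreviation wcoeff :: "'d nc_poly \<Rightarrow> 'd list \<Rightarrow> complex" where
  "wcoeff p xs \<equiv> Poly_Mapping.lookup p (NCWord xs)"

lemma nc_poly_eqI: "(\<And>xs. wcoeff p xs = wcoeff q xs) \<Longrightarrow> p = q"
  by (rule poly_mapping_eqI) (metis nc_word.exhaust)

lemma nc_poly_sum_monomials:
  fixes p :: "'d nc_poly"
  shows "p = (\<Sum>w\<in>Poly_Mapping.keys p. Poly_Mapping.single w (Poly_Mapping.lookup p w))"
  by (rule poly_mapping_eqI)
    (auto simp: lookup_sum lookup_single when_def sum.delta[OF finite_keys] not_in_keys_iff_lookup_eq_zero)

lemma nc_poly_mult_expand:
  fixes p q :: "'d nc_poly"
  shows "p * q = (\<Sum>u\<in>Poly_Mapping.keys p. \<Sum>v\<in>Poly_Mapping.keys q.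
    Poly_Mapping.single (u + v) (Poly_Mapping.lookup p u * Poly_Mapping.lookup q v))"
proof -
  have "p * q = (\<Sum>u\<in>Poly_Mapping.keys p. Poly_Mapping.single u (Poly_Mapping.lookup p u)) *
      (\<Sum>v\<in>Poly_Mapping.keys q. Poly_Mapping.single v (Poly_Mapping.lookup q v))"
    by (rule arg_cong2[where f = "(*)", OF nc_poly_sum_monomials nc_poly_sum_monomials])
  then show ?thesis by (simp only: sum_product mult_single)
qed

lemma coeff_single: "wcoeff (Poly_Mapping.single (NCWord ys) c) xs = (if xs = ys then c else 0)"
  by (auto simp: lookup_single when_def)

lemma coeff_const: "wcoeff (Poly_Mapping.single 0 c) xs = (if xs = [] then c else 0)"
  by (simp add: zero_nc_word_def coeff_single)

lemma coeff_one: "wcoeff 1 xs = (if xs = [] then 1 else 0)"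
  by (simp add: coeff_const flip: single_one)

lemma sum_when_splits:
  fixes g :: "'d list \<Rightarrow> 'd list \<Rightarrow> complex"
  shows "(\<Sum>i\<le>length zs. if us = take i zs \<and> vs = drop i zs then c else 0) =
    (if zs = us @ vs then c else (0::complex))"
proof (cases "zs = us @ vs")
  case True
  have "(\<Sum>i\<le>length zs. if us = take i zs \<and> vs = drop i zs then c else 0) =
      (\<Sum>i\<le>length zs. if i = length us then c else 0)"
  proof (rule sum.cong[OF refl])
    fix i assume "i \<in> {..length zs}"
    then show "(if us = take i zs \<and> vs = drop i zs then c else 0) = (if i = length us then c else 0)"
      unfolding True by (auto dest: arg_cong[where f = length])
  qed
  then show ?thesis using True by simp
next
  case False
  then have "(if us = take i zs \<and> vs = drop i zs then c else 0) = 0" for i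
    using append_take_drop_id[of i zs] by auto
  then show ?thesis using False by simp
qed

lemma coeff_mult:
  "wcoeff (p * q) zs = (\<Sum>i\<le>length zs. wcoeff p (take i zs) * wcoeff q (drop i zs))"
proof -
  let ?P = "Poly_Mapping.keys p" and ?Q = "Poly_Mapping.keys q"
  let ?l = "Poly_Mapping.lookup"
  have ex: "wcoeff r xs = (\<Sum>u\<in>Poly_Mapping.keys r. if letters u = xs then ?l r u else 0)" for r :: "'a nc_poly" and xs
  proof -
    have "(letters u = xs) = (u = NCWord xs)" for u by (cases u) auto
    then show ?thesis
      by (simp add: sum.delta[OF finite_keys] not_in_keys_iff_lookup_eq_zero)
  qed
  have "p * q = (\<Sum>u\<in>?P. \<Sum>v\<in>?Q. Poly_Mapping.single (u + v) (?l p u * ?l q v))"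
    by (rule nc_poly_mult_expand)
  then have "wcoeff (p * q) zs = (\<Sum>u\<in>?P. \<Sum>v\<in>?Q. if zs = letters u @ letters v then ?l p u * ?l q v else 0)"
    by (simp add: lookup_sum lookup_single when_def plus_nc_word_def eq_commute[of _ "NCWord zs"])
  also have "\<dots> = (\<Sum>u\<in>?P. \<Sum>v\<in>?Q. \<Sum>i\<le>length zs.
      if letters u = take i zs \<and> letters v = drop i zs then ?l p u * ?l q v else 0)"
    by (simp only: sum_when_splits)
  also have "\<dots> = (\<Sum>u\<in>?P. \<Sum>i\<le>length zs. \<Sum>v\<in>?Q.
      if letters u = take i zs \<and> letters v = drop i zs then ?l p u * ?l q v else 0)"
    by (rule sum.cong[OF refl], rule sum.swap)
  also have "\<dots> = (\<Sum>i\<le>length zs. \<Sum>u\<in>?P. \<Sum>v\<in>?Q.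
      if letters u = take i zs \<and> letters v = drop i zs then ?l p u * ?l q v else 0)"
    by (rule sum.swap)
  also have "\<dots> = (\<Sum>i\<le>length zs. wcoeff p (take i zs) * wcoeff q (drop i zs))"
    unfolding ex[of p] ex[of q] sum_product
    by (intro sum.cong refl) auto
  finally show ?thesis .
qed

lemma coeff_mult_const: "wcoeff (p * Poly_Mapping.single 0 c) xs = wcoeff p xs * c"
proof -
  have "wcoeff (p * Poly_Mapping.single 0 c) xs =
    (\<Sum>i\<le>length xs. if i = length xs then wcoeff p xs * c else 0)"
    unfolding coeff_mult by (rule sum.cong) (auto simp: coeff_const)
  then show ?thesis by simp
qed

text \<open>The transduction that keeps the words ending in \<open>ys\<close> and removes this ending. It extracts the
  right cofactor of a letter in the linearization, and it is the division step of the weak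
  algorithm.\<close>

definition rstrip :: "'d list \<Rightarrow> 'd nc_poly \<Rightarrow> 'd nc_poly" where
  "rstrip ys p = Poly_Mapping.map_key (\<lambda>v. v + NCWord ys) p"

lemma coeff_rstrip: "wcoeff (rstrip ys p) xs = wcoeff p (xs @ ys)"
proof -
  have "inj (\<lambda>v. v + NCWord ys)"
    by (auto simp: inj_on_def plus_nc_word_def) (metis nc_word.exhaust_sel)
  then show ?thesis by (simp add: rstrip_def map_key.rep_eq plus_nc_word_def)
qed

text \<open>Degree plus one, so that the zero polynomial has its own value.\<close>

definition deg1 :: "'d nc_poly \<Rightarrow> nat" where
  "deg1 p = (LEAST D. \<forall>xs. wcoeff p xs \<noteq> 0 \<longrightarrow> length xs < D)"

lemma deg1_bound_ex: "\<exists>D. \<forall>xs. wcoeff p xs \<noteq> 0 \<longrightarrow> length xs < D"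
proof -
  have "finite ((length \<circ> letters) ` Poly_Mapping.keys p)" by simp
  then obtain D where D: "\<forall>x\<in>(length \<circ> letters) ` Poly_Mapping.keys p. x < D"
    by (metis finite_nat_set_iff_bounded)
  have "length xs < D" if "wcoeff p xs \<noteq> 0" for xs
    using D[rule_format, of "length xs"] that
    by (metis comp_apply image_eqI in_keys_iff nc_word.sel)
  then show ?thesis by auto
qed

lemma deg1_gt: "wcoeff p xs \<noteq> 0 \<Longrightarrow> length xs < deg1 p"
  using LeastI_ex[OF deg1_bound_ex, of p] unfolding deg1_def by blast

lemma deg1_le: "(\<And>xs. wcoeff p xs \<noteq> 0 \<Longrightarrow> length xs < D) \<Longrightarrow> deg1 p \<le> D"
  unfolding deg1_def by (rule Least_le) blast

lemma deg1_eq_0: "deg1 p = 0 \<longleftrightarrow> p = 0"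
  by (metis deg1_gt deg1_le le_zero_eq lookup_zero nc_poly_eqI not_less0)

lemma deg1_attained:
  assumes "p \<noteq> 0" obtains xs where "wcoeff p xs \<noteq> 0" "deg1 p = Suc (length xs)"
proof -
  obtain e where e: "deg1 p = Suc e" using assms deg1_eq_0 not0_implies_Suc by blast
  have "\<not> deg1 p \<le> e" using e by simp
  then obtain xs where "wcoeff p xs \<noteq> 0" "\<not> length xs < e" using deg1_le[of p e] by blast
  with deg1_gt[of p xs] e that show ?thesis by force
qed

lemma coeff_mult_top:
  assumes "p \<noteq> 0" "q \<noteq> 0" "length zs + 2 \<ge> deg1 p + deg1 q" "length xs + 1 = deg1 p"
   "zs = xs @ ys" 
  shows "wcoeff (p * q) zs = wcoeff p xs * wcoeff q ys"
proof -
  have "wcoeff (p * q) zs = (\<Sum>i\<le>length zs. if i = length xs then wcoeff p xs * wcoeff q ys else 0)"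
    unfolding coeff_mult
  proof (rule sum.cong[OF refl])
    fix i assume i: "i \<in> {..length zs}"
    show "wcoeff p (take i zs) * wcoeff q (drop i zs) =
      (if i = length xs then wcoeff p xs * wcoeff q ys else 0)"
    proof (cases "i = length xs")
      case False
      have "wcoeff p (take i zs) = 0 \<or> wcoeff q (drop i zs) = 0"
        using deg1_gt[of p "take i zs"] deg1_gt[of q "drop i zs"] False assms i
        by (cases "i < length xs") auto
      then show ?thesis using False by auto
    qed (simp add: assms)
  qed
  then show ?thesis using assms by simp
qed

definition ev :: "nat \<Rightarrow> ('d \<Rightarrow> complex mat) \<Rightarrow> 'd nc_poly \<Rightarrow> complex mat" where
  "ev n X p = mat n n (\<lambda>(a, b). \<Sum>w\<in>Poly_Mapping.keys p.
     Poly_Mapping.lookup p w * word_eval n X w $$ (a, b))"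

lemma ev_carrier[simp]: "ev n X p \<in> carrier_mat n n" by (simp add: ev_def)

lemma dim_ev[simp]: "dim_row (ev n X p) = n" "dim_col (ev n X p) = n" by (simp_all add: ev_def)

lemma word_eval_carrier:
  assumes "\<forall>j. X j \<in> carrier_mat n n" shows "word_eval n X w \<in> carrier_mat n n"
proof -
  have "foldr (\<lambda>j A. X j * A) xs (1\<^sub>m n) \<in> carrier_mat n n" for xs
    by (induction xs) (use assms in \<open>auto intro!: mult_carrier_mat\<close>)
  then show ?thesis by (simp add: word_eval_def)
qed

lemma word_eval_Nil: "word_eval n X (NCWord []) = 1\<^sub>m n"
  by (simp add: word_eval_def)

lemma word_eval_Cons: "word_eval n X (NCWord (j # xs)) = X j * word_eval n X (NCWord xs)"
  by (simp add: word_eval_def)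

lemma word_eval_plus:
  assumes X: "\<forall>j. X j \<in> carrier_mat n n"
  shows "word_eval n X (u + v) = word_eval n X u * word_eval n X v"
proof -
  have "word_eval n X (NCWord (xs @ ys)) = word_eval n X (NCWord xs) * word_eval n X (NCWord ys)" for xs ys
  proof (induction xs)
    case Nil
    then show ?case using word_eval_carrier[OF X, of "NCWord ys"] by (simp add: word_eval_Nil)
  next
    case (Cons j xs)
    then show ?case
      using assoc_mult_mat[OF X[rule_format] word_eval_carrier[OF X, of "NCWord xs"] word_eval_carrier[OF X, of "NCWord ys"]]
      by (simp add: word_eval_Cons)
  qed
  then show ?thesis by (cases u; cases v) (simp add: plus_nc_word_def)
qed

lemma ev_superset:
  assumes "finite S" "Poly_Mapping.keys p \<subseteq> S" "a < n" "b < n"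
  shows "ev n X p $$ (a, b) = (\<Sum>w\<in>S. Poly_Mapping.lookup p w * word_eval n X w $$ (a, b))"
  unfolding ev_def using assms
  by (auto simp: in_keys_iff intro!: sum.mono_neutral_left)

lemma ev_add: "a < n \<Longrightarrow> b < n \<Longrightarrow> ev n X (p + q) $$ (a, b) = ev n X p $$ (a, b) + ev n X q $$ (a, b)"
  using Poly_Mapping.keys_add[of p q]
  by (simp add: ev_superset[where S = "Poly_Mapping.keys p \<union> Poly_Mapping.keys q"] lookup_add
      distrib_right sum.distrib)

lemma ev_zero[simp]: "a < n \<Longrightarrow> b < n \<Longrightarrow> ev n X 0 $$ (a, b) = 0"
  by (simp add: ev_def)

lemma ev_sum: "a < n \<Longrightarrow> b < n \<Longrightarrow> ev n X (sum f S) $$ (a, b) = (\<Sum>s\<in>S. ev n X (f s) $$ (a, b))"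
  by (induction S rule: infinite_finite_induct) (auto simp: ev_add)

lemma ev_single: "a < n \<Longrightarrow> b < n \<Longrightarrow> ev n X (Poly_Mapping.single w c) $$ (a, b) = c * word_eval n X w $$ (a, b)"
  by (subst ev_superset[where S = "{w}"]) auto

lemma ev_uminus: "a < n \<Longrightarrow> b < n \<Longrightarrow> ev n X (- p) $$ (a, b) = - ev n X p $$ (a, b)"
  using ev_add[of a n b X p "- p"] by (simp add: eq_neg_iff_add_eq_0 add.commute)

lemma ev_diff: "a < n \<Longrightarrow> b < n \<Longrightarrow> ev n X (p - q) $$ (a, b) = ev n X p $$ (a, b) - ev n X q $$ (a, b)"
  using ev_add[of a n b X p "- q"] by (simp add: ev_uminus)

lemma ev_const: "ev n X (Poly_Mapping.single 0 c) = c \<cdot>\<^sub>m 1\<^sub>m n"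
  by (rule eq_matI) (auto simp: ev_single zero_nc_word_def word_eval_Nil)

lemma ev_one: "ev n X 1 = 1\<^sub>m n"
  using ev_const[of n X 1] by (auto simp flip: single_one intro!: eq_matI)

lemma ev_mult:
  assumes X: "\<forall>j. X j \<in> carrier_mat n n"
  shows "ev n X (p * q) = ev n X p * ev n X q"
proof (rule eq_matI)
  fix a b assume "a < dim_row (ev n X p * ev n X q)" "b < dim_col (ev n X p * ev n X q)"
  then have ab: "a < n" "b < n" by auto
  let ?P = "Poly_Mapping.keys p" and ?Q = "Poly_Mapping.keys q"
  let ?l = "Poly_Mapping.lookup"
  have W: "dim_row (word_eval n X w) = n" "dim_col (word_eval n X w) = n" for w
    using word_eval_carrier[OF X, of w] by auto
  have "p * q = (\<Sum>u\<in>?P. \<Sum>v\<in>?Q. Poly_Mapping.single (u + v) (?l p u * ?l q v))"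
    by (rule nc_poly_mult_expand)
  then have "ev n X (p * q) $$ (a, b) =
      (\<Sum>u\<in>?P. \<Sum>v\<in>?Q. ?l p u * ?l q v * (\<Sum>c<n. word_eval n X u $$ (a, c) * word_eval n X v $$ (c, b)))"
    using ab by (simp add: ev_sum ev_single word_eval_plus[OF X] scalar_prod_def W lessThan_atLeast0)
  also have "\<dots> = (\<Sum>u\<in>?P. \<Sum>v\<in>?Q. \<Sum>c<n. (?l p u * word_eval n X u $$ (a, c)) * (?l q v * word_eval n X v $$ (c, b)))"
    by (simp add: sum_distrib_left mult_ac)
  also have "\<dots> = (\<Sum>u\<in>?P. \<Sum>c<n. \<Sum>v\<in>?Q. (?l p u * word_eval n X u $$ (a, c)) * (?l q v * word_eval n X v $$ (c, b)))"
    by (rule sum.cong[OF refl], rule sum.swap)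
  also have "\<dots> = (\<Sum>c<n. \<Sum>u\<in>?P. \<Sum>v\<in>?Q. (?l p u * word_eval n X u $$ (a, c)) * (?l q v * word_eval n X v $$ (c, b)))"
    by (rule sum.swap)
  also have "\<dots> = (\<Sum>c<n. ev n X p $$ (a, c) * ev n X q $$ (c, b))"
    using ab by (simp add: ev_def sum_product)
  also have "\<dots> = (ev n X p * ev n X q) $$ (a, b)"
    using ab by (simp add: scalar_prod_def lessThan_atLeast0)
  finally show "ev n X (p * q) $$ (a, b) = (ev n X p * ev n X q) $$ (a, b)" .
qed auto

lemma sum_div_mod:
  fixes f :: "nat \<Rightarrow> nat \<Rightarrow> 'a::comm_monoid_add"
  shows "(\<Sum>l<c * n. f (l div n) (l mod n)) = (\<Sum>q<c. \<Sum>b<n. f q b)"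
proof (induction c)
  case (Suc c)
  have "{..<Suc c * n} = {..<c * n} \<union> {c * n..<c * n + n}" by auto
  then have sp: "(\<Sum>l<Suc c * n. f (l div n) (l mod n)) =
      (\<Sum>l<c * n. f (l div n) (l mod n)) + (\<Sum>l\<in>{c * n..<c * n + n}. f (l div n) (l mod n))"
    by (simp add: sum.union_disjoint ivl_disj_int)
  have dm: "a div n = c" "a mod n = a - c * n" if "c * n \<le> a" "a < c * n + n" for a
  proof -
    show "a div n = c" using that by (intro div_nat_eqI) (auto simp: mult.commute)
    then show "a mod n = a - c * n" by (simp add: modulo_nat_def)
  qed
  have "(\<Sum>l\<in>{c * n..<c * n + n}. f (l div n) (l mod n)) = (\<Sum>b<n. f c b)"
    by (rule sum.reindex_bij_witness[where i = "\<lambda>b. c * n + b" and j = "\<lambda>l. l - c * n"])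
      (auto simp: dm)
  then show ?case using Suc sp by simp
qed simp

lemma nc_eval_dim[simp]:
  "dim_row (nc_eval P (n, X)) = dim_row P * n" "dim_col (nc_eval P (n, X)) = dim_col P * n"
  by auto

lemma nc_eval_carrier: "P \<in> carrier_mat r c \<Longrightarrow> nc_eval P (n, X) \<in> carrier_mat (r * n) (c * n)"
  by auto

lemma div_mod_less: 
  fixes i :: nat
  assumes "i < r * n" shows "i div n < r" "i mod n < n"
proof -
  show "i div n < r" using assms by (rule less_mult_imp_div_less)
  have "n > 0" using assms by (cases n) auto
  then show "i mod n < n" by simp
qed

text \<open>The rows and columns of \<open>nc_eval P (n, X)\<close> are numbered by \<open>p * n + a\<close>, so it is the block matrix of
  the evaluations of the entries of \<open>P\<close>. Everything about evaluations goes through the ring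
  homomorphism \<open>ev n X\<close>.\<close>

lemma nc_eval_index:
  assumes X: "\<forall>j. X j \<in> carrier_mat n n" and ij: "i < dim_row P * n" "j < dim_col P * n"
  shows "nc_eval P (n, X) $$ (i, j) = ev n X (P $$ (i div n, j div n)) $$ (i mod n, j mod n)"
proof -
  have W: "dim_row (word_eval n X w) = n" "dim_col (word_eval n X w) = n" for w
    using word_eval_carrier[OF X, of w] by auto
  have fin: "finite (mat_words P)" by (simp add: mat_words_def elements_mat_def)
  have sub: "Poly_Mapping.keys (P $$ (i div n, j div n)) \<subseteq> mat_words P"
    using div_mod_less[OF ij(1)] div_mod_less[OF ij(2)] by (force simp: mat_words_def elements_mat_def)
  show ?thesis
    using ij div_mod_less[OF ij(1)] div_mod_less[OF ij(2)]
    by (subst ev_superset[OF fin sub]) (auto simp: kronecker_def mat_coeff_def W)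
qed

lemma nc_eval_mult:
  assumes X: "\<forall>j. X j \<in> carrier_mat n n" and F: "F \<in> carrier_mat r c" and G: "G \<in> carrier_mat c s"
  shows "nc_eval (F * G) (n, X) = nc_eval F (n, X) * nc_eval G (n, X)"
proof (rule eq_matI)
  fix i j assume "i < dim_row (nc_eval F (n, X) * nc_eval G (n, X))"
    "j < dim_col (nc_eval F (n, X) * nc_eval G (n, X))"
  then have ij: "i < r * n" "j < s * n" using F G by auto
  note d = div_mod_less[OF ij(1)] div_mod_less[OF ij(2)]
  have "(nc_eval F (n, X) * nc_eval G (n, X)) $$ (i, j) =
      (\<Sum>l<c * n. nc_eval F (n, X) $$ (i, l) * nc_eval G (n, X) $$ (l, j))"
    using ij F G by (simp add: scalar_prod_def lessThan_atLeast0 del: nc_eval.simps)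
  also have "\<dots> = (\<Sum>l<c * n. ev n X (F $$ (i div n, l div n)) $$ (i mod n, l mod n) *
      ev n X (G $$ (l div n, j div n)) $$ (l mod n, j mod n))"
    by (rule sum.cong[OF refl]) (use ij F G in \<open>simp add: nc_eval_index[OF X] del: nc_eval.simps\<close>)
  also have "\<dots> = (\<Sum>q<c. \<Sum>b<n. ev n X (F $$ (i div n, q)) $$ (i mod n, b) *
      ev n X (G $$ (q, j div n)) $$ (b, j mod n))"
    by (rule sum_div_mod)
  also have "\<dots> = (\<Sum>q<c. ev n X (F $$ (i div n, q) * G $$ (q, j div n)) $$ (i mod n, j mod n))"
    using d by (simp add: ev_mult[OF X] scalar_prod_def lessThan_atLeast0)
  also have "\<dots> = ev n X ((F * G) $$ (i div n, j div n)) $$ (i mod n, j mod n)"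
    using d F G by (simp add: ev_sum scalar_prod_def lessThan_atLeast0)
  also have "\<dots> = nc_eval (F * G) (n, X) $$ (i, j)"
    using ij F G by (simp add: nc_eval_index[OF X] del: nc_eval.simps index_mult_mat(1))
  finally show "nc_eval (F * G) (n, X) $$ (i, j) = (nc_eval F (n, X) * nc_eval G (n, X)) $$ (i, j)"
    by simp
qed (use F G in auto)

lemma nc_eval_pad:
  assumes X: "\<forall>j. X j \<in> carrier_mat n n" and A: "A \<in> carrier_mat m m"
  shows "nc_eval (pad N A) (n, X) = pad (N * n) (nc_eval A (n, X))"
proof (rule eq_matI)
  fix i j assume "i < dim_row (pad (N * n) (nc_eval A (n, X)))" "j < dim_col (pad (N * n) (nc_eval A (n, X)))"
  then have ij: "i < N * n" "j < N * n" by auto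
  note d = div_mod_less[OF ij(1)] div_mod_less[OF ij(2)]
  have lt: "i < m * n \<longleftrightarrow> i div n < m" for i
    using d(2) by (auto simp: div_less_iff_less_mult)
  have eq: "(i div n = j div n \<and> i mod n = j mod n) = (i = j)"
    by (metis div_mult_mod_eq)
  show "nc_eval (pad N A) (n, X) $$ (i, j) = pad (N * n) (nc_eval A (n, X)) $$ (i, j)"
    using ij d A eq
    by (auto simp: nc_eval_index[OF X] pad_def lt ev_one[of n X] simp del: nc_eval.simps)
qed auto

lemma nc_eval_one:
  assumes X: "\<forall>j. X j \<in> carrier_mat n n"
  shows "nc_eval (1\<^sub>m N) (n, X) = 1\<^sub>m (N * n)"
  using nc_eval_pad[of X n "1\<^sub>m 0" 0 N] X by (simp add: pad_one del: nc_eval.simps) (simp add: pad_def one_mat_def)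

lemma nc_eval_invertible:
  assumes X: "\<forall>j. X j \<in> carrier_mat n n" and A: "A \<in> carrier_mat N N" "invertible_mat A"
  shows "invertible_mat (nc_eval A (n, X))"
proof -
  obtain B where B: "B \<in> carrier_mat N N" "A * B = 1\<^sub>m N" "B * A = 1\<^sub>m N"
    using invertible_matE[OF A(2,1)] .
  show ?thesis
    by (rule invertible_matI[where n = "N * n" and B = "nc_eval B (n, X)"])
      (use A B in \<open>simp_all add: nc_eval_one[OF X] nc_eval_mult[OF X, symmetric] del: nc_eval.simps add: nc_eval_carrier\<close>)
qed

section \<open>Linearization\<close>

lemma coeff_mult_letter:
  "wcoeff (p * Poly_Mapping.single (NCWord [j]) 1) zs =
     (if zs \<noteq> [] \<and> last zs = j then wcoeff p (butlast zs) else 0)"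
proof (cases zs rule: rev_cases)
  case Nil
  then show ?thesis by (simp add: coeff_mult coeff_single)
next
  case (snoc ys l)
  have d: "drop i (ys @ [l]) = [j] \<longleftrightarrow> i = length ys \<and> l = j" if "i \<le> Suc (length ys)" for i
    using that by (cases "i \<le> length ys"; cases "drop i ys") auto
  have "wcoeff (p * Poly_Mapping.single (NCWord [j]) 1) zs =
      (\<Sum>i\<le>length zs. if i = length ys then (if l = j then wcoeff p ys else 0) else 0)"
    unfolding coeff_mult by (rule sum.cong) (auto simp: coeff_single snoc d simp del: drop_append)
  then show ?thesis by (auto simp: snoc)
qed

lemma nc_poly_decompose_last_letter:
  fixes p :: "'d::finite nc_poly"
  shows "p = Poly_Mapping.single 0 (wcoeff p []) +
    (\<Sum>j\<in>UNIV. rstrip [j] p * Poly_Mapping.single (NCWord [j]) 1)"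
proof (rule nc_poly_eqI)
  fix xs
  show "wcoeff p xs = wcoeff (Poly_Mapping.single 0 (wcoeff p []) +
    (\<Sum>j\<in>UNIV. rstrip [j] p * Poly_Mapping.single (NCWord [j]) 1)) xs"
    by (cases xs rule: rev_cases)
      (auto simp: lookup_add lookup_sum coeff_mult_letter coeff_rstrip coeff_const)
qed

lemma deg1_rstrip: "deg1 p \<le> Suc D \<Longrightarrow> deg1 (rstrip [j] p) \<le> D"
  by (rule deg1_le) (use deg1_gt[of p] in \<open>force simp: coeff_rstrip\<close>)

lemma deg1_single: "deg1 (Poly_Mapping.single (NCWord ys) c) \<le> Suc (length ys)"
  by (rule deg1_le) (auto simp: coeff_single split: if_splits)

lemma deg1_zero[simp]: "deg1 0 = 0" by (simp add: deg1_eq_0)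

lemma deg1_one: "deg1 1 \<le> 1"
  by (rule deg1_le) (auto simp: coeff_one split: if_splits)

lemma deg1_uminus[simp]: "deg1 (- p) = deg1 p"
  by (simp add: deg1_def)

lemma uminus_r_inv_mat:
  fixes a :: "'a::group_add mat" shows "a \<in> carrier_mat n m \<Longrightarrow> a + - a = 0\<^sub>m n m"
  by (rule eq_matI) auto

lemma uminus_zero_mat[simp]: "- 0\<^sub>m n m = (0\<^sub>m n m :: 'a::group_add mat)"
  by (rule eq_matI) auto

lemma invertible_upper_unipotent:
  fixes a :: "'a::ring_1 mat"
  assumes "a \<in> carrier_mat n m"
  shows "invertible_mat (four_block_mat (1\<^sub>m n) a (0\<^sub>m m n) (1\<^sub>m m))"
  by (rule invertible_matI[where n = "n + m" and B = "four_block_mat (1\<^sub>m n) (- a) (0\<^sub>m m n) (1\<^sub>m m)"])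
    (use assms in \<open>auto simp: uminus_l_inv_mat uminus_r_inv_mat mult_square_blocks[where n = n and m = m]\<close>)

lemma invertible_lower_unipotent:
  fixes a :: "'a::ring_1 mat"
  assumes "a \<in> carrier_mat m n"
  shows "invertible_mat (four_block_mat (1\<^sub>m n) (0\<^sub>m n m) a (1\<^sub>m m))"
  by (rule invertible_matI[where n = "n + m" and B = "four_block_mat (1\<^sub>m n) (0\<^sub>m n m) (- a) (1\<^sub>m m)"])
    (use assms in \<open>auto simp: uminus_l_inv_mat uminus_r_inv_mat mult_square_blocks[where n = n and m = m]\<close>)

text \<open>Higman's trick: a product inside a matrix is resolved at the cost of a larger matrix. With
  \<open>a\<close> and \<open>b\<close> of lower degree than \<open>a * b\<close> this lowers degrees.\<close>

lemma stably_assoc_higman: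
  fixes f :: "'a::ring_1 mat"
  assumes f: "f \<in> carrier_mat n n" and a: "a \<in> carrier_mat n m" and b: "b \<in> carrier_mat m n"
  shows "stably_assoc (f + a * b) (four_block_mat f (- a) b (1\<^sub>m m))"
proof (rule stably_assocI)
  let ?E = "four_block_mat (1\<^sub>m n) a (0\<^sub>m m n) (1\<^sub>m m)"
  let ?F = "four_block_mat (1\<^sub>m n) (0\<^sub>m n m) (- b) (1\<^sub>m m)"
  let ?B = "four_block_mat f (- a) b (1\<^sub>m m)"
  have "?E * ?B = four_block_mat (f + a * b) (0\<^sub>m n m) b (1\<^sub>m m)"
    by (subst mult_square_blocks[where n = n and m = m])
      (use assms in \<open>auto simp: uminus_l_inv_mat\<close>)
  also have "\<dots> * ?F = four_block_mat (f + a * b) (0\<^sub>m n m) (0\<^sub>m m n) (1\<^sub>m m)"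
    by (subst mult_square_blocks[where n = n and m = m])
      (use assms in \<open>auto simp: uminus_r_inv_mat\<close>)
  also have "\<dots> = pad (n + m) (f + a * b)"
    by (rule pad_conv_four_block[symmetric]) (use assms in auto)
  finally show "pad (n + m) (f + a * b) = ?E * pad (n + m) ?B * ?F"
    using assms by (subst pad_same[of ?B "n + m"]) auto
qed (use assms invertible_upper_unipotent[OF a] invertible_lower_unipotent[of "- b" m n] in auto)

lemma linearization_step:
  fixes F :: "'d::finite nc_poly mat"
  assumes F: "F \<in> carrier_mat n n" and deg: "\<And>i j. i < n \<Longrightarrow> j < n \<Longrightarrow> deg1 (F $$ (i, j)) \<le> Suc D"
    and D: "D \<ge> 2"
  shows "\<exists>n' F'. F' \<in> carrier_mat n' n' \<and> stably_assoc F F' \<and>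
    (\<forall>i<n'. \<forall>j<n'. deg1 (F' $$ (i, j)) \<le> D)"
proof -
  define c where "c = card (UNIV :: 'd set)"
  obtain e :: "nat \<Rightarrow> 'd" where e: "bij_betw e {..<c} UNIV"
    using ex_bij_betw_nat_finite[of "UNIV :: 'd set"] by (auto simp: c_def lessThan_atLeast0)
  \<comment> \<open>The constant term, and the cofactors of the last letters: entrywise this is \<open>nc_poly_decompose_last_letter\<close>.\<close>
  define f :: "'d nc_poly mat" where "f = mat n n (\<lambda>(i, j). Poly_Mapping.single 0 (wcoeff (F $$ (i, j)) []))"
  define a :: "'d nc_poly mat" where "a = mat n (c * n) (\<lambda>(i, l). rstrip [e (l div n)] (F $$ (i, l mod n)))"
  define b :: "'d nc_poly mat" where "b = mat (c * n) n (\<lambda>(l, j). if l mod n = j then Poly_Mapping.single (NCWord [e (l div n)]) 1 else 0)"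
  have car: "f \<in> carrier_mat n n" "a \<in> carrier_mat n (c * n)" "b \<in> carrier_mat (c * n) n"
    by (auto simp: f_def a_def b_def)
  have "F = f + a * b"
  proof (rule eq_matI)
    fix i j assume "i < dim_row (f + a * b)" "j < dim_col (f + a * b)"
    then have ij: "i < n" "j < n" using car by auto
    have "(a * b) $$ (i, j) = (\<Sum>l<c * n. rstrip [e (l div n)] (F $$ (i, l mod n)) *
        (if l mod n = j then Poly_Mapping.single (NCWord [e (l div n)]) 1 else 0))"
      using ij by (simp add: a_def b_def scalar_prod_def lessThan_atLeast0)
    also have "\<dots> = (\<Sum>q<c. \<Sum>s<n. rstrip [e q] (F $$ (i, s)) *
        (if s = j then Poly_Mapping.single (NCWord [e q]) 1 else 0))"
      by (rule sum_div_mod)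
    also have "\<dots> = (\<Sum>q<c. \<Sum>s<n. if s = j then rstrip [e q] (F $$ (i, j)) *
        Poly_Mapping.single (NCWord [e q]) 1 else 0)"
      by (intro sum.cong refl) auto
    also have "\<dots> = (\<Sum>q<c. rstrip [e q] (F $$ (i, j)) * Poly_Mapping.single (NCWord [e q]) 1)"
      using ij by simp
    also have "\<dots> = (\<Sum>l\<in>UNIV. rstrip [l] (F $$ (i, j)) * Poly_Mapping.single (NCWord [l]) 1)"
      by (rule sum.reindex_bij_betw[OF e])
    finally show "F $$ (i, j) = (f + a * b) $$ (i, j)"
      using ij car nc_poly_decompose_last_letter[of "F $$ (i, j)"] by (simp add: f_def)
  qed (use F car in auto)
  then have "stably_assoc F (four_block_mat f (- a) b (1\<^sub>m (c * n)))"
    using stably_assoc_higman[OF car] by simp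
  moreover have "deg1 (four_block_mat f (- a) b (1\<^sub>m (c * n)) $$ (i, j)) \<le> D"
    if "i < n + c * n" "j < n + c * n" for i j
  proof -
    have 1: "deg1 (f $$ (i, j)) \<le> D" if "i < n" "j < n" for i j
      using that deg1_single[of "[] :: 'd list" "wcoeff (F $$ (i, j)) []"] D by (auto simp: f_def zero_nc_word_def)
    have 2: "deg1 (a $$ (i, l)) \<le> D" if "i < n" "l < c * n" for i l
      using that div_mod_less[OF that(2)] by (auto simp: a_def intro!: deg1_rstrip deg)
    have 3: "deg1 (b $$ (l, j)) \<le> D" if "l < c * n" "j < n" for l j
      using that deg1_single[of "[e (l div n)]" 1] D by (auto simp: b_def intro: order.trans)
    have 4: "deg1 (1 :: 'd nc_poly) \<le> D" using deg1_one[where ?'a = 'd] D by linarith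
    show ?thesis using that car 1 2 3 4 by (auto simp: one_mat_def)
  qed
  ultimately show ?thesis using car
    by (intro exI[of _ "n + c * n"] exI[of _ "four_block_mat f (- a) b (1\<^sub>m (c * n))"]) auto
qed

lemma affine_linearization:
  fixes F :: "'d::finite nc_poly mat"
  assumes F: "F \<in> carrier_mat n n"
  shows "\<exists>n' F'. F' \<in> carrier_mat n' n' \<and> stably_assoc F F' \<and>
    (\<forall>i<n'. \<forall>j<n'. deg1 (F' $$ (i, j)) \<le> 2)"
proof -
  have "\<exists>n' F'. F' \<in> carrier_mat n' n' \<and> stably_assoc F F' \<and>
    (\<forall>i<n'. \<forall>j<n'. deg1 (F' $$ (i, j)) \<le> 2)"
    if "F \<in> carrier_mat n n" "\<And>i j. i < n \<Longrightarrow> j < n \<Longrightarrow> deg1 (F $$ (i, j)) \<le> D + 2"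
    for n and F :: "'d nc_poly mat" and D
    using that
  proof (induction D arbitrary: n F)
    case 0
    have "stably_assoc F F" using stably_assoc_pad[of F n n] pad_same[of F n] 0 by auto
    then show ?case using 0 by (intro exI[of _ n] exI[of _ F]) (simp add: numeral_2_eq_2)
  next
    case (Suc D)
    have "deg1 (F $$ (i, j)) \<le> Suc (D + 2)" if "i < n" "j < n" for i j
      using Suc.prems(2)[OF that] by simp
    from linearization_step[OF Suc.prems(1) this le_add2]
    obtain n' F' where F': "F' \<in> carrier_mat n' n'" "stably_assoc F F'"
      "\<forall>i<n'. \<forall>j<n'. deg1 (F' $$ (i, j)) \<le> D + 2"
      by metis
    from Suc.IH[OF F'(1) F'(3)[rule_format]] stably_assoc_trans[OF F'(2)] show ?case by blast
  qed
  moreover have "deg1 (F $$ (i, j)) \<le> (\<Sum>i<n. \<Sum>j<n. deg1 (F $$ (i, j))) + 2" if "i < n" "j < n" for i j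
  proof -
    have "deg1 (F $$ (i, j)) \<le> (\<Sum>j<n. deg1 (F $$ (i, j)))"
      by (rule member_le_sum) (use that in auto)
    also have "\<dots> \<le> (\<Sum>i<n. \<Sum>j<n. deg1 (F $$ (i, j)))"
      by (rule member_le_sum[of i "{..<n}" "\<lambda>i. \<Sum>j<n. deg1 (F $$ (i, j))"]) (use that in auto)
    finally show ?thesis by simp
  qed
  ultimately show ?thesis using F by blast
qed

definition lin :: "nat \<Rightarrow> ('d::finite \<Rightarrow> complex mat) \<Rightarrow> 'd nc_poly mat" where
  "lin m A = mat m m (\<lambda>(p, q). \<Sum>j\<in>UNIV. Poly_Mapping.single (NCWord [j]) (A j $$ (p, q)))"

lemma lin_carrier[simp]: "lin m A \<in> carrier_mat m m" by (simp add: lin_def)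

lemma dim_lin[simp]: "dim_row (lin m A) = m" "dim_col (lin m A) = m" by (simp_all add: lin_def)

abbreviation const_mat :: "complex mat \<Rightarrow> 'd nc_poly mat" where
  "const_mat M \<equiv> map_mat (Poly_Mapping.single 0) M"

lemma const_mat_mult:
  "dim_col M = dim_row N \<Longrightarrow> const_mat (M * N) = const_mat M * (const_mat N :: 'd nc_poly mat)"
proof (rule eq_matI)
  fix i j assume d: "dim_col M = dim_row N"
    and "i < dim_row (const_mat M * (const_mat N :: 'd nc_poly mat))"
    "j < dim_col (const_mat M * (const_mat N :: 'd nc_poly mat))"
  then have ij: "i < dim_row M" "j < dim_col N" by auto
  have *: "Poly_Mapping.single 0 (sum f S) = (\<Sum>s\<in>S. Poly_Mapping.single 0 (f s) :: 'd nc_poly)" for f :: "nat \<Rightarrow> complex" and S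
    by (induction S rule: infinite_finite_induct) (auto simp: single_add)
  show "const_mat (M * N) $$ (i, j) = (const_mat M * (const_mat N :: 'd nc_poly mat)) $$ (i, j)"
    using ij d by (simp add: scalar_prod_def * mult_single)
qed auto

lemma const_mat_one: "const_mat (1\<^sub>m n) = (1\<^sub>m n :: 'd nc_poly mat)"
  by (rule eq_matI) auto

lemma invertible_const_mat:
  assumes "S \<in> carrier_mat n n" "invertible_mat S"
  shows "invertible_mat (const_mat S :: 'd nc_poly mat)"
proof -
  obtain T where T: "T \<in> carrier_mat n n" "S * T = 1\<^sub>m n" "T * S = 1\<^sub>m n"
    using invertible_matE[OF assms(2,1)] .
  show ?thesis
    by (rule invertible_matI[where n = n and B = "const_mat T"])
      (use T assms in \<open>auto simp: const_mat_one simp flip: const_mat_mult\<close>)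
qed

lemma single_sum: "Poly_Mapping.single w (sum f S) = (\<Sum>s\<in>S. Poly_Mapping.single w (f s))"
  by (induction S rule: infinite_finite_induct) (auto simp: single_add)

lemma const_mat_mult_lin:
  assumes "S \<in> carrier_mat m m" "\<forall>j. A j \<in> carrier_mat m m"
  shows "const_mat S * lin m A = lin m (\<lambda>j. S * A j)"
proof (rule eq_matI)
  fix p q assume "p < dim_row (lin m (\<lambda>j. S * A j))" "q < dim_col (lin m (\<lambda>j. S * A j))"
  then have pq: "p < m" "q < m" by auto
  have A: "dim_row (A j) = m" "dim_col (A j) = m" for j using assms(2) by auto
  have "(const_mat S * lin m A) $$ (p, q) =
    (\<Sum>s<m. \<Sum>j\<in>UNIV. Poly_Mapping.single (NCWord [j]) (S $$ (p, s) * A j $$ (s, q)))"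
    using pq assms(1) by (simp add: scalar_prod_def lin_def sum_distrib_left mult_single lessThan_atLeast0)
  also have "\<dots> = (\<Sum>j\<in>UNIV. \<Sum>s<m. Poly_Mapping.single (NCWord [j]) (S $$ (p, s) * A j $$ (s, q)))"
    by (rule sum.swap)
  also have "\<dots> = lin m (\<lambda>j. S * A j) $$ (p, q)"
    using pq assms(1) A by (simp add: lin_def scalar_prod_def single_sum lessThan_atLeast0)
  finally show "(const_mat S * lin m A) $$ (p, q) = lin m (\<lambda>j. S * A j) $$ (p, q)" .
qed (use assms in auto)

lemma lin_mult_const_mat:
  assumes "S \<in> carrier_mat m m" "\<forall>j. A j \<in> carrier_mat m m"
  shows "lin m A * const_mat S = lin m (\<lambda>j. A j * S)"
proof (rule eq_matI)
  fix p q assume "p < dim_row (lin m (\<lambda>j. A j * S))" "q < dim_col (lin m (\<lambda>j. A j * S))"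
  then have pq: "p < m" "q < m" by auto
  have A: "dim_row (A j) = m" "dim_col (A j) = m" for j using assms(2) by auto
  have "(lin m A * const_mat S) $$ (p, q) =
    (\<Sum>s<m. \<Sum>j\<in>UNIV. Poly_Mapping.single (NCWord [j]) (A j $$ (p, s) * S $$ (s, q)))"
    using pq assms(1) by (simp add: scalar_prod_def lin_def sum_distrib_right mult_single lessThan_atLeast0)
  also have "\<dots> = (\<Sum>j\<in>UNIV. \<Sum>s<m. Poly_Mapping.single (NCWord [j]) (A j $$ (p, s) * S $$ (s, q)))"
    by (rule sum.swap)
  also have "\<dots> = lin m (\<lambda>j. A j * S) $$ (p, q)"
    using pq assms(1) A by (simp add: lin_def scalar_prod_def single_sum lessThan_atLeast0)
  finally show "(lin m A * const_mat S) $$ (p, q) = lin m (\<lambda>j. A j * S) $$ (p, q)" .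
qed (use assms in auto)

lemma coeff_affine:
  fixes p :: "'d::finite nc_poly"
  assumes "deg1 p \<le> 2"
  shows "p = Poly_Mapping.single 0 (wcoeff p []) + (\<Sum>j\<in>UNIV. Poly_Mapping.single (NCWord [j]) (wcoeff p [j]))"
proof (rule nc_poly_eqI)
  fix xs :: "'d list"
  consider "xs = []" | l where "xs = [l]" | "length xs \<ge> 2"
    by (metis One_nat_def Suc_1 Suc_leI length_0_conv length_Suc_conv less_2_cases linorder_not_less)
  then show "wcoeff p xs = wcoeff (Poly_Mapping.single 0 (wcoeff p []) +
      (\<Sum>j\<in>UNIV. Poly_Mapping.single (NCWord [j]) (wcoeff p [j]))) xs"
  proof cases
    case 3
    then have "wcoeff p xs = 0" using deg1_gt[of p xs] assms by force
    moreover have "xs \<noteq> []" "\<And>j. xs \<noteq> [j]" using 3 by auto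
    ultimately show ?thesis by (auto simp: lookup_add lookup_sum coeff_const coeff_single)
  qed (auto simp: lookup_add lookup_sum coeff_const coeff_single)
qed

lemma nc_eval_origin:
  fixes M :: "'d nc_poly mat"
  shows "nc_eval M (1, \<lambda>_. 0\<^sub>m 1 1) = map_mat (\<lambda>p. wcoeff p []) M"
proof (rule eq_matI)
  fix i j assume "i < dim_row (map_mat (\<lambda>p. wcoeff p []) M)" "j < dim_col (map_mat (\<lambda>p. wcoeff p []) M)"
  then have ij: "i < dim_row M * 1" "j < dim_col M * 1" by auto
  have w: "word_eval 1 (\<lambda>_. 0\<^sub>m 1 1) w $$ (0, 0) = (if w = NCWord [] then 1 else 0)" for w :: "'d nc_word"
  proof (cases w)
    case (NCWord xs)
    have c: "word_eval 1 (\<lambda>_. 0\<^sub>m 1 1) v \<in> carrier_mat 1 1" for v :: "'d nc_word"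
      by (rule word_eval_carrier) auto
    have z: "0\<^sub>m 1 1 * word_eval 1 (\<lambda>_. 0\<^sub>m 1 1) v = 0\<^sub>m 1 1" for v :: "'d nc_word"
      by (rule left_mult_zero_mat[OF c])
    show ?thesis unfolding NCWord
      by (cases xs) (auto simp: word_eval_Nil word_eval_Cons z[unfolded One_nat_def])
  qed
  have "ev 1 (\<lambda>_. 0\<^sub>m 1 1) p $$ (0, 0) = wcoeff p []" for p :: "'d nc_poly"
  proof -
    have "ev 1 (\<lambda>_. 0\<^sub>m 1 1) p $$ (0, 0) =
       (\<Sum>u\<in>insert (NCWord []) (Poly_Mapping.keys p). Poly_Mapping.lookup p u * (if u = NCWord [] then 1 else 0))"
      by (subst ev_superset[where S = "insert (NCWord []) (Poly_Mapping.keys p)"]) (auto simp: w[unfolded One_nat_def])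
    also have "\<dots> = (\<Sum>u\<in>insert (NCWord []) (Poly_Mapping.keys p). if u = NCWord [] then Poly_Mapping.lookup p u else 0)"
      by (intro sum.cong) auto
    finally show ?thesis by simp
  qed
  then show "nc_eval M (1, \<lambda>_. 0\<^sub>m 1 1) $$ (i, j) = map_mat (\<lambda>p. wcoeff p []) M $$ (i, j)"
    using ij nc_eval_index[of "\<lambda>_. 0\<^sub>m 1 1" 1 i M j] by (simp del: nc_eval.simps)
qed auto

lemma stably_assoc_eval_invertible:
  assumes X: "\<forall>j. X j \<in> carrier_mat n n" and A: "A \<in> carrier_mat k k" and B: "B \<in> carrier_mat m m"
    and AB: "stably_assoc A B" and inv: "invertible_mat (nc_eval A (n, X))"
  shows "invertible_mat (nc_eval B (n, X))"
proof -
  obtain N E F where NEF: "k \<le> N" "m \<le> N" "E \<in> carrier_mat N N" "F \<in> carrier_mat N N"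
    "invertible_mat E" "invertible_mat F" "pad N A = E * pad N B * F"
    using AB A B unfolding stably_assoc_def by auto
  have "invertible_mat (pad (N * n) (nc_eval A (n, X)))"
    using inv NEF(1) by (subst invertible_mat_pad[OF nc_eval_carrier[OF A]]) auto
  then have "invertible_mat (nc_eval (pad N A) (n, X))" by (simp only: nc_eval_pad[OF X A])
  then have "invertible_mat (nc_eval E (n, X) * nc_eval (pad N B) (n, X) * nc_eval F (n, X))"
    unfolding NEF(7) nc_eval_mult[OF X mult_carrier_mat[OF NEF(3) pad_carrier] NEF(4)]
      nc_eval_mult[OF X NEF(3) pad_carrier] .
  then have "invertible_mat (nc_eval E (n, X) * nc_eval (pad N B) (n, X))"
    by (rule invertible_mat_cancel_right[where n = "N * n"])
      (use NEF in \<open>auto intro!: nc_eval_invertible[OF X] mult_carrier_mat nc_eval_carrier simp del: nc_eval.simps\<close>)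
  then have "invertible_mat (nc_eval (pad N B) (n, X))"
    by (rule invertible_mat_cancel_left[where n = "N * n"])
      (use NEF in \<open>auto intro!: nc_eval_invertible[OF X] mult_carrier_mat nc_eval_carrier simp del: nc_eval.simps\<close>)
  then show ?thesis
    using NEF(2) by (simp only: nc_eval_pad[OF X B] invertible_mat_pad[OF nc_eval_carrier[OF B]] mult_le_mono1)
qed

text \<open>The affine pencil is normalized by its constant coefficient, which is invertible because stable
  association preserves invertibility of the value at the origin.\<close>

theorem monic_linearization:
  fixes P :: "'d::finite nc_poly mat"
  assumes P: "P \<in> carrier_mat k k" and inv: "invertible_mat (nc_eval P (1, \<lambda>_. 0\<^sub>m 1 1))"
  obtains m A where "\<forall>j. A j \<in> carrier_mat m m" "stably_assoc P (1\<^sub>m m - lin m A)"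
proof -
  obtain m F where F: "F \<in> carrier_mat m m" "stably_assoc P F"
    "\<forall>i<m. \<forall>j<m. deg1 (F $$ (i, j)) \<le> 2"
    using affine_linearization[OF P] by metis
  define F0 where "F0 = map_mat (\<lambda>p. wcoeff p []) F"
  have F0: "F0 \<in> carrier_mat m m" using F by (simp add: F0_def)
  have "invertible_mat F0"
    using stably_assoc_eval_invertible[OF _ P F(1,2) inv] unfolding nc_eval_origin F0_def by simp
  then obtain G where G: "G \<in> carrier_mat m m" "F0 * G = 1\<^sub>m m" "G * F0 = 1\<^sub>m m"
    using F0 by (elim invertible_matE)
  define C where "C j = map_mat (\<lambda>p. wcoeff p [j]) F" for j
  have C: "\<forall>j. C j \<in> carrier_mat m m" using F by (simp add: C_def)
  define A where "A j = - (G * C j)" for j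
  have A: "\<forall>j. A j \<in> carrier_mat m m" using G C by (simp add: A_def)
  have "F = const_mat F0 + lin m C"
    by (rule eq_matI) (use F in \<open>auto simp: F0_def C_def lin_def intro: coeff_affine\<close>)
  also have "lin m C = lin m (\<lambda>j. F0 * (G * C j))"
  proof -
    have "F0 * (G * C j) = C j" for j
      using assoc_mult_mat[OF F0 G(1) C[rule_format, of j]] G C[rule_format, of j] by simp
    then show ?thesis by simp
  qed
  also have "\<dots> = const_mat F0 * lin m (\<lambda>j. G * C j)"
    using const_mat_mult_lin[OF F0, of "\<lambda>j. G * C j"] G C by simp
  also have "lin m (\<lambda>j. G * C j) = - lin m A"
  proof (rule eq_matI)
    fix i j assume "i < dim_row (- lin m A)" "j < dim_col (- lin m A)"
    then have ij: "i < m" "j < m" by auto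
    moreover have "(- (G * C l)) $$ (i, j) = - ((G * C l) $$ (i, j))" for l
      using ij G C[rule_format, of l] by (simp del: index_mult_mat(1))
    ultimately show "lin m (\<lambda>j. G * C j) $$ (i, j) = (- lin m A) $$ (i, j)"
      by (simp add: lin_def A_def sum_negf single_uminus del: index_mult_mat(1))
  qed auto
  also have "const_mat F0 + const_mat F0 * - lin m A = const_mat F0 * (1\<^sub>m m - lin m A) * 1\<^sub>m m"
  proof -
    have "const_mat F0 * (1\<^sub>m m + - lin m A) = const_mat F0 * 1\<^sub>m m + const_mat F0 * - lin m A"
      by (rule mult_add_distrib_mat[of _ m m _ m]) (use F0 in auto)
    moreover have "1\<^sub>m m + - lin m A = 1\<^sub>m m - lin m A"
      by (rule eq_matI) auto
    moreover have "const_mat F0 * (1\<^sub>m m - lin m A) * 1\<^sub>m m = const_mat F0 * (1\<^sub>m m - lin m A)"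
      by (rule right_mult_one_mat[of _ m]) (use F0 in \<open>auto intro!: mult_carrier_mat minus_carrier_mat\<close>)
    ultimately show ?thesis using F0 by simp
  qed
  finally have "stably_assoc F (1\<^sub>m m - lin m A)"
    using stably_assoc_mult[of "1\<^sub>m m - lin m A" m "const_mat F0" "1\<^sub>m m" F] F0
      invertible_const_mat[OF F0 \<open>invertible_mat F0\<close>] invertible_mat_one
    by (auto simp: minus_carrier_mat)
  then show ?thesis using that A stably_assoc_trans[OF F(2)] by blast
qed

section \<open>Unimodular rows over the free algebra\<close>

text \<open>The row \<open>c\<close> of length \<open>Suc n\<close> times an invertible matrix is \<open>(0, \<dots>, 0, 1)\<close>; in other words, \<open>c\<close> is
  the last row of an invertible matrix.\<close>

definition completable :: "nat \<Rightarrow> (nat \<Rightarrow> 'a::ring_1) \<Rightarrow> bool" where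
  "completable n c \<longleftrightarrow> (\<exists>V \<in> carrier_mat (Suc n) (Suc n). invertible_mat V \<and>
     (\<forall>j\<le>n. (\<Sum>i\<le>n. c i * V $$ (i, j)) = (if j = n then 1 else 0)))"

lemma mat_mult_index_sum:
  assumes "A \<in> carrier_mat r c" "B \<in> carrier_mat c s" "i < r" "j < s"
  shows "(A * B) $$ (i, j) = (\<Sum>l<c. A $$ (i, l) * B $$ (l, j))"
  using assms by (simp add: scalar_prod_def lessThan_atLeast0)

lemma completable_mult:
  fixes c :: "nat \<Rightarrow> 'a::ring_1"
  assumes V: "V \<in> carrier_mat (Suc n) (Suc n)" "invertible_mat V"
    and c': "\<And>j. j \<le> n \<Longrightarrow> c' j = (\<Sum>i\<le>n. c i * V $$ (i, j))" and comp: "completable n c'"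
  shows "completable n c"
proof -
  obtain V' where V': "V' \<in> carrier_mat (Suc n) (Suc n)" "invertible_mat V'"
    "\<And>j. j \<le> n \<Longrightarrow> (\<Sum>i\<le>n. c' i * V' $$ (i, j)) = (if j = n then 1 else 0)"
    using comp unfolding completable_def by blast
  have "(\<Sum>i\<le>n. c i * (V * V') $$ (i, j)) = (if j = n then 1 else 0)" if j: "j \<le> n" for j
  proof -
    have "(\<Sum>i\<le>n. c i * (V * V') $$ (i, j)) = (\<Sum>i\<le>n. \<Sum>l\<le>n. c i * V $$ (i, l) * V' $$ (l, j))"
      using j by (simp add: mat_mult_index_sum[OF V(1) V'(1)] sum_distrib_left mult.assoc lessThan_Suc_atMost)
    also have "\<dots> = (\<Sum>l\<le>n. \<Sum>i\<le>n. c i * V $$ (i, l) * V' $$ (l, j))" by (rule sum.swap)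
    also have "\<dots> = (\<Sum>l\<le>n. c' l * V' $$ (l, j))"
      by (simp add: c' sum_distrib_right)
    finally show ?thesis using V'(3)[OF j] by simp
  qed
  then show ?thesis unfolding completable_def
    using V V' invertible_mat_mult[OF V(2,1) V'(2,1)] by (intro bexI[of _ "V * V'"]) auto
qed

lemma invertible_one_plus_square_zero:
  fixes E :: "'a::ring_1 mat"
  assumes E: "E \<in> carrier_mat n n" and EE: "E * E = 0\<^sub>m n n"
  shows "invertible_mat (1\<^sub>m n + E)"
proof (rule invertible_matI[where n = n and B = "1\<^sub>m n + - E"])
  have "(1\<^sub>m n + E) * (1\<^sub>m n + - E) = (1\<^sub>m n + E) + - (E + E * E)"
    using E by (simp add: mult_add_distrib_mat[of _ n n _ n] add_mult_distrib_mat[of _ n n _ _ n])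
  then show "(1\<^sub>m n + E) * (1\<^sub>m n + - E) = 1\<^sub>m n"
    using E unfolding EE by (intro eq_matI) auto
  have "(1\<^sub>m n + - E) * (1\<^sub>m n + E) = (1\<^sub>m n + - E) + (E + - (E * E))"
    using E by (simp add: mult_add_distrib_mat[of _ n n _ n] add_mult_distrib_mat[of _ n n _ _ n])
  then show "(1\<^sub>m n + - E) * (1\<^sub>m n + E) = 1\<^sub>m n"
    using E unfolding EE by (intro eq_matI) auto
qed (use E in auto)

lemma completable_column_operation:
  fixes c :: "nat \<Rightarrow> 'a::ring_1"
  assumes i: "i \<le> n" and comp: "completable n (c(i := c i + (\<Sum>l\<in>{..n} - {i}. c l * h l)))"
  shows "completable n c"
proof -
  define E where "E = mat (Suc n) (Suc n) (\<lambda>(a, b). if b = i \<and> a \<noteq> i then h a else 0)"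
  have E: "E \<in> carrier_mat (Suc n) (Suc n)" by (simp add: E_def)
  have "E * E = 0\<^sub>m (Suc n) (Suc n)"
  proof (rule eq_matI)
    fix a b assume "a < dim_row (0\<^sub>m (Suc n) (Suc n) :: 'a mat)" "b < dim_col (0\<^sub>m (Suc n) (Suc n) :: 'a mat)"
    then have "(E * E) $$ (a, b) = (\<Sum>l<Suc n. E $$ (a, l) * E $$ (l, b))"
      by (intro mat_mult_index_sum[OF E E]) auto
    also have "\<dots> = 0" using \<open>b < _\<close> \<open>a < _\<close> by (intro sum.neutral) (auto simp: E_def)
    finally show "(E * E) $$ (a, b) = 0\<^sub>m (Suc n) (Suc n) $$ (a, b)" using \<open>b < _\<close> \<open>a < _\<close> by simp
  qed (use E in auto)
  \<comment> \<open>A column operation is \<open>1 + E\<close> with \<open>E\<close> supported in column \<open>i\<close> off the diagonal, so \<open>E\<^sup>2 = 0\<close>.\<close>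
  note inv = invertible_one_plus_square_zero[OF E this]
  show ?thesis
  proof (rule completable_mult[OF _ inv _ comp])
    fix j assume j: "j \<le> n"
    have "(\<Sum>a\<le>n. c a * (1\<^sub>m (Suc n) + E) $$ (a, j)) =
        (\<Sum>a\<le>n. if a = j then c a else 0) + (\<Sum>a\<le>n. if j = i \<and> a \<noteq> i then c a * h a else 0)"
      unfolding sum.distrib[symmetric]
    proof (rule sum.cong[OF refl])
      fix a assume "a \<in> {..n}"
      then show "c a * (1\<^sub>m (Suc n) + E) $$ (a, j) = (if a = j then c a else 0) + (if j = i \<and> a \<noteq> i then c a * h a else 0)"
        using j by (auto simp: E_def)
    qed
    also have "(\<Sum>a\<le>n. if j = i \<and> a \<noteq> i then c a * h a else 0) =
        (if j = i then (\<Sum>l\<in>{..n} - {i}. c l * h l) else 0)"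
      by (auto simp: sum.If_cases Diff_eq Compl_eq intro!: sum.cong)
    finally show "(c(i := c i + (\<Sum>l\<in>{..n} - {i}. c l * h l))) j =
        (\<Sum>a\<le>n. c a * (1\<^sub>m (Suc n) + E) $$ (a, j))"
      using j by simp
  qed (use E in auto)
qed

lemma sum_mult_delta:
  fixes f :: "nat \<Rightarrow> 'a::semiring_1"
  assumes "finite S"
  shows "(\<Sum>l\<in>S. f l * (if l = j then 1 else 0)) = (if j \<in> S then f j else 0)"
    "(\<Sum>l\<in>S. (if l = j then 1 else 0) * f l) = (if j \<in> S then f j else 0)"
proof -
  have "f l * (if l = j then 1 else 0) = (if l = j then f l else 0)"
    "(if l = j then 1 else 0) * f l = (if l = j then f l else 0)" for l by auto
  then show "(\<Sum>l\<in>S. f l * (if l = j then 1 else 0)) = (if j \<in> S then f j else 0)"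
    "(\<Sum>l\<in>S. (if l = j then 1 else 0) * f l) = (if j \<in> S then f j else 0)"
    using assms by simp_all
qed

lemma completable_last_unit:
  fixes c :: "nat \<Rightarrow> 'a::ring_1"
  assumes "c n * b = 1" "b * c n = 1"
  shows "completable n c"
proof -
  define V where "V = mat (Suc n) (Suc n) (\<lambda>(i, j). if i = n then (if j = n then b else - b * c j)
    else if i = j then 1 else 0)"
  define W where "W = mat (Suc n) (Suc n) (\<lambda>(i, j). if i = n then c j else if i = j then 1 else 0)"
  have V: "V \<in> carrier_mat (Suc n) (Suc n)" and W: "W \<in> carrier_mat (Suc n) (Suc n)"
    by (auto simp: V_def W_def)
  have *: "(\<Sum>l<n. if l = j then g l else 0) = (if j < n then g j else (0::'a))" for g j
    by simp
  have "V * W = 1\<^sub>m (Suc n)"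
  proof (rule eq_matI)
    fix i j assume "i < dim_row (1\<^sub>m (Suc n) :: 'a mat)" "j < dim_col (1\<^sub>m (Suc n) :: 'a mat)"
    then have ij: "i \<le> n" "j \<le> n" by auto
    have "(V * W) $$ (i, j) = (\<Sum>l<n. if l = j then V $$ (i, l) else 0) + V $$ (i, n) * W $$ (n, j)"
      using ij by (subst mat_mult_index_sum[OF V W]) (auto simp: W_def sum_mult_delta intro!: sum.cong)
    then show "(V * W) $$ (i, j) = 1\<^sub>m (Suc n) $$ (i, j)"
      unfolding * using ij assms by (auto simp: V_def W_def)
  qed (use V W in auto)
  moreover have "W * V = 1\<^sub>m (Suc n)"
  proof (rule eq_matI)
    fix i j assume "i < dim_row (1\<^sub>m (Suc n) :: 'a mat)" "j < dim_col (1\<^sub>m (Suc n) :: 'a mat)"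
    then have ij: "i \<le> n" "j \<le> n" by auto
    have "(W * V) $$ (i, j) = (\<Sum>l<n. if l = j then W $$ (i, l) else 0) + W $$ (i, n) * V $$ (n, j)"
      using ij by (subst mat_mult_index_sum[OF W V]) (auto simp: V_def sum_mult_delta intro!: sum.cong)
    then show "(W * V) $$ (i, j) = 1\<^sub>m (Suc n) $$ (i, j)"
      unfolding * using ij assms by (auto simp: V_def W_def simp flip: mult.assoc)
  qed (use V W in auto)
  ultimately have "invertible_mat V" by (intro invertible_matI[OF V W])
  moreover have "(\<Sum>i\<le>n. c i * V $$ (i, j)) = (if j = n then 1 else 0)" if j: "j \<le> n" for j
  proof -
    have "(\<Sum>i\<le>n. c i * V $$ (i, j)) = (\<Sum>l<n. if l = j then c l else 0) + c n * V $$ (n, j)"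
      using j unfolding lessThan_Suc_atMost[symmetric] by (auto simp: V_def sum_mult_delta intro!: sum.cong)
    then show ?thesis unfolding * using j assms by (auto simp: V_def simp flip: mult.assoc)
  qed
  ultimately show ?thesis using V unfolding completable_def by blast
qed

text \<open>A nonzero constant at another place is used to turn the last entry into \<open>1\<close>.\<close>

lemma completable_constant:
  fixes c :: "nat \<Rightarrow> 'd nc_poly"
  assumes i: "i \<le> n" and ci: "c i = Poly_Mapping.single 0 a" and a: "a \<noteq> 0"
  shows "completable n c"
proof (cases "i = n")
  case True
  then show ?thesis using ci a
    by (intro completable_last_unit[of _ _ "Poly_Mapping.single 0 (inverse a)"]) (auto simp: mult_single)
next
  case False
  define h where "h l = (if l = i then Poly_Mapping.single 0 (inverse a) * (1 - c n) else 0)" for l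
  have "(\<Sum>l\<in>{..n} - {n}. c l * h l) = (\<Sum>l\<in>{..n} - {n}. if l = i then c i * h i else 0)"
    by (rule sum.cong) (auto simp: h_def)
  also have "\<dots> = c i * h i" using False i by (simp add: sum.delta)
  also have "\<dots> = 1 - c n"
    unfolding h_def ci using a by (simp add: mult_single flip: mult.assoc)
  finally have "completable n (c(n := c n + (\<Sum>l\<in>{..n} - {n}. c l * h l)))"
    by (intro completable_last_unit[of _ _ 1]) auto
  then show ?thesis by (rule completable_column_operation[OF order.refl])
qed

text \<open>Coefficients at long words only see the part of \<open>q\<close> that ends in \<open>ys\<close>: if the left factor has too
  small a degree to reach into \<open>ys\<close>, the ending \<open>ys\<close> comes entirely from the right factor.\<close>

lemma coeff_mult_strip:
  assumes "deg1 p \<le> Suc (length zs)"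
  shows "wcoeff (p * q) (zs @ ys) = wcoeff (p * rstrip ys q) zs"
proof -
  have "wcoeff (p * q) (zs @ ys) =
      (\<Sum>i\<le>length (zs @ ys). if i \<le> length zs then wcoeff p (take i zs) * wcoeff q (drop i zs @ ys) else 0)"
    unfolding coeff_mult
  proof (rule sum.cong[OF refl])
    fix i assume "i \<in> {..length (zs @ ys)}"
    then show "wcoeff p (take i (zs @ ys)) * wcoeff q (drop i (zs @ ys)) =
      (if i \<le> length zs then wcoeff p (take i zs) * wcoeff q (drop i zs @ ys) else 0)"
      using deg1_gt[of p "take i (zs @ ys)"] assms by (cases "i \<le> length zs") auto
  qed
  also have "\<dots> = (\<Sum>i\<in>{..length (zs @ ys)} \<inter> {i. i \<le> length zs}. wcoeff p (take i zs) * wcoeff q (drop i zs @ ys))"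
    by (simp add: sum.inter_restrict)
  also have "{..length (zs @ ys)} \<inter> {i. i \<le> length zs} = {..length zs}" by auto
  finally show ?thesis by (simp add: coeff_mult coeff_rstrip)
qed

lemma coeff_mult_eq_0:
  assumes "length zs + 2 > deg1 p + deg1 q"
  shows "wcoeff (p * q) zs = 0"
  unfolding coeff_mult
proof (rule sum.neutral, intro ballI)
  fix i assume "i \<in> {..length zs}"
  then show "wcoeff p (take i zs) * wcoeff q (drop i zs) = 0"
    using deg1_gt[of p "take i zs"] deg1_gt[of q "drop i zs"] assms by force
qed

text \<open>Cohn's weak algorithm. In \<open>\<Sum> c\<^sub>l u\<^sub>l = 1\<close> the terms of highest total degree \<open>M\<close> cancel. Among the
  indices attaining \<open>M\<close> choose \<open>i\<close> with \<open>c\<^sub>i\<close> of largest degree, so that \<open>u\<^sub>i\<close> has smallest degree, and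
  let \<open>w\<close> be a word of maximal length in \<open>u\<^sub>i\<close>. Stripping the ending \<open>w\<close> from the cancelling leading
  terms turns \<open>u\<^sub>i\<close> into a nonzero scalar, so a right linear combination of the other \<open>c\<^sub>l\<close> cancels the
  leading form of \<open>c\<^sub>i\<close>.\<close>

lemma weak_algorithm_step:
  fixes c u :: "nat \<Rightarrow> 'd nc_poly"
  assumes sum: "(\<Sum>l\<le>n. c l * u l) = 1" and nc: "\<And>l. l \<le> n \<Longrightarrow> deg1 (c l) \<noteq> 1"
  obtains i h where "i \<le> n" "deg1 (c i + (\<Sum>l\<in>{..n} - {i}. c l * h l)) < deg1 (c i)"
proof -
  define T0 where "T0 = {l. l \<le> n \<and> c l \<noteq> 0 \<and> u l \<noteq> 0}"
  have T0: "finite T0" by (simp add: T0_def)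
  have "T0 \<noteq> {}"
  proof
    assume "T0 = {}"
    then have "(\<Sum>l\<le>n. c l * u l) = 0" by (intro sum.neutral) (auto simp: T0_def)
    then show False using sum by simp
  qed
  define M where "M = Max ((\<lambda>l. deg1 (c l) + deg1 (u l)) ` T0)"
  define T where "T = {l \<in> T0. deg1 (c l) + deg1 (u l) = M}"
  have "M \<in> (\<lambda>l. deg1 (c l) + deg1 (u l)) ` T0"
    unfolding M_def using T0 \<open>T0 \<noteq> {}\<close> by (intro Max_in) auto
  then have T: "finite T" "T \<noteq> {}" using T0 by (auto simp: T_def)
  have M: "deg1 (c l) + deg1 (u l) \<le> M" if "l \<in> T0" for l
    unfolding M_def using T0 that by (intro Max_ge) auto
  have "Max ((\<lambda>l. deg1 (c l)) ` T) \<in> (\<lambda>l. deg1 (c l)) ` T"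
    using T by (intro Max_in) auto
  then obtain i where "i \<in> T" "Max ((\<lambda>l. deg1 (c l)) ` T) = deg1 (c i)" by auto
  then have i: "i \<in> T" "\<And>l. l \<in> T \<Longrightarrow> deg1 (c l) \<le> deg1 (c i)"
    using T by (auto dest!: sym[of "Max _"])
  have iT0: "i \<le> n" "c i \<noteq> 0" "u i \<noteq> 0" "deg1 (c i) + deg1 (u i) = M"
    using i(1) by (auto simp: T_def T0_def)
  define D where "D = deg1 (c i) - 1"
  have D: "deg1 (c i) = Suc D" "D \<ge> 1"
    using nc[OF iT0(1)] iT0(2) deg1_eq_0[of "c i"] by (auto simp: D_def)
  obtain w where w: "wcoeff (u i) w \<noteq> 0" "deg1 (u i) = Suc (length w)"
    using deg1_attained[OF iT0(3)] .
  define lam where "lam = wcoeff (u i) w"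
  \<comment> \<open>An index \<open>l\<close> with \<open>c\<^sub>l\<close> of larger degree than \<open>c\<^sub>i\<close> does not attain \<open>M\<close>; it contributes nothing in the top degree.\<close>
  define h where "h l = (if deg1 (c l) \<le> Suc D then rstrip w (u l) * Poly_Mapping.single 0 (inverse lam) else 0)" for l
  let ?c = "c i + (\<Sum>l\<in>{..n} - {i}. c l * h l)"
  have M_eq: "M = D + length w + 2" using iT0(4) D w by simp
  have "wcoeff ?c z = 0" if z: "length z \<ge> D" for z
  proof -
    have ch: "wcoeff (c l * h l) z = (if deg1 (c l) \<le> Suc D then wcoeff (c l * u l) (z @ w) * inverse lam else 0)" for l
      using z by (simp add: h_def coeff_mult_const coeff_mult_strip flip: mult.assoc)
    show ?thesis
    proof (cases "length z = D")
      case True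
      have "wcoeff (c l * u l) (z @ w) = 0" if "\<not> deg1 (c l) \<le> Suc D" "l \<le> n" for l
      proof (cases "l \<in> T0")
        case l: True
        then have "l \<notin> T" using i(2)[of l] that D by auto
        then have "deg1 (c l) + deg1 (u l) < M" using M[OF l] l by (auto simp: T_def)
        then show ?thesis using True M_eq by (intro coeff_mult_eq_0) auto
      qed (use that in \<open>auto simp: T0_def\<close>)
      then have "wcoeff (c l * h l) z = wcoeff (c l * u l) (z @ w) * inverse lam" if "l \<le> n" for l
        using ch[of l] that by auto
      then have "wcoeff (\<Sum>l\<in>{..n} - {i}. c l * h l) z = (\<Sum>l\<in>{..n} - {i}. wcoeff (c l * u l) (z @ w)) * inverse lam"
        by (simp add: lookup_sum sum_distrib_right)
      also have "(\<Sum>l\<in>{..n} - {i}. wcoeff (c l * u l) (z @ w)) = (\<Sum>l\<le>n. wcoeff (c l * u l) (z @ w)) - wcoeff (c i * u i) (z @ w)"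
        using iT0(1) by (simp add: sum_diff1)
      also have "(\<Sum>l\<le>n. wcoeff (c l * u l) (z @ w)) = 0"
        using True D(2) by (auto simp: sum coeff_one simp flip: lookup_sum)
      also have "wcoeff (c i * u i) (z @ w) = wcoeff (c i) z * lam"
        unfolding lam_def by (rule coeff_mult_top) (use iT0 True D w in auto)
      finally show ?thesis using w(1) by (simp add: lookup_add lam_def)
    next
      case False
      then have z: "length z > D" using z by simp
      have "wcoeff (c l * u l) (z @ w) = 0" if "l \<le> n" for l
      proof (cases "l \<in> T0")
        case True
        then show ?thesis using M[OF True] M_eq z by (intro coeff_mult_eq_0) auto
      qed (use that in \<open>auto simp: T0_def\<close>)
      then have "wcoeff (\<Sum>l\<in>{..n} - {i}. c l * h l) z = 0"
        unfolding lookup_sum by (intro sum.neutral) (auto simp: ch)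
      moreover have "wcoeff (c i) z = 0" using deg1_gt[of "c i" z] D z by auto
      ultimately show ?thesis by (simp add: lookup_add)
    qed
  qed
  then have "deg1 ?c \<le> D" using not_less by (intro deg1_le) blast
  then show ?thesis using that[OF iT0(1), of h] D by simp
qed

text \<open>Each step of the weak algorithm is a column operation that lowers the total degree; it stops when
  some entry is a nonzero constant. The relation \<open>\<Sum> c\<^sub>l u\<^sub>l = 1\<close> is carried along by transforming the
  \<open>u\<^sub>l\<close> inversely. In other words, finitely generated stably free modules over the free algebra are free.\<close>

theorem unimodular_row_completable:
  fixes c u :: "nat \<Rightarrow> 'd nc_poly"
  assumes "(\<Sum>l\<le>n. c l * u l) = 1"
  shows "completable n c"
  using assms
proof (induction "\<Sum>l\<le>n. deg1 (c l)" arbitrary: c u rule: less_induct)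
  case less
  show ?case
  proof (cases "\<exists>i\<le>n. deg1 (c i) = 1")
    case True
    then obtain i where i: "i \<le> n" "deg1 (c i) = 1" by blast
    have "c i = Poly_Mapping.single 0 (wcoeff (c i) [])"
      by (rule nc_poly_eqI) (use deg1_gt[of "c i"] i in \<open>auto simp: coeff_const\<close>)
    moreover have "wcoeff (c i) [] \<noteq> 0"
      using calculation i(2) deg1_eq_0[of "c i"] by (metis single_zero zero_neq_one)
    ultimately show ?thesis using completable_constant[OF i(1)] by blast
  next
    case False
    obtain i h where i: "i \<le> n" and lt: "deg1 (c i + (\<Sum>l\<in>{..n} - {i}. c l * h l)) < deg1 (c i)"
      using weak_algorithm_step[OF less.prems] False by blast
    define c' where "c' = c(i := c i + (\<Sum>l\<in>{..n} - {i}. c l * h l))"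
    define u' where "u' l = (if l = i then u i else u l - h l * u i)" for l
    have split: "(\<Sum>l\<le>n. g l) = g i + (\<Sum>l\<in>{..n} - {i}. g l)" for g :: "nat \<Rightarrow> 'e::comm_monoid_add"
      using i by (simp add: sum.remove)
    have "(\<Sum>l\<le>n. deg1 (c' l)) < (\<Sum>l\<le>n. deg1 (c l))"
      unfolding split c'_def using lt by simp
    moreover have "(\<Sum>l\<le>n. c' l * u' l) = (\<Sum>l\<le>n. c l * u l)"
      unfolding split by (simp add: c'_def u'_def algebra_simps sum_subtractf sum_distrib_left sum_distrib_right)
    ultimately have "completable n c'" using less.hyps less.prems by metis
    then show ?thesis unfolding c'_def by (rule completable_column_operation[OF i])
  qed
qed

section \<open>Factorizations up to stable association\<close>

lemma four_block_upper_factor: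
  fixes a :: "'a::ring_1 mat"
  assumes "a \<in> carrier_mat n n" "y \<in> carrier_mat n m"
  shows "four_block_mat a y (0\<^sub>m m n) (1\<^sub>m m) = four_block_mat (1\<^sub>m n) y (0\<^sub>m m n) (1\<^sub>m m) * pad (n + m) a"
  unfolding pad_conv_four_block[OF assms(1)]
  by (subst mult_square_blocks[where n = n and m = m])
    (use assms in auto)

lemma invertible_upper_block:
  fixes a :: "'a::ring_1 mat"
  assumes "a \<in> carrier_mat n n" "y \<in> carrier_mat n m" "invertible_mat a"
  shows "invertible_mat (four_block_mat a y (0\<^sub>m m n) (1\<^sub>m m))"
  unfolding four_block_upper_factor[OF assms(1,2)]
  by (rule invertible_mat_mult[where n = "n + m"])
    (use assms invertible_upper_unipotent[OF assms(2)] in \<open>auto simp: invertible_mat_pad[where n = n]\<close>)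

lemma mat_last_row_unit_split:
  assumes A: "A \<in> carrier_mat (Suc n) (Suc n)"
    and row: "\<And>j. j \<le> n \<Longrightarrow> A $$ (n, j) = (if j = n then 1 else 0)"
  obtains a y where "a \<in> carrier_mat n n" "y \<in> carrier_mat n 1"
    "A = four_block_mat a y (0\<^sub>m 1 n) (1\<^sub>m 1)"
proof -
  define a where "a = mat n n (\<lambda>ij. A $$ ij)"
  define y where "y = mat n 1 (\<lambda>(i, j). A $$ (i, n))"
  have "A = four_block_mat a y (0\<^sub>m 1 n) (1\<^sub>m 1)"
  proof (rule eq_matI)
    fix i j assume "i < dim_row (four_block_mat a y (0\<^sub>m 1 n) (1\<^sub>m 1))" "j < dim_col (four_block_mat a y (0\<^sub>m 1 n) (1\<^sub>m 1))"
    then have "i < Suc n" "j < Suc n" by (auto simp: a_def y_def)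
    then show "A $$ (i, j) = four_block_mat a y (0\<^sub>m 1 n) (1\<^sub>m 1) $$ (i, j)"
      using row by (cases "i = n"; cases "j = n") (auto simp: a_def y_def)
  qed (use A in \<open>auto simp: a_def y_def\<close>)
  then show ?thesis by (rule that[rotated 2]) (auto simp: a_def y_def)
qed

text \<open>The last row of \<open>F\<close> is unimodular, since its product with the last column of \<open>G\<close> is \<open>1\<close>. Inserting
  \<open>V V\<^sup>-\<^sup>1\<close> between \<open>F\<close> and \<open>G\<close>, where \<open>V\<close> turns this row into \<open>(0, \<dots>, 0, 1)\<close>, makes both factors
  block upper triangular with corner entry \<open>1\<close>; their upper left blocks multiply to \<open>P\<close>.\<close>

lemma factorization_unpad_one:
  fixes F G :: "'d nc_poly mat"
  assumes F: "F \<in> carrier_mat (Suc n) (Suc n)" and G: "G \<in> carrier_mat (Suc n) (Suc n)"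
    and P: "P \<in> carrier_mat n n" and FG: "F * G = pad (Suc n) P"
  shows "\<exists>F'\<in>carrier_mat n n. \<exists>G'\<in>carrier_mat n n. P = F' * G' \<and>
    (invertible_mat F' \<longrightarrow> invertible_mat F) \<and> (invertible_mat G' \<longrightarrow> invertible_mat G)"
proof -
  have "(\<Sum>l\<le>n. F $$ (n, l) * G $$ (l, n)) = (F * G) $$ (n, n)"
    by (simp add: mat_mult_index_sum[OF F G] lessThan_Suc_atMost)
  also have "\<dots> = 1" unfolding FG using P by (simp add: pad_def)
  finally obtain V where V: "V \<in> carrier_mat (Suc n) (Suc n)" "invertible_mat V"
    "\<And>j. j \<le> n \<Longrightarrow> (\<Sum>l\<le>n. F $$ (n, l) * V $$ (l, j)) = (if j = n then 1 else 0)"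
    using unimodular_row_completable[of "\<lambda>l. F $$ (n, l)" "\<lambda>l. G $$ (l, n)" n]
    unfolding completable_def by blast
  obtain V' where V': "V' \<in> carrier_mat (Suc n) (Suc n)" "V * V' = 1\<^sub>m (Suc n)" "V' * V = 1\<^sub>m (Suc n)"
    using invertible_matE[OF V(2,1)] .
  have iV': "invertible_mat V'" by (rule invertible_matI[OF V'(1) V(1) V'(3,2)])
  define H where "H = V' * G"
  have FV: "F * V \<in> carrier_mat (Suc n) (Suc n)" and H: "H \<in> carrier_mat (Suc n) (Suc n)"
    using F V V' G by (auto simp: H_def)
  have prod: "(F * V) * H = pad (Suc n) P"
    unfolding H_def using mult_mat_cancel_middle[OF F V(1) V'(1) G V'(2)] FG by simp
  have rFV: "(F * V) $$ (n, j) = (if j = n then 1 else 0)" if "j \<le> n" for j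
    using that V(3) by (simp add: mat_mult_index_sum[OF F V(1)] lessThan_Suc_atMost)
  then obtain F' y where F': "F' \<in> carrier_mat n n" "y \<in> carrier_mat n 1"
    "F * V = four_block_mat F' y (0\<^sub>m 1 n) (1\<^sub>m 1)"
    using mat_last_row_unit_split[OF FV] by blast
  have "H $$ (n, j) = (if j = n then 1 else 0)" if j: "j \<le> n" for j
  proof -
    have "((F * V) * H) $$ (n, j) = (\<Sum>l\<le>n. if l = n then H $$ (l, j) else 0)"
      using j rFV by (simp add: mat_mult_index_sum[OF FV H] lessThan_Suc_atMost sum_mult_delta del: index_mult_mat(1))
    then show ?thesis unfolding prod using j P by (auto simp: pad_def)
  qed
  then obtain G' z where G': "G' \<in> carrier_mat n n" "z \<in> carrier_mat n 1"
    "H = four_block_mat G' z (0\<^sub>m 1 n) (1\<^sub>m 1)"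
    using mat_last_row_unit_split[OF H] by blast
  have blk: "(F * V) * H = four_block_mat (F' * G') (F' * z + y) (0\<^sub>m 1 n) (1\<^sub>m 1)"
    unfolding F'(3) G'(3)
    by (subst mult_square_blocks[where n = n and m = 1])
      (use F' G' in auto)
  have "P = F' * G'"
  proof (rule eq_matI)
    fix i j assume "i < dim_row (F' * G')" "j < dim_col (F' * G')"
    then have ij: "i < n" "j < n" using F' G' by auto
    have "pad (Suc n) P $$ (i, j) = four_block_mat (F' * G') (F' * z + y) (0\<^sub>m 1 n) (1\<^sub>m 1) $$ (i, j)"
      unfolding prod[symmetric] blk ..
    then show "P $$ (i, j) = (F' * G') $$ (i, j)"
      using ij P F' G' by (simp add: pad_def del: index_mult_mat(1))
  qed (use P F' G' in auto)
  moreover have "invertible_mat F" if "invertible_mat F'"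
  proof -
    have "invertible_mat (F * V)" unfolding F'(3) by (rule invertible_upper_block[OF F'(1,2) that])
    then show ?thesis using invertible_mat_cancel_right[OF _ F V(2,1)] by blast
  qed
  moreover have "invertible_mat G" if "invertible_mat G'"
  proof -
    have "invertible_mat H" unfolding G'(3) by (rule invertible_upper_block[OF G'(1,2) that])
    then show ?thesis using invertible_mat_cancel_left[OF _ iV' V'(1) G] unfolding H_def by blast
  qed
  ultimately show ?thesis using F'(1) G'(1) by blast
qed

lemma factorization_unpad:
  fixes F G :: "'d nc_poly mat"
  assumes "F \<in> carrier_mat (k + s) (k + s)" "G \<in> carrier_mat (k + s) (k + s)"
    and P: "P \<in> carrier_mat k k" and "F * G = pad (k + s) P"
  shows "\<exists>F'\<in>carrier_mat k k. \<exists>G'\<in>carrier_mat k k. P = F' * G' \<and>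
    (invertible_mat F' \<longrightarrow> invertible_mat F) \<and> (invertible_mat G' \<longrightarrow> invertible_mat G)"
  using assms(1,2,4)
proof (induction s arbitrary: F G)
  case 0
  then show ?case using pad_same[OF P] by (intro bexI[of _ F] bexI[of _ G]) auto
next
  case (Suc s)
  have "F * G = pad (Suc (k + s)) (pad (k + s) P)"
    using Suc.prems P by (simp add: pad_pad)
  then obtain F1 G1 where 1: "F1 \<in> carrier_mat (k + s) (k + s)" "G1 \<in> carrier_mat (k + s) (k + s)"
    "pad (k + s) P = F1 * G1" "invertible_mat F1 \<longrightarrow> invertible_mat F" "invertible_mat G1 \<longrightarrow> invertible_mat G"
    using factorization_unpad_one[of F "k + s" G "pad (k + s) P"] Suc.prems by auto
  from Suc.IH[OF 1(1,2) 1(3)[symmetric]] 1(4,5) show ?case by blast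
qed

text \<open>Adding identity summands creates no new factorizations of an atom.\<close>

theorem atom_stably_atom:
  assumes "nc_atom k P" "k \<le> N" "F \<in> carrier_mat N N" "G \<in> carrier_mat N N" "F * G = pad N P"
  shows "invertible_mat F \<or> invertible_mat G"
proof -
  obtain s where "N = k + s" using assms(2) le_Suc_ex by blast
  then show ?thesis using factorization_unpad[of F k s G P] assms unfolding nc_atom_def by blast
qed

section \<open>Invariant subspaces and irreducible linearizations\<close>

lemma invertible_mat_iff_det:
  fixes A :: "complex mat"
  assumes A: "A \<in> carrier_mat n n"
  shows "invertible_mat A \<longleftrightarrow> det A \<noteq> 0"
proof
  assume "invertible_mat A"
  then obtain B where "B \<in> carrier_mat n n" "A * B = 1\<^sub>m n" using A by (elim invertible_matE)
  then have "det A * det B = 1" using det_mult[OF A] by (metis det_one)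
  then show "det A \<noteq> 0" by auto
next
  assume "det A \<noteq> 0"
  from det_non_zero_imp_unit[OF A this, unfolded Units_def ring_mat_simps]
  show "invertible_mat A" by (auto intro: invertible_matI[OF A])
qed

definition vsubspace :: "nat \<Rightarrow> complex vec set \<Rightarrow> bool" where
  "vsubspace m W \<longleftrightarrow> W \<subseteq> carrier_vec m \<and> 0\<^sub>v m \<in> W \<and> (\<forall>v\<in>W. \<forall>w\<in>W. v + w \<in> W) \<and>
     (\<forall>c. \<forall>v\<in>W. c \<cdot>\<^sub>v v \<in> W)"

text \<open>Exchange step: \<open>S z\<close> becomes column \<open>r\<close> of a new invertible matrix that keeps the columns before \<open>r\<close>.
  If the pivot \<open>i\<close> of \<open>z\<close> differs from \<open>r\<close>, the old column \<open>r\<close> moves to place \<open>i\<close>.\<close>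

lemma adapted_basis_extend:
  assumes S: "S \<in> carrier_mat m m" "invertible_mat (S :: complex mat)" and r: "r \<le> i" "i < m"
    and z: "z \<in> carrier_vec m" "z $ i \<noteq> 0"
  shows "\<exists>T\<in>carrier_mat m m. invertible_mat T \<and> T *\<^sub>v unit_vec m r = S *\<^sub>v z \<and>
    (\<forall>q<r. T *\<^sub>v unit_vec m q = S *\<^sub>v unit_vec m q)"
proof -
  have rm: "r < m" using r by simp
  define U where "U = mat m m (\<lambda>(a, b). if b = r then z $ a else if b = i then (if a = r then 1 else 0)
    else if a = b then 1 else 0)"
  have U: "U \<in> carrier_mat m m" by (simp add: U_def)
  have "(U *\<^sub>v unit_vec m q) $ a = U $$ (a, q)" if "q < m" "a < m" for q a
    using that U by simp
  then have col: "U *\<^sub>v unit_vec m q = vec m (\<lambda>a. U $$ (a, q))" if "q < m" for q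
    using that U by (intro eq_vecI) auto
  have inj: "v = 0\<^sub>v m" if v: "v \<in> carrier_vec m" and Uv: "U *\<^sub>v v = 0\<^sub>v m" for v
  proof -
    have s: "(\<Sum>b<m. U $$ (a, b) * v $ b) = 0" if "a < m" for a
    proof -
      have "(U *\<^sub>v v) $ a = 0" using Uv that by simp
      then show ?thesis using that U v by (simp add: scalar_prod_def lessThan_atLeast0)
    qed
    have row: "(\<Sum>b<m. U $$ (a, b) * v $ b) =
        z $ a * v $ r + (if a = r \<and> i \<noteq> r then v $ i else 0) + (if a \<noteq> r \<and> a \<noteq> i then v $ a else 0)"
      if a: "a < m" for a
    proof -
      have "(\<Sum>b<m. U $$ (a, b) * v $ b) = (\<Sum>b<m. (if b = r then z $ a * v $ r else 0) +
          (if b = i then (if a = r \<and> i \<noteq> r then v $ i else 0) else 0) +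
          (if b = a then (if a \<noteq> r \<and> a \<noteq> i then v $ a else 0) else 0))"
        by (rule sum.cong) (use a in \<open>auto simp: U_def\<close>)
      then show ?thesis using a r rm by (simp add: sum.distrib)
    qed
    have vr: "v $ r = 0" using s[OF r(2)] row[OF r(2)] z(2) by auto
    have "v $ a = 0" if "a < m" for a
      using s[OF that] row[OF that] s[OF rm] row[OF rm] vr by (auto split: if_splits)
    then show ?thesis using v by (intro eq_vecI) auto
  qed
  have "det U \<noteq> 0" using det_0_iff_vec_prod_zero[OF U] inj by auto
  then have "invertible_mat U" using invertible_mat_iff_det[OF U] by blast
  then have "invertible_mat (S * U)" using invertible_mat_mult[OF S(2,1) _ U] by blast
  moreover have "S * U *\<^sub>v unit_vec m q = S *\<^sub>v (U *\<^sub>v unit_vec m q)" for q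
    using S U by (intro assoc_mult_mat_vec) auto
  moreover have "U *\<^sub>v unit_vec m r = z" unfolding col[OF rm] using z rm by (intro eq_vecI) (auto simp: U_def)
  moreover have "U *\<^sub>v unit_vec m q = unit_vec m q" if "q < r" for q
  proof -
    have q: "q < m" using that rm by simp
    show ?thesis unfolding col[OF q] using that r q by (intro eq_vecI) (auto simp: U_def unit_vec_def)
  qed
  ultimately show ?thesis using S U by (intro bexI[of _ "S * U"]) auto
qed

text \<open>Choose an invertible matrix with as many leading columns in \<open>W\<close> as possible; by the exchange step a
  vector of \<open>W\<close> outside their span would allow one more.\<close>

lemma vsubspace_adapted_basis:
  assumes W: "vsubspace m W"
  obtains S r where "S \<in> carrier_mat m m" "invertible_mat S" "r \<le> m"
    "W = {S *\<^sub>v v | v. v \<in> carrier_vec m \<and> (\<forall>i<m. r \<le> i \<longrightarrow> v $ i = 0)}"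
proof -
  define R where "R r \<longleftrightarrow> r \<le> m \<and> (\<exists>S\<in>carrier_mat m m. invertible_mat S \<and>
    (\<forall>q<r. S *\<^sub>v unit_vec m q \<in> W))" for r
  have "R 0" unfolding R_def using invertible_mat_one[of m] by (auto intro!: bexI[of _ "1\<^sub>m m"])
  moreover have "\<forall>r. R r \<longrightarrow> r \<le> m" by (auto simp: R_def)
  ultimately obtain r where r: "R r" "\<forall>r'. R r' \<longrightarrow> r' \<le> r"
    using Nat.ex_has_greatest_nat[of R 0 m] by auto
  then obtain S where S: "S \<in> carrier_mat m m" "invertible_mat S" "\<And>q. q < r \<Longrightarrow> S *\<^sub>v unit_vec m q \<in> W"
    and rm: "r \<le> m" unfolding R_def by blast
  obtain S' where S': "S' \<in> carrier_mat m m" "S * S' = 1\<^sub>m m" "S' * S = 1\<^sub>m m"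
    using invertible_matE[OF S(2,1)] .
  have "S *\<^sub>v v \<in> W" if v: "v \<in> carrier_vec m" "\<forall>i<m. r \<le> i \<longrightarrow> v $ i = 0" for v
  proof -
    have "t \<le> r \<Longrightarrow> S *\<^sub>v vec m (\<lambda>i. if i < t then v $ i else 0) \<in> W" for t
    proof (induction t)
      case 0
      have "vec m (\<lambda>i. 0) = (0\<^sub>v m :: complex vec)" by (rule eq_vecI) auto
      moreover have "S *\<^sub>v 0\<^sub>v m = 0\<^sub>v m" using S(1) by (intro eq_vecI) auto
      ultimately show ?case using W by (simp add: vsubspace_def)
    next
      case (Suc t)
      have "vec m (\<lambda>i. if i < Suc t then v $ i else 0) =
          vec m (\<lambda>i. if i < t then v $ i else 0) + v $ t \<cdot>\<^sub>v unit_vec m t"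
        by (rule eq_vecI) (use Suc.prems rm in \<open>auto simp: unit_vec_def less_Suc_eq\<close>)
      then have "S *\<^sub>v vec m (\<lambda>i. if i < Suc t then v $ i else 0) =
          S *\<^sub>v vec m (\<lambda>i. if i < t then v $ i else 0) + v $ t \<cdot>\<^sub>v (S *\<^sub>v unit_vec m t)"
        using S(1) by (simp add: mult_add_distrib_mat_vec[of _ m m] mult_mat_vec[of _ m m])
      then show ?case using W S(3)[of t] Suc by (simp add: vsubspace_def)
    qed
    moreover have "vec m (\<lambda>i. if i < r then v $ i else 0) = v"
      using v by (intro eq_vecI) auto
    ultimately show ?thesis by (metis order.refl)
  qed
  moreover have "\<exists>v. w = S *\<^sub>v v \<and> v \<in> carrier_vec m \<and> (\<forall>i<m. r \<le> i \<longrightarrow> v $ i = 0)" if w: "w \<in> W" for w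
  proof (intro exI[of _ "S' *\<^sub>v w"] conjI allI impI)
    have wc: "w \<in> carrier_vec m" using W w by (auto simp: vsubspace_def)
    then show z: "S' *\<^sub>v w \<in> carrier_vec m" using S' by auto
    show wS: "w = S *\<^sub>v (S' *\<^sub>v w)" using assoc_mult_mat_vec[OF S(1) S'(1) wc] S' wc by simp
    fix i assume i: "i < m" "r \<le> i"
    show "(S' *\<^sub>v w) $ i = 0"
    proof (rule ccontr)
      assume "(S' *\<^sub>v w) $ i \<noteq> 0"
      from adapted_basis_extend[OF S(1,2) i(2,1) z this] obtain T where T: "T \<in> carrier_mat m m" "invertible_mat T"
        "T *\<^sub>v unit_vec m r = w" "\<And>q. q < r \<Longrightarrow> T *\<^sub>v unit_vec m q = S *\<^sub>v unit_vec m q"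
        unfolding wS[symmetric] by blast
      have "T *\<^sub>v unit_vec m q \<in> W" if "q < Suc r" for q
        using that T(3,4) S(3) w by (cases "q = r") auto
      then have "R (Suc r)" unfolding R_def using T i by auto
      then show False using r(2) by auto
    qed
  qed
  ultimately have "W = {S *\<^sub>v v | v. v \<in> carrier_vec m \<and> (\<forall>i<m. r \<le> i \<longrightarrow> v $ i = 0)}" by blast
  then show ?thesis using that S rm by blast
qed

lemma vsubspace_functional:
  assumes W: "vsubspace m W" and ne: "W \<noteq> carrier_vec m"
  obtains f where "f \<in> carrier_vec m" "f \<noteq> 0\<^sub>v m" "\<And>w. w \<in> W \<Longrightarrow> f \<bullet> w = 0"
proof -
  obtain S r where S: "S \<in> carrier_mat m m" "invertible_mat S" "r \<le> m"
    "W = {S *\<^sub>v v | v. v \<in> carrier_vec m \<and> (\<forall>i<m. r \<le> i \<longrightarrow> v $ i = 0)}"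
    using vsubspace_adapted_basis[OF W] by blast
  obtain S' where S': "S' \<in> carrier_mat m m" "S * S' = 1\<^sub>m m" "S' * S = 1\<^sub>m m"
    using invertible_matE[OF S(2,1)] .
  have "r \<noteq> m"
  proof
    assume "r = m"
    then have "w \<in> W" if w: "w \<in> carrier_vec m" for w
      unfolding S(4) using assoc_mult_mat_vec[OF S(1) S'(1) w] S' w
      by (auto intro!: exI[of _ "S' *\<^sub>v w"])
    then show False using ne W by (auto simp: vsubspace_def)
  qed
  then have r: "r < m" using S by simp
  show ?thesis
  proof (rule that[of "row S' r"])
    show "row S' r \<in> carrier_vec m" using S' by auto
    have eq: "row S' r \<bullet> (S *\<^sub>v v) = v $ r" if v: "v \<in> carrier_vec m" for v
    proof -
      have "row S' r \<bullet> (S *\<^sub>v v) = (S' *\<^sub>v (S *\<^sub>v v)) $ r" using r S' by simp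
      also have "S' *\<^sub>v (S *\<^sub>v v) = v" using assoc_mult_mat_vec[OF S'(1) S(1) v] S' v by simp
      finally show ?thesis .
    qed
    show "row S' r \<noteq> 0\<^sub>v m"
    proof
      assume "row S' r = 0\<^sub>v m"
      then have "row S' r \<bullet> (S *\<^sub>v unit_vec m r) = 0"
        using S(1) by (simp add: scalar_prod_left_zero[of _ m] del: row_def)
      then show False using eq[of "unit_vec m r"] r by simp
    qed
    show "row S' r \<bullet> w = 0" if "w \<in> W" for w
      using that eq r unfolding S(4) by auto
  qed
qed

lemma stably_assoc_swap_blocks:
  fixes L :: "'a::ring_1 mat"
  assumes L: "L \<in> carrier_mat s s"
  shows "stably_assoc (four_block_mat (1\<^sub>m r) (0\<^sub>m r s) (0\<^sub>m s r) L) L"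
proof -
  let ?M = "four_block_mat (1\<^sub>m r) (0\<^sub>m r s) (0\<^sub>m s r) L"
  let ?T = "four_block_mat (0\<^sub>m s r) (1\<^sub>m s) (1\<^sub>m r) (0\<^sub>m r s) :: 'a mat"
  let ?U = "four_block_mat (0\<^sub>m r s) (1\<^sub>m r) (1\<^sub>m s) (0\<^sub>m s r) :: 'a mat"
  have T: "?T \<in> carrier_mat (r + s) (r + s)" "?U \<in> carrier_mat (r + s) (r + s)"
    using four_block_carrier_mat[of "0\<^sub>m s r" s r "0\<^sub>m r s" r s] by (auto simp: add.commute)
  have TU: "?T * ?U = 1\<^sub>m (r + s)"
    by (subst mult_four_block_mat[where ?nr1.0 = s and ?n1.0 = r and ?n2.0 = s and ?nr2.0 = r and ?nc1.0 = s and ?nc2.0 = r])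
      (auto simp: add.commute)
  have UT: "?U * ?T = 1\<^sub>m (r + s)"
    by (subst mult_four_block_mat[where ?nr1.0 = r and ?n1.0 = s and ?n2.0 = r and ?nr2.0 = s and ?nc1.0 = r and ?nc2.0 = s])
      auto
  have M: "?M \<in> carrier_mat (r + s) (r + s)" using L by auto
  have 1: "?U * pad (r + s) L = four_block_mat (0\<^sub>m r s) (1\<^sub>m r) L (0\<^sub>m s r)"
    unfolding add.commute[of r s] pad_conv_four_block[OF L]
    by (subst mult_four_block_mat[where ?nr1.0 = r and ?n1.0 = s and ?n2.0 = r and ?nr2.0 = s and ?nc1.0 = s and ?nc2.0 = r])
      (use L in auto)
  have 2: "?U * pad (r + s) L * ?T = ?M"
    unfolding 1
    by (subst mult_four_block_mat[where ?nr1.0 = r and ?n1.0 = s and ?n2.0 = r and ?nr2.0 = s and ?nc1.0 = r and ?nc2.0 = s])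
      (use L in auto)
  show ?thesis
    by (rule stably_assocI[of ?U "r + s" ?T])
      (use T TU UT M L in \<open>auto simp: 2 pad_same[OF M] intro: invertible_matI[where n = "r + s"]\<close>)
qed

text \<open>In a basis adapted to \<open>W\<close> the pencil is
  \<open>(L\<^sub>1 Y; 0 L\<^sub>2) = (1 Y; 0 L\<^sub>2) (L\<^sub>1 0; 0 1)\<close>. This factors \<open>P \<oplus> 1\<close>, and since \<open>P\<close> is an atom one of the
  two factors is invertible. Absorbing it leaves \<open>P\<close> stably associated to the diagonal block of the
  other factor.\<close>

lemma reducible_linearization_shrinks:
  fixes A :: "'d::finite \<Rightarrow> complex mat" and P :: "'d nc_poly mat"
  assumes atom: "nc_atom k P" and A: "\<forall>j. A j \<in> carrier_mat m m"
    and PA: "stably_assoc P (1\<^sub>m m - lin m A)"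
    and W: "vsubspace m W" "W \<noteq> {0\<^sub>v m}" "W \<noteq> carrier_vec m"
    and inv: "\<And>j w. w \<in> W \<Longrightarrow> A j *\<^sub>v w \<in> W"
  shows "\<exists>m'<m. \<exists>B. (\<forall>j. B j \<in> carrier_mat m' m') \<and> stably_assoc P (1\<^sub>m m' - lin m' B)"
proof -
  obtain S r where S: "S \<in> carrier_mat m m" "invertible_mat S" "r \<le> m"
    "W = {S *\<^sub>v v | v. v \<in> carrier_vec m \<and> (\<forall>i<m. r \<le> i \<longrightarrow> v $ i = 0)}"
    using vsubspace_adapted_basis[OF W(1)] by blast
  obtain S' where S': "S' \<in> carrier_mat m m" "S * S' = 1\<^sub>m m" "S' * S = 1\<^sub>m m"
    using invertible_matE[OF S(2,1)] .
  have iS': "invertible_mat S'" by (rule invertible_matI[OF S'(1) S(1) S'(3,2)])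
  have "r \<noteq> m"
  proof
    assume "r = m"
    then have "w \<in> W" if w: "w \<in> carrier_vec m" for w
      unfolding S(4) using assoc_mult_mat_vec[OF S(1) S'(1) w] S' w
      by (auto intro!: exI[of _ "S' *\<^sub>v w"])
    then show False using W by (auto simp: vsubspace_def)
  qed
  then have rm: "r < m" using S by simp
  have "r \<noteq> 0"
  proof
    assume "r = 0"
    then have "w = 0\<^sub>v m" if w: "w \<in> W" for w
    proof -
      obtain v where v: "w = S *\<^sub>v v" "v \<in> carrier_vec m" "\<forall>i<m. v $ i = 0"
        using w \<open>r = 0\<close> unfolding S(4) by auto
      then have "v = 0\<^sub>v m" by (intro eq_vecI) auto
      then show ?thesis using v S(1) by (intro eq_vecI) auto
    qed
    then show False using W by (auto simp: vsubspace_def)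
  qed
  define s where "s = m - r"
  have m: "m = r + s" using rm by (simp add: s_def)
  define B where "B j = S' * A j * S" for j
  have B: "\<forall>j. B j \<in> carrier_mat m m" using S S' A by (auto simp: B_def intro!: mult_carrier_mat)
  have B0: "B j $$ (p, q) = 0" if "q < r" "r \<le> p" "p < m" for j p q
  proof -
    have q: "q < m" using that by simp
    have "S *\<^sub>v unit_vec m q \<in> W" unfolding S(4) using that by (auto intro!: exI[of _ "unit_vec m q"])
    then have "A j *\<^sub>v (S *\<^sub>v unit_vec m q) \<in> W" by (rule inv)
    then obtain v where v: "A j *\<^sub>v (S *\<^sub>v unit_vec m q) = S *\<^sub>v v" "v \<in> carrier_vec m" "\<forall>i<m. r \<le> i \<longrightarrow> v $ i = 0"
      unfolding S(4) by auto
    have Aj: "A j \<in> carrier_mat m m" using A by blast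
    have SA: "S' * A j \<in> carrier_mat m m" using S' Aj by auto
    have "B j *\<^sub>v unit_vec m q = S' *\<^sub>v (A j *\<^sub>v (S *\<^sub>v unit_vec m q))"
      unfolding B_def using assoc_mult_mat_vec[OF SA S(1), of "unit_vec m q"]
        assoc_mult_mat_vec[OF S'(1) Aj, of "S *\<^sub>v unit_vec m q"] S(1) by simp
    also have "\<dots> = v" unfolding v(1) using assoc_mult_mat_vec[OF S'(1) S(1) v(2)] S' v(2) by simp
    finally have "(B j *\<^sub>v unit_vec m q) $ p = 0" using v(3) that by simp
    moreover have "(B j *\<^sub>v unit_vec m q) $ p = B j $$ (p, q)"
      using B[rule_format, of j] that q by simp
    ultimately show ?thesis by simp
  qed
  define B1 where "B1 j = mat r r (\<lambda>ij. B j $$ ij)" for j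
  define B2 where "B2 j = mat s s (\<lambda>(p, q). B j $$ (p + r, q + r))" for j
  define L1 where "L1 = 1\<^sub>m r - lin r B1"
  define L2 where "L2 = 1\<^sub>m s - lin s B2"
  define Y where "Y = mat r s (\<lambda>(p, q). (1\<^sub>m m - lin m B) $$ (p, q + r))"
  have L1: "L1 \<in> carrier_mat r r" and L2: "L2 \<in> carrier_mat s s" and Y: "Y \<in> carrier_mat r s"
    by (auto simp: L1_def L2_def Y_def minus_carrier_mat)
  have blk: "1\<^sub>m m - lin m B = four_block_mat L1 Y (0\<^sub>m s r) L2"
  proof (rule eq_matI)
    fix p q assume "p < dim_row (four_block_mat L1 Y (0\<^sub>m s r) L2)" "q < dim_col (four_block_mat L1 Y (0\<^sub>m s r) L2)"
    then have pq: "p < m" "q < m" using L1 L2 m by auto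
    show "(1\<^sub>m m - lin m B) $$ (p, q) = four_block_mat L1 Y (0\<^sub>m s r) L2 $$ (p, q)"
      using pq L1 L2 Y B0 m
      by (cases "p < r"; cases "q < r") (auto simp: L1_def L2_def Y_def B1_def B2_def lin_def)
  qed (use L1 L2 m in auto)
  let ?G1 = "four_block_mat (1\<^sub>m r) Y (0\<^sub>m s r) L2"
  let ?C = "const_mat S :: 'd nc_poly mat" and ?C' = "const_mat S' :: 'd nc_poly mat"
  have C: "?C \<in> carrier_mat m m" "?C' \<in> carrier_mat m m" using S S' by auto
  have iC: "invertible_mat ?C" "invertible_mat ?C'"
    using invertible_const_mat[OF S(1,2)] invertible_const_mat[OF S'(1) iS'] by blast+
  have G1: "?G1 \<in> carrier_mat m m" using m L2 by auto
  have fac: "1\<^sub>m m - lin m B = ?G1 * pad m L1"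
    unfolding blk unfolding m pad_conv_four_block[OF L1]
    by (subst mult_square_blocks[where n = r and m = s])
      (use L1 L2 Y in auto)
  have LA: "1\<^sub>m m - lin m A = ?C * (1\<^sub>m m - lin m B) * ?C'"
  proof -
    have "S * B j * S' = A j" for j
    proof -
      have Aj: "A j \<in> carrier_mat m m" using A by blast
      have "S * (S' * A j * S) * S' = (S * S') * A j * (S * S')"
        using S(1) S'(1) Aj by (smt (verit) assoc_mult_mat mult_carrier_mat)
      then show ?thesis using S' Aj by (simp add: B_def)
    qed
    then have "lin m A = lin m (\<lambda>j. S * B j * S')" by simp
    also have "\<dots> = lin m (\<lambda>j. S * B j) * ?C'"
      using S B by (intro lin_mult_const_mat[symmetric] S') (auto intro!: mult_carrier_mat)
    also have "lin m (\<lambda>j. S * B j) = ?C * lin m B"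
      by (intro const_mat_mult_lin[symmetric] S B)
    finally have l: "lin m A = ?C * lin m B * ?C'" .
    have "?C * (1\<^sub>m m - lin m B) = ?C - ?C * lin m B"
      using C by (subst mult_minus_distrib_mat[of _ m m _ m]) auto
    then have "?C * (1\<^sub>m m - lin m B) * ?C' = ?C * ?C' - ?C * lin m B * ?C'"
      using C by (subst minus_mult_distrib_mat[of _ m m _ _ m, symmetric]) auto
    moreover have "?C * ?C' = 1\<^sub>m m"
      using S S' by (simp add: const_mat_one flip: const_mat_mult)
    ultimately show ?thesis using l by simp
  qed
  obtain N E F where NEF: "k \<le> N" "m \<le> N" "E \<in> carrier_mat N N" "F \<in> carrier_mat N N"
    "invertible_mat E" "invertible_mat F" "pad N P = E * pad N (1\<^sub>m m - lin m A) * F"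
    using PA atom unfolding stably_assoc_def nc_atom_def by (auto simp: minus_carrier_mat)
  define F1 where "F1 = E * pad N (?C * ?G1)"
  define F2 where "F2 = pad N (pad m L1 * ?C') * F"
  have F12: "F1 \<in> carrier_mat N N" "F2 \<in> carrier_mat N N"
    using NEF by (auto simp: F1_def F2_def intro!: mult_carrier_mat)
  have CG: "?C * ?G1 \<in> carrier_mat m m" "pad m L1 * ?C' \<in> carrier_mat m m"
    using C G1 by (auto intro!: mult_carrier_mat)
  have "1\<^sub>m m - lin m A = (?C * ?G1) * (pad m L1 * ?C')"
    unfolding LA fac using C G1 pad_carrier[of m L1] by (smt (verit) assoc_mult_mat mult_carrier_mat)
  then have "pad N P = E * (pad N (?C * ?G1) * pad N (pad m L1 * ?C')) * F"
    unfolding NEF(7) using pad_mult[OF CG NEF(2)] by simp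
  also have "\<dots> = F1 * F2"
    unfolding F1_def F2_def using NEF(3,4) pad_carrier[of N "?C * ?G1"] pad_carrier[of N "pad m L1 * ?C'"]
    by (smt (verit) assoc_mult_mat mult_carrier_mat)
  finally have F: "pad N P = F1 * F2" .
  have kP: "dim_row P = k" using atom unfolding nc_atom_def by auto
  from atom_stably_atom[OF atom NEF(1) F12 F[symmetric]] show ?thesis
  proof
    assume inv1: "invertible_mat F1"
    have p: "pad N (pad m L1 * ?C') = pad N L1 * pad N ?C'"
      using pad_mult[OF pad_carrier C(2) NEF(2), of L1] L1 rm NEF(2) by (simp add: pad_pad)
    have "stably_assoc P L1"
    proof (rule stably_assocI[of F1 N "pad N ?C' * F"])
      show "pad N P = F1 * pad N L1 * (pad N ?C' * F)"
        unfolding F F2_def p using F12(1) NEF(4) pad_carrier[of N L1] pad_carrier[of N ?C']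
        by (smt (verit) assoc_mult_mat mult_carrier_mat)
      show "invertible_mat (pad N ?C' * F)"
        using invertible_mat_mult[OF _ pad_carrier NEF(6,4)] iC C NEF(2) by (auto simp: invertible_mat_pad[OF C(2)])
    qed (use inv1 F12 NEF L1 rm kP in auto)
    then show ?thesis unfolding L1_def using rm by (intro exI[of _ r] conjI exI[of _ B1]) (auto simp: B1_def)
  next
    assume inv2: "invertible_mat F2"
    let ?M = "four_block_mat (1\<^sub>m r) (0\<^sub>m r s) (0\<^sub>m s r) L2"
    let ?U = "four_block_mat (1\<^sub>m r) Y (0\<^sub>m s r) (1\<^sub>m s)"
    have MU: "?M \<in> carrier_mat m m" "?U \<in> carrier_mat m m" using m L2 Y by auto
    have "?G1 = ?M * ?U" 
      by (subst mult_square_blocks[where n = r and m = s])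
      (use L2 Y in auto)
    then have "pad N (?C * ?G1) = pad N ?C * (pad N ?M * pad N ?U)"
      using pad_mult[OF C(1) G1 NEF(2)] pad_mult[OF MU NEF(2)] by simp
    then have "pad N P = (E * pad N ?C) * pad N ?M * (pad N ?U * F2)"
      unfolding F F1_def using F12(2) NEF(3) pad_carrier[of N ?C] pad_carrier[of N ?M] pad_carrier[of N ?U]
      by (smt (verit) assoc_mult_mat mult_carrier_mat)
    moreover have "invertible_mat (E * pad N ?C)"
      using invertible_mat_mult[OF NEF(5,3) _ pad_carrier] iC C NEF(2) by (auto simp: invertible_mat_pad[OF C(1)])
    moreover have "invertible_mat (pad N ?U * F2)"
      using invertible_mat_mult[OF _ pad_carrier inv2 F12(2)] invertible_upper_unipotent[OF Y] NEF(2)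
      by (auto simp: invertible_mat_pad[OF MU(2)])
    ultimately have "stably_assoc P ?M"
      using NEF F12 MU kP by (intro stably_assocI[of "E * pad N ?C" N "pad N ?U * F2"]) auto
    then have "stably_assoc P L2" using stably_assoc_trans stably_assoc_swap_blocks[OF L2] by blast
    then show ?thesis unfolding L2_def using \<open>r \<noteq> 0\<close> m
      by (intro exI[of _ s] conjI exI[of _ B2]) (auto simp: B2_def)
  qed
qed

definition irreducible_tuple :: "nat \<Rightarrow> ('d \<Rightarrow> complex mat) \<Rightarrow> bool" where
  "irreducible_tuple m A \<longleftrightarrow> (\<forall>j. A j \<in> carrier_mat m m) \<and>
     (\<forall>W. vsubspace m W \<and> (\<forall>j. \<forall>w\<in>W. A j *\<^sub>v w \<in> W) \<longrightarrow> W = {0\<^sub>v m} \<or> W = carrier_vec m)"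

text \<open>Among all linearizations take one of least size; it admits no nontrivial invariant subspace. For
  invertible \<open>P\<close> the least size is \<open>0\<close>.\<close>

theorem irreducible_linearization:
  fixes P :: "'d::finite nc_poly mat"
  assumes atom: "nc_atom k P" and inv: "invertible_mat (nc_eval P (1, \<lambda>_. 0\<^sub>m 1 1))"
  obtains m A where "irreducible_tuple m A" "stably_assoc P (1\<^sub>m m - lin m A)"
proof -
  have P: "P \<in> carrier_mat k k" using atom by (simp add: nc_atom_def)
  define R where "R m \<longleftrightarrow> (\<exists>A. (\<forall>j. A j \<in> carrier_mat m m) \<and> stably_assoc P (1\<^sub>m m - lin m A))" for m
  have "\<exists>m. R m" using monic_linearization[OF P inv] unfolding R_def by metis
  then obtain m where m: "R m" "\<And>m'. m' < m \<Longrightarrow> \<not> R m'"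
    using exists_least_iff[of R] by blast
  obtain A where A: "\<forall>j. A j \<in> carrier_mat m m" "stably_assoc P (1\<^sub>m m - lin m A)"
    using m(1) unfolding R_def by blast
  have "irreducible_tuple m A"
    unfolding irreducible_tuple_def
    using A reducible_linearization_shrinks[OF atom A] m(2) unfolding R_def by metis
  then show ?thesis using that A by blast
qed

section \<open>Burnside's theorem\<close>

lemma smult_mult_mat_vec:
  fixes M :: "'a::comm_ring_1 mat"
  assumes "M \<in> carrier_mat n m" "v \<in> carrier_vec m"
  shows "(c \<cdot>\<^sub>m M) *\<^sub>v v = c \<cdot>\<^sub>v (M *\<^sub>v v)"
  by (rule eq_vecI) (use assms in \<open>auto simp: scalar_prod_def sum_distrib_left mult.assoc\<close>)

lemma linear_map_matrix:
  fixes f :: "complex vec \<Rightarrow> complex vec"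
  assumes car: "\<And>v. v \<in> carrier_vec m \<Longrightarrow> f v \<in> carrier_vec m"
    and add: "\<And>v w. v \<in> carrier_vec m \<Longrightarrow> w \<in> carrier_vec m \<Longrightarrow> f (v + w) = f v + f w"
    and smult: "\<And>c v. v \<in> carrier_vec m \<Longrightarrow> f (c \<cdot>\<^sub>v v) = c \<cdot>\<^sub>v f v"
  obtains M where "M \<in> carrier_mat m m" "\<And>v. v \<in> carrier_vec m \<Longrightarrow> f v = M *\<^sub>v v"
proof -
  define M where "M = mat m m (\<lambda>(p, q). f (unit_vec m q) $ p)"
  have M: "M \<in> carrier_mat m m" by (simp add: M_def)
  have "f v = M *\<^sub>v v" if v: "v \<in> carrier_vec m" for v
  proof -
    have "t \<le> m \<Longrightarrow> f (vec m (\<lambda>i. if i < t then v $ i else 0)) = M *\<^sub>v vec m (\<lambda>i. if i < t then v $ i else 0)" for t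
    proof (induction t)
      case 0
      have z: "vec m (\<lambda>i. 0) = (0\<^sub>v m :: complex vec)" by (rule eq_vecI) auto
      have "(0::complex) \<cdot>\<^sub>v 0\<^sub>v m = 0\<^sub>v m" by (rule eq_vecI) auto
      moreover have "f (0 \<cdot>\<^sub>v 0\<^sub>v m) = 0 \<cdot>\<^sub>v f (0\<^sub>v m)" by (rule smult) simp
      moreover have "0 \<cdot>\<^sub>v f (0\<^sub>v m) = 0\<^sub>v m" using car[of "0\<^sub>v m"] by (intro eq_vecI) auto
      ultimately have "f (0\<^sub>v m) = 0\<^sub>v m" by simp
      moreover have "M *\<^sub>v 0\<^sub>v m = 0\<^sub>v m" using M by (intro eq_vecI) auto
      ultimately show ?case by (simp add: z)
    next
      case (Suc t)
      have u: "unit_vec m t \<in> carrier_vec m" by simp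
      have *: "vec m (\<lambda>i. if i < Suc t then v $ i else 0) =
          vec m (\<lambda>i. if i < t then v $ i else 0) + v $ t \<cdot>\<^sub>v unit_vec m t"
        by (rule eq_vecI) (use Suc.prems in \<open>auto simp: unit_vec_def less_Suc_eq\<close>)
      have "f (unit_vec m t) = M *\<^sub>v unit_vec m t"
        using Suc.prems car[OF u] by (intro eq_vecI) (auto simp: M_def)
      then show ?case unfolding * using Suc M
        by (simp add: add smult mult_add_distrib_mat_vec[of _ m m] mult_mat_vec[of _ m m])
    qed
    moreover have "vec m (\<lambda>i. if i < m then v $ i else 0) = v" using v by (intro eq_vecI) auto
    ultimately show ?thesis by (metis order.refl)
  qed
  with M that show ?thesis by blast
qed

definition matrix_algebra :: "nat \<Rightarrow> complex mat set \<Rightarrow> bool" where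
  "matrix_algebra m \<A> \<longleftrightarrow> \<A> \<subseteq> carrier_mat m m \<and> 1\<^sub>m m \<in> \<A> \<and>
     (\<forall>a\<in>\<A>. \<forall>b\<in>\<A>. a + b \<in> \<A> \<and> a * b \<in> \<A>) \<and> (\<forall>c. \<forall>a\<in>\<A>. c \<cdot>\<^sub>m a \<in> \<A>)"

text \<open>Jacobson's density argument, by induction on the list. Let \<open>I\<close> be the left ideal of elements that
  kill \<open>xs\<close>. If \<open>I\<close> does not kill the next vector \<open>x\<close>, then \<open>I x\<close> is everything, and \<open>a x \<mapsto> a y\<close> for
  \<open>a \<in> I\<close> is a well-defined linear map commuting with the algebra. It has an eigenvalue \<open>\<mu>\<close>, and as
  the algebra is transitive it equals multiplication by \<open>\<mu>\<close>. So \<open>I\<close> kills \<open>y - \<mu> x\<close>, to which the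
  induction hypothesis applies. Membership in every subspace \<open>W\<close> containing the list replaces the
  linear span.\<close>

lemma transitive_algebra_dense:
  assumes alg: "matrix_algebra m \<A>"
    and trans: "\<And>x y. x \<in> carrier_vec m \<Longrightarrow> x \<noteq> 0\<^sub>v m \<Longrightarrow> y \<in> carrier_vec m \<Longrightarrow> \<exists>a\<in>\<A>. a *\<^sub>v x = y"
  shows "vsubspace m W \<Longrightarrow> set xs \<subseteq> W \<Longrightarrow> y \<in> carrier_vec m \<Longrightarrow>
    (\<And>a. a \<in> \<A> \<Longrightarrow> \<forall>x\<in>set xs. a *\<^sub>v x = 0\<^sub>v m \<Longrightarrow> a *\<^sub>v y = 0\<^sub>v m) \<Longrightarrow> y \<in> W"
proof (induction xs arbitrary: y)
  case Nil
  have "1\<^sub>m m \<in> \<A>" using alg by (simp add: matrix_algebra_def)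
  then have "y = 0\<^sub>v m" using Nil.prems(4)[of "1\<^sub>m m"] Nil.prems(3) by simp
  then show ?case using Nil.prems(1) by (simp add: vsubspace_def)
next
  case (Cons x xs)
  have car: "a \<in> carrier_mat m m" if "a \<in> \<A>" for a using that alg by (auto simp: matrix_algebra_def)
  have W: "W \<subseteq> carrier_vec m" using Cons.prems(1) by (simp add: vsubspace_def)
  have x: "x \<in> carrier_vec m" "x \<in> W" "set xs \<subseteq> W" using Cons.prems(2) W by auto
  have xs: "x' \<in> carrier_vec m" if "x' \<in> set xs" for x' using that x W by auto
  note y = Cons.prems(3)
  define I where "I = {a \<in> \<A>. \<forall>x'\<in>set xs. a *\<^sub>v x' = 0\<^sub>v m}"
  have Icar: "a \<in> carrier_mat m m" if "a \<in> I" for a using that car by (auto simp: I_def)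
  have Iadd: "a + b \<in> I" if "a \<in> I" "b \<in> I" for a b
    using that alg car xs by (auto simp: I_def matrix_algebra_def add_mult_distrib_mat_vec[of _ m m])
  have Ismult: "c \<cdot>\<^sub>m a \<in> I" if "a \<in> I" for a c
    using that alg car xs by (auto simp: I_def matrix_algebra_def smult_mult_mat_vec[of _ m m] intro!: eq_vecI)
  have Imult: "b * a \<in> I" if "b \<in> \<A>" "a \<in> I" for a b
  proof -
    have "b * a *\<^sub>v x' = 0\<^sub>v m" if "x' \<in> set xs" for x'
      using assoc_mult_mat_vec[of b m m a m x'] car[OF \<open>b \<in> \<A>\<close>] Icar[OF \<open>a \<in> I\<close>] xs[OF that] \<open>a \<in> I\<close> that
      by (auto simp: I_def intro!: eq_vecI)
    then show ?thesis using that alg by (auto simp: I_def matrix_algebra_def)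
  qed
  have kill: "a *\<^sub>v y = 0\<^sub>v m" if "a \<in> I" "a *\<^sub>v x = 0\<^sub>v m" for a
    using Cons.prems(4)[of a] that by (auto simp: I_def)
  have kill2: "a *\<^sub>v y = b *\<^sub>v y" if "a \<in> I" "b \<in> I" "a *\<^sub>v x = b *\<^sub>v x" for a b
  proof -
    note c = Icar[OF that(1)] Icar[OF that(2)]
    have d: "(a + (-1) \<cdot>\<^sub>m b) *\<^sub>v v = a *\<^sub>v v + - (b *\<^sub>v v)" if "v \<in> carrier_vec m" for v
      using that c by (intro eq_vecI) (auto simp: add_scalar_prod_distrib[of _ m])
    have "(a + (-1) \<cdot>\<^sub>m b) *\<^sub>v x = 0\<^sub>v m"
      unfolding d[OF x(1)] that(3) using c x(1) by (intro uminus_r_inv_vec) auto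
    then have "a *\<^sub>v y + - (b *\<^sub>v y) = 0\<^sub>v m"
      using kill[of "a + (-1) \<cdot>\<^sub>m b"] Iadd Ismult that d[OF y] by simp
    then have "(a *\<^sub>v y + - (b *\<^sub>v y)) $ i = 0" if "i < m" for i using that by simp
    then show ?thesis using c by (intro eq_vecI) auto
  qed
  show ?case
  proof (cases "\<forall>a\<in>I. a *\<^sub>v x = 0\<^sub>v m")
    case True
    then have "a *\<^sub>v y = 0\<^sub>v m" if "a \<in> \<A>" "\<forall>x\<in>set xs. a *\<^sub>v x = 0\<^sub>v m" for a
      using kill that by (auto simp: I_def)
    then show ?thesis using Cons.IH[OF Cons.prems(1) x(3) y] by blast
  next
    case False
    then obtain a0 where a0: "a0 \<in> I" "a0 *\<^sub>v x \<noteq> 0\<^sub>v m" by blast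
    have ex: "\<exists>a\<in>I. a *\<^sub>v x = v" if v: "v \<in> carrier_vec m" for v
    proof -
      obtain c where c: "c \<in> \<A>" "c *\<^sub>v (a0 *\<^sub>v x) = v"
        using trans[OF _ a0(2) v] Icar[OF a0(1)] x(1) by (meson mult_mat_vec_carrier)
      then show ?thesis
        using Imult[OF c(1) a0(1)] assoc_mult_mat_vec[OF car[OF c(1)] Icar[OF a0(1)] x(1)] by (intro bexI[of _ "c * a0"]) auto
    qed
    \<comment> \<open>\<open>g\<close> selects a preimage under \<open>a \<mapsto> a x\<close>; by \<open>kill2\<close> the vector \<open>g v y\<close> depends only on \<open>v\<close>.\<close>
    define g where "g v = (SOME a. a \<in> I \<and> a *\<^sub>v x = v)" for v
    have g: "g v \<in> I" "g v *\<^sub>v x = v" if "v \<in> carrier_vec m" for v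
      using someI_ex[of "\<lambda>a. a \<in> I \<and> a *\<^sub>v x = v"] ex[OF that] unfolding g_def by blast+
    obtain M where M: "M \<in> carrier_mat m m" "\<And>v. v \<in> carrier_vec m \<Longrightarrow> g v *\<^sub>v y = M *\<^sub>v v"
    proof (rule linear_map_matrix[of m "\<lambda>v. g v *\<^sub>v y"])
      show "g v *\<^sub>v y \<in> carrier_vec m" if "v \<in> carrier_vec m" for v
        using Icar[OF g(1)[OF that]] y by auto
      show "g (v + w) *\<^sub>v y = g v *\<^sub>v y + g w *\<^sub>v y" if v: "v \<in> carrier_vec m" and w: "w \<in> carrier_vec m" for v w
      proof -
        have vw: "v + w \<in> carrier_vec m" using v w by simp
        have "g (v + w) *\<^sub>v y = (g v + g w) *\<^sub>v y"
          by (rule kill2) (use g[OF v] g[OF w] g[OF vw] Iadd x Icar in \<open>auto simp: add_mult_distrib_mat_vec[of _ m m]\<close>)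
        then show ?thesis using Icar[OF g(1)[OF v]] Icar[OF g(1)[OF w]] y by (simp add: add_mult_distrib_mat_vec[of _ m m])
      qed
      show "g (c \<cdot>\<^sub>v v) *\<^sub>v y = c \<cdot>\<^sub>v (g v *\<^sub>v y)" if v: "v \<in> carrier_vec m" for c v
      proof -
        have cv: "c \<cdot>\<^sub>v v \<in> carrier_vec m" using v by simp
        have "g (c \<cdot>\<^sub>v v) *\<^sub>v y = (c \<cdot>\<^sub>m g v) *\<^sub>v y"
          by (rule kill2) (use g[OF v] g[OF cv] Ismult x Icar in \<open>auto simp: smult_mult_mat_vec[of _ m m]\<close>)
        then show ?thesis using Icar[OF g(1)[OF v]] y by (simp add: smult_mult_mat_vec[of _ m m])
      qed
    qed (rule that)
    have "m > 0"
    proof (rule ccontr)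
      assume "\<not> m > 0"
      then have "a0 *\<^sub>v x = 0\<^sub>v m" using Icar[OF a0(1)] x(1) by (intro eq_vecI) auto
      then show False using a0 by simp
    qed
    then obtain \<mu> where "eigenvalue M \<mu>" using spectrum_non_empty[OF M(1)] by (auto simp: spectrum_def)
    then obtain v where v: "v \<in> carrier_vec m" "v \<noteq> 0\<^sub>v m" "M *\<^sub>v v = \<mu> \<cdot>\<^sub>v v"
      using M(1) by (auto simp: eigenvalue_def eigenvector_def)
    define z where "z = y + (- \<mu>) \<cdot>\<^sub>v x"
    have z: "z \<in> carrier_vec m" using x y by (simp add: z_def)
    have "b *\<^sub>v z = 0\<^sub>v m" if b: "b \<in> I" for b
    proof -
      note bc = Icar[OF b]
      obtain c where c: "c \<in> \<A>" "c *\<^sub>v v = b *\<^sub>v x"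
        using trans[OF v(1,2), of "b *\<^sub>v x"] bc x(1) by auto
      note cc = car[OF c(1)] and gc = Icar[OF g(1)[OF v(1)]]
      have "c * g v *\<^sub>v x = b *\<^sub>v x" using assoc_mult_mat_vec[OF cc gc x(1)] g[OF v(1)] c by simp
      then have "b *\<^sub>v y = c * g v *\<^sub>v y" using kill2[OF b Imult[OF c(1) g(1)[OF v(1)]]] by simp
      also have "\<dots> = c *\<^sub>v (\<mu> \<cdot>\<^sub>v v)" using assoc_mult_mat_vec[OF cc gc y] M(2)[OF v(1)] v(3) by simp
      also have "\<dots> = \<mu> \<cdot>\<^sub>v (b *\<^sub>v x)" using mult_mat_vec[OF cc v(1)] c(2) by simp
      finally have "b *\<^sub>v y = \<mu> \<cdot>\<^sub>v (b *\<^sub>v x)" .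
      moreover have "b *\<^sub>v z = b *\<^sub>v y + (- \<mu>) \<cdot>\<^sub>v (b *\<^sub>v x)"
        unfolding z_def using bc x y by (simp add: mult_add_distrib_mat_vec[of _ m m] mult_mat_vec[of _ m m])
      ultimately show ?thesis using bc x by (intro eq_vecI) auto
    qed
    then have "z \<in> W" using Cons.IH[OF Cons.prems(1) x(3) z] by (auto simp: I_def)
    then have "z + \<mu> \<cdot>\<^sub>v x \<in> W" using Cons.prems(1) x(2) by (simp add: vsubspace_def)
    moreover have "z + \<mu> \<cdot>\<^sub>v x = y" unfolding z_def using x y by (intro eq_vecI) auto
    ultimately show ?thesis by simp
  qed
qed

lemma transitive_algebra_matrix_unit:
  assumes alg: "matrix_algebra m \<A>"
    and trans: "\<And>x y. x \<in> carrier_vec m \<Longrightarrow> x \<noteq> 0\<^sub>v m \<Longrightarrow> y \<in> carrier_vec m \<Longrightarrow> \<exists>a\<in>\<A>. a *\<^sub>v x = y"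
    and pq: "p < m" "q < m"
  shows "\<exists>a\<in>\<A>. \<forall>i<m. \<forall>j<m. a $$ (i, j) = (if i = p \<and> j = q then 1 else 0)"
proof -
  have car: "a \<in> carrier_mat m m" if "a \<in> \<A>" for a using that alg by (auto simp: matrix_algebra_def)
  define W :: "complex vec set" where "W = {v \<in> carrier_vec m. v $ q = 0}"
  have W: "vsubspace m W" using pq by (auto simp: W_def vsubspace_def)
  define xs :: "complex vec list" where "xs = map (unit_vec m) (filter (\<lambda>j. j \<noteq> q) [0..<m])"
  have xs: "set xs \<subseteq> W" using pq by (auto simp: xs_def W_def unit_vec_def)
  have "unit_vec m q \<notin> W" using pq by (simp add: W_def)
  then obtain a where a: "a \<in> \<A>" "\<forall>x\<in>set xs. a *\<^sub>v x = 0\<^sub>v m" "a *\<^sub>v unit_vec m q \<noteq> 0\<^sub>v m"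
    using transitive_algebra_dense[OF alg trans W xs, of "unit_vec m q"] by auto
  obtain c where c: "c \<in> \<A>" "c *\<^sub>v (a *\<^sub>v unit_vec m q) = unit_vec m p"
    using trans[OF _ a(3), of "unit_vec m p"] car[OF a(1)] by auto
  have "(c * a) $$ (i, j) = (if i = p \<and> j = q then 1 else 0)" if ij: "i < m" "j < m" for i j
  proof -
    note cc = car[OF c(1)] and ac = car[OF a(1)]
    have "c * a *\<^sub>v unit_vec m j = c *\<^sub>v (a *\<^sub>v unit_vec m j)"
      using cc ac by (intro assoc_mult_mat_vec) auto
    also have "\<dots> = (if j = q then unit_vec m p else 0\<^sub>v m)"
    proof (cases "j = q")
      case False
      then have "a *\<^sub>v unit_vec m j = 0\<^sub>v m" using a(2) ij by (auto simp: xs_def)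
      then show ?thesis using False cc by (auto intro!: eq_vecI)
    qed (use c in simp)
    finally have "(c * a *\<^sub>v unit_vec m j) $ i = (if j = q then unit_vec m p else 0\<^sub>v m) $ i" by simp
    moreover have "(c * a *\<^sub>v unit_vec m j) $ i = (c * a) $$ (i, j)"
      using ij cc ac by (simp del: assoc_mult_mat_vec)
    ultimately have "(c * a) $$ (i, j) = (if j = q then unit_vec m p else 0\<^sub>v m) $ i" by simp
    then show ?thesis using ij pq by (simp add: unit_vec_def)
  qed
  moreover have "c * a \<in> \<A>" using alg a c by (auto simp: matrix_algebra_def)
  ultimately show ?thesis by blast
qed

text \<open>Burnside's theorem for the algebra of all values \<open>f(A)\<close>: the orbit of a nonzero vector is an
  invariant subspace, hence everything.\<close>

theorem irreducible_tuple_matrix_unit: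
  fixes A :: "'d \<Rightarrow> complex mat"
  assumes irr: "irreducible_tuple m A" and pq: "p < m" "q < m"
  obtains f :: "'d nc_poly" where
    "\<And>i j. i < m \<Longrightarrow> j < m \<Longrightarrow> ev m A f $$ (i, j) = (if i = p \<and> j = q then 1 else 0)"
proof -
  have A: "\<forall>j. A j \<in> carrier_mat m m" using irr by (simp add: irreducible_tuple_def)
  define \<A> where "\<A> = range (ev m A)"
  have evadd: "ev m A f + ev m A g = ev m A (f + g)" for f g
    by (rule eq_matI) (auto simp: ev_add)
  have evsmult: "c \<cdot>\<^sub>m ev m A f = ev m A (Poly_Mapping.single 0 c * f)" for c f
    by (rule eq_matI) (auto simp: ev_mult[OF A] ev_const)
  have alg: "matrix_algebra m \<A>"
    unfolding matrix_algebra_def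
  proof (intro conjI ballI allI)
    show "1\<^sub>m m \<in> \<A>" unfolding \<A>_def ev_one[of m A, symmetric] by (rule rangeI)
    show "a + b \<in> \<A>" "a * b \<in> \<A>" if ab: "a \<in> \<A>" "b \<in> \<A>" for a b
    proof -
      obtain f g where fg: "a = ev m A f" "b = ev m A g" using ab unfolding \<A>_def by blast
      show "a + b \<in> \<A>" unfolding \<A>_def fg evadd by (rule rangeI)
      show "a * b \<in> \<A>" unfolding \<A>_def fg ev_mult[OF A, symmetric] by (rule rangeI)
    qed
    show "c \<cdot>\<^sub>m a \<in> \<A>" if a: "a \<in> \<A>" for a c
    proof -
      obtain f where f: "a = ev m A f" using a by (auto simp: \<A>_def)
      show ?thesis unfolding \<A>_def f evsmult by (rule rangeI)
    qed
  qed (auto simp: \<A>_def)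
  have trans: "\<exists>a\<in>\<A>. a *\<^sub>v x = y" if x: "x \<in> carrier_vec m" "x \<noteq> 0\<^sub>v m" and y: "y \<in> carrier_vec m" for x y
  proof -
    define W where "W = (\<lambda>a. a *\<^sub>v x) ` \<A>"
    have car: "a \<in> carrier_mat m m" if "a \<in> \<A>" for a using that by (auto simp: \<A>_def)
    have "vsubspace m W"
    proof -
      have "0\<^sub>v m \<in> W" unfolding W_def
      proof (rule image_eqI)
        show "0 \<cdot>\<^sub>m 1\<^sub>m m \<in> \<A>" using alg by (simp add: matrix_algebra_def)
        show "0\<^sub>v m = 0 \<cdot>\<^sub>m 1\<^sub>m m *\<^sub>v x" using x by (intro eq_vecI) auto
      qed
      moreover have "v + w \<in> W" if vw: "v \<in> W" "w \<in> W" for v w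
      proof -
        obtain a b where "a \<in> \<A>" "b \<in> \<A>" "v = a *\<^sub>v x" "w = b *\<^sub>v x" using vw by (auto simp: W_def)
        moreover have "a + b \<in> \<A>" using alg calculation by (simp add: matrix_algebra_def)
        moreover have "(a + b) *\<^sub>v x = a *\<^sub>v x + b *\<^sub>v x"
          using calculation car x by (intro add_mult_distrib_mat_vec) auto
        ultimately have "v + w = (a + b) *\<^sub>v x" "a + b \<in> \<A>" by auto
        then show ?thesis unfolding W_def by (rule image_eqI)
      qed
      moreover have "c \<cdot>\<^sub>v v \<in> W" if v: "v \<in> W" for c v
      proof -
        obtain a where "a \<in> \<A>" "v = a *\<^sub>v x" using v by (auto simp: W_def)
        moreover have "c \<cdot>\<^sub>m a \<in> \<A>" using alg calculation by (simp add: matrix_algebra_def)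
        moreover have "(c \<cdot>\<^sub>m a) *\<^sub>v x = c \<cdot>\<^sub>v (a *\<^sub>v x)"
          using calculation car x by (intro smult_mult_mat_vec) auto
        ultimately have "c \<cdot>\<^sub>v v = (c \<cdot>\<^sub>m a) *\<^sub>v x" "c \<cdot>\<^sub>m a \<in> \<A>" by auto
        then show ?thesis unfolding W_def by (rule image_eqI)
      qed
      moreover have "W \<subseteq> carrier_vec m"
        unfolding W_def using car x by (blast intro: mult_mat_vec_carrier)
      ultimately show ?thesis unfolding vsubspace_def by blast
    qed
    moreover have "A j *\<^sub>v w \<in> W" if w: "w \<in> W" for j w
    proof -
      obtain f where f: "w = ev m A f *\<^sub>v x" using w by (auto simp: W_def \<A>_def)
      have Aj: "A j = ev m A (Poly_Mapping.single (NCWord [j]) 1)"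
        by (rule eq_matI) (use A[rule_format, of j] in \<open>auto simp: ev_single word_eval_Cons word_eval_Nil\<close>)
      have "A j *\<^sub>v w = ev m A (Poly_Mapping.single (NCWord [j]) 1 * f) *\<^sub>v x"
        unfolding f Aj ev_mult[OF A] using x by (intro assoc_mult_mat_vec[symmetric]) auto
      then show ?thesis by (auto simp: W_def \<A>_def)
    qed
    ultimately have "W = {0\<^sub>v m} \<or> W = carrier_vec m" using irr by (auto simp: irreducible_tuple_def)
    moreover have "x \<in> W" unfolding W_def
    proof (rule image_eqI)
      show "1\<^sub>m m \<in> \<A>" using alg by (simp add: matrix_algebra_def)
    qed (use x in simp)
    ultimately have "y \<in> W" using x y by auto
    then show ?thesis by (auto simp: W_def)
  qed
  obtain a where "a \<in> \<A>" "\<forall>i<m. \<forall>j<m. a $$ (i, j) = (if i = p \<and> j = q then 1 else 0)"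
    using transitive_algebra_matrix_unit[OF alg trans pq] by blast
  with that show ?thesis unfolding \<A>_def by blast
qed

lemma trace_eigenvalue_bound:
  fixes M :: "complex mat"
  assumes M: "M \<in> carrier_mat m m" and ev: "\<And>\<mu>. eigenvalue M \<mu> \<Longrightarrow> norm \<mu> \<le> b"
  shows "norm (\<Sum>i<m. M $$ (i, i)) \<le> real m * b"
proof -
  obtain es where es: "char_poly M = (\<Prod>a\<leftarrow>es. [:- a, 1:])" using char_poly_factorized[OF M] by auto
  obtain B where B: "B \<in> carrier_mat m m" "upper_triangular B" "similar_mat M B"
    using schur_decomposition_exists[OF M es] by blast
  obtain S T where "similar_mat_wit M B S T" using B(3) unfolding similar_mat_def by blast
  from similar_mat_witD2[OF M this]
  have ST: "S \<in> carrier_mat m m" "T \<in> carrier_mat m m" "T * S = 1\<^sub>m m" "M = S * B * T"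
    by blast+
  have tr: "(\<Sum>i<m. (X * Y) $$ (i, i)) = (\<Sum>i<m. (Y * X) $$ (i, i))"
    if "X \<in> carrier_mat m m" "Y \<in> carrier_mat m m" for X Y :: "complex mat"
  proof -
    have "(\<Sum>i<m. (X * Y) $$ (i, i)) = (\<Sum>i<m. \<Sum>l<m. X $$ (i, l) * Y $$ (l, i))"
      by (simp add: mat_mult_index_sum[OF that] del: index_mult_mat(1))
    also have "\<dots> = (\<Sum>l<m. \<Sum>i<m. X $$ (i, l) * Y $$ (l, i))" by (rule sum.swap)
    also have "\<dots> = (\<Sum>i<m. (Y * X) $$ (i, i))"
      by (simp add: mat_mult_index_sum[OF that(2,1)] mult.commute del: index_mult_mat(1))
    finally show ?thesis .
  qed
  have "(\<Sum>i<m. M $$ (i, i)) = (\<Sum>i<m. (T * (S * B)) $$ (i, i))"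
    unfolding ST(4) using ST B by (intro tr) auto
  also have "T * (S * B) = B" using assoc_mult_mat[OF ST(2,1) B(1)] ST B by simp
  finally have "(\<Sum>i<m. M $$ (i, i)) = (\<Sum>i<m. B $$ (i, i))" .
  moreover have "norm (B $$ (i, i)) \<le> b" if i: "i < m" for i
  proof (rule ev)
    have "char_poly M = (\<Prod>a\<leftarrow>diag_mat B. [:- a, 1:])"
      using char_poly_similar[OF B(3)] char_poly_upper_triangular[OF B(1,2)] by simp
    moreover have "B $$ (i, i) \<in> set (diag_mat B)" using i B(1) by (auto simp: diag_mat_def)
    ultimately show "eigenvalue M (B $$ (i, i))"
      unfolding eigenvalue_root_char_poly[OF M] by (auto simp: poly_prod_list prod_list_zero_iff)
  qed
  ultimately show ?thesis
    using sum_norm_bound[of "{..<m}" "\<lambda>i. B $$ (i, i)" b] by simp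
qed

section \<open>Hilbert space preliminaries\<close>

text \<open>The norm of the first \<open>n\<close> members of a family, for vectors of \<open>\<complex>\<^sup>n\<close> as well as for families in a
  Hilbert space.\<close>

abbreviation l2n :: "nat \<Rightarrow> (nat \<Rightarrow> 'a::real_normed_vector) \<Rightarrow> real" where
  "l2n n f \<equiv> L2_set (\<lambda>a. norm (f a)) {..<n}"

lemma l2n_nonneg: "0 \<le> l2n n f" by (rule L2_set_nonneg)

lemma l2n_cong: "(\<And>a. a < n \<Longrightarrow> f a = g a) \<Longrightarrow> l2n n f = l2n n g"
  by (rule L2_set_cong) auto

lemma l2n_triangle: "l2n n (\<lambda>a. f a + g a) \<le> l2n n f + l2n n g"
proof -
  have "l2n n (\<lambda>a. f a + g a) \<le> L2_set (\<lambda>a. norm (f a) + norm (g a)) {..<n}"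
    by (rule L2_set_mono) (auto intro: norm_triangle_ineq)
  also have "\<dots> \<le> l2n n f + l2n n g" by (rule L2_set_triangle_ineq)
  finally show ?thesis .
qed

lemma L2_set_zero[simp]: "L2_set (\<lambda>a. 0) A = 0" by (simp add: L2_set_def)

lemma l2n_eq_0: "l2n n f = 0 \<longleftrightarrow> (\<forall>a<n. f a = 0)"
  by (auto simp: L2_set_eq_0_iff)

lemma l2n_sum: "l2n n (\<lambda>a. \<Sum>s\<in>S. f s a) \<le> (\<Sum>s\<in>S. l2n n (f s))"
proof (induction S rule: infinite_finite_induct)
  case (insert s S)
  have "l2n n (\<lambda>a. \<Sum>s\<in>insert s S. f s a) = l2n n (\<lambda>a. f s a + (\<Sum>s\<in>S. f s a))"
    using insert by simp
  also have "\<dots> \<le> l2n n (f s) + l2n n (\<lambda>a. \<Sum>s\<in>S. f s a)" by (rule l2n_triangle)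
  finally show ?case using insert by simp
qed auto

lemma l2n_mult: "l2n n (\<lambda>a. c * f a) = norm c * l2n n (f :: nat \<Rightarrow> complex)"
  by (simp add: norm_mult L2_set_right_distrib)

lemma l2n_scaleR: "l2n n (\<lambda>a. r *\<^sub>R f a) = \<bar>r\<bar> * l2n n f"
  by (simp add: L2_set_right_distrib)

lemma l2n_power2: "(l2n n f)\<^sup>2 = (\<Sum>a<n. (norm (f a))\<^sup>2)"
  by (simp add: L2_set_def sum_nonneg)

lemma l2n_le_iff: "l2n n f \<le> l2n m g \<longleftrightarrow> (\<Sum>a<n. (norm (f a))\<^sup>2) \<le> (\<Sum>a<m. (norm (g a))\<^sup>2)"
  by (simp add: L2_set_def)

lemma norm_le_l2n: "a < n \<Longrightarrow> norm (f a) \<le> l2n n f"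
  by (rule member_le_L2_set) auto

lemma scaleC_zero[simp]: "scaleC a (0 :: 'h::complex_hilbert) = 0"
  using scaleC_add_right[of a 0 "0 :: 'h"] by simp

lemma scaleC_sum: "scaleC a (\<Sum>s\<in>S. f s) = (\<Sum>s\<in>S. scaleC a (f s :: 'h::complex_hilbert))"
  by (induction S rule: infinite_finite_induct) (auto simp: scaleC_add_right)

lemma scaleC_left_zero[simp]: "scaleC 0 (x :: 'h::complex_hilbert) = 0"
  using scaleC_add_left[of 0 0 x] by simp

lemma scaleC_scaleR: "scaleC a (scaleR r x) = scaleR r (scaleC a (x :: 'h::complex_hilbert))"
  by (simp add: scaleR_eq_scaleC scaleC_scaleC mult.commute)

lemma scaleC_sum_left: "scaleC (\<Sum>s\<in>S. f s) x = (\<Sum>s\<in>S. scaleC (f s) (x :: 'h::complex_hilbert))"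
  by (induction S rule: infinite_finite_induct) (auto simp: scaleC_add_left)

lemma cinner_zero_left[simp]: "cinner (0 :: 'h::complex_hilbert) y = 0"
  using cinner_add_left[of 0 0 y] by simp

lemma cinner_sum_left: "cinner (\<Sum>s\<in>S. f s) y = (\<Sum>s\<in>S. cinner (f s) (y :: 'h::complex_hilbert))"
  by (induction S rule: infinite_finite_induct) (auto simp: cinner_add_left)

lemma cinner_scaleC_right: "cinner z (scaleC a u) = cnj a * cinner z (u :: 'h::complex_hilbert)"
proof -
  have "cinner z (scaleC a u) = cnj (cinner (scaleC a u) z)" by (rule cinner_commute)
  also have "\<dots> = cnj a * cnj (cinner u z)" by (simp add: cinner_scaleC_left)
  also have "cnj (cinner u z) = cinner z u" by (rule cinner_commute[symmetric])
  finally show ?thesis .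
qed

lemma cinner_add_right: "cinner z (u + v) = cinner z u + cinner z (v :: 'h::complex_hilbert)"
proof -
  have "cinner z (u + v) = cnj (cinner (u + v) z)" by (rule cinner_commute)
  also have "\<dots> = cnj (cinner u z) + cnj (cinner v z)" by (simp add: cinner_add_left)
  finally show ?thesis by (simp only: cinner_commute[symmetric])
qed

lemma norm_scaleC: "norm (scaleC a x) = norm a * norm (x :: 'h::complex_hilbert)"
proof -
  have "cinner (scaleC a x) (scaleC a x) = (a * cnj a) * cinner x x"
    by (simp add: cinner_scaleC_left cinner_scaleC_right)
  then have "complex_of_real ((norm (scaleC a x))\<^sup>2) = complex_of_real ((norm a)\<^sup>2 * (norm x)\<^sup>2)"
    by (simp only: cinner_self complex_norm_square[symmetric] of_real_mult)
  then have "(norm (scaleC a x))\<^sup>2 = (norm a * norm x)\<^sup>2"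
    by (simp only: of_real_eq_iff power_mult_distrib)
  then show ?thesis by (simp add: power2_eq_iff_nonneg)
qed

lemma cinner_cauchy_schwarz: "norm (cinner x y) \<le> norm x * norm (y :: 'h::complex_hilbert)"
proof (cases "y = 0")
  case True
  then show ?thesis using cinner_commute[of x y] by simp
next
  case False
  define c where "c = cinner x y"
  define t where "t = (norm y)\<^sup>2"
  have t: "t > 0" using False by (simp add: t_def)
  have yy: "cinner y y = complex_of_real t" and xx: "cinner x x = complex_of_real ((norm x)\<^sup>2)"
    and yx: "cinner y x = cnj c" and xy: "cinner x y = c"
    using cinner_commute[of y x] by (auto simp: cinner_self t_def c_def)
  let ?z = "scaleC (complex_of_real t) x + scaleC (- c) y"
  have "cinner ?z ?z = complex_of_real t * (complex_of_real t * complex_of_real ((norm x)\<^sup>2) - c * cnj c)"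
    by (simp only: cinner_add_right cinner_scaleC_right cinner_add_left cinner_scaleC_left yy xx yx xy)
      (simp add: algebra_simps)
  also have "\<dots> = complex_of_real (t * (t * (norm x)\<^sup>2 - (norm c)\<^sup>2))"
    by (simp only: of_real_mult of_real_diff complex_norm_square)
  finally have "(norm ?z)\<^sup>2 = t * (t * (norm x)\<^sup>2 - (norm c)\<^sup>2)"
    by (simp only: cinner_self of_real_eq_iff)
  then have "t * (t * (norm x)\<^sup>2 - (norm c)\<^sup>2) \<ge> 0"
    by (metis zero_le_power2)
  then have "(norm c)\<^sup>2 \<le> (norm x * norm y)\<^sup>2"
    using t by (simp add: zero_le_mult_iff t_def power_mult_distrib mult.commute)
  then show ?thesis unfolding c_def by (rule power2_le_imp_le) simp
qed

lemma norm_scaleC_sum_le: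
  "norm (\<Sum>b<n. scaleC (c b) (u b :: 'h::complex_hilbert)) \<le> l2n n c * l2n n u"
proof -
  have "norm (\<Sum>b<n. scaleC (c b) (u b)) \<le> (\<Sum>b<n. \<bar>norm (c b)\<bar> * \<bar>norm (u b)\<bar>)"
    by (rule order.trans[OF norm_sum]) (simp add: norm_scaleC)
  also have "\<dots> \<le> l2n n c * l2n n u" by (rule L2_set_mult_ineq)
  finally show ?thesis .
qed

section \<open>Operator balls\<close>

text \<open>The bound \<open>\<parallel>Q(X)\<parallel> \<le> \<rho>\<close> as an inequality for all vectors, which avoids the supremum in
  \<open>pencil_norm\<close>. Most of the argument uses the closed ball \<open>\<rho> = 1\<close>.\<close>

definition pencil_bound :: "('d::finite \<Rightarrow> 'h::complex_hilbert \<Rightarrow> 'h) \<Rightarrow> nat \<Rightarrow> ('d \<Rightarrow> complex mat) \<Rightarrow> real \<Rightarrow> bool" where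
  "pencil_bound Q n X \<rho> \<longleftrightarrow> (\<forall>j. X j \<in> carrier_mat n n) \<and> (\<forall>v. l2n n (pencil Q (n, X) v) \<le> \<rho> * l2n n v)"

lemma pencil_bound_less_one_imp_ball:
  fixes Q :: "'d::finite \<Rightarrow> 'b::complex_hilbert \<Rightarrow> 'b"
  assumes n: "n \<ge> 1" and X: "pencil_bound Q n X \<rho>" and \<rho>: "0 \<le> \<rho>" "\<rho> < 1"
  shows "(n, X) \<in> nc_ball Q"
proof -
  have "pencil_norm Q (n, X) \<le> \<rho>"
    unfolding pencil_norm_def
  proof (rule cSUP_least)
    have "(\<lambda>_. 0 :: 'b) \<in> {v. l2n (fst (n, X)) v \<le> 1}" by simp
    then show "{v :: nat \<Rightarrow> 'b. l2n (fst (n, X)) v \<le> 1} \<noteq> {}" by (metis empty_iff)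
    fix v :: "nat \<Rightarrow> 'b" assume "v \<in> {v. l2n (fst (n, X)) v \<le> 1}"
    then have v: "l2n n v \<le> 1" by simp
    have "l2n n (pencil Q (n, X) v) \<le> \<rho> * l2n n v" using X by (simp add: pencil_bound_def del: pencil.simps)
    also have "\<dots> \<le> \<rho>" using v \<rho> by (simp add: mult_left_le)
    finally show "l2n (fst (n, X)) (pencil Q (n, X) v) \<le> \<rho>" by simp
  qed
  then show ?thesis using X n \<rho> by (auto simp: nc_ball_def nc_universe_def pencil_bound_def)
qed

lemma nc_ball_imp_pencil_bound:
  fixes Q :: "'d::finite \<Rightarrow> 'b::complex_hilbert \<Rightarrow> 'b"
  assumes bdd: "\<forall>j. bounded_clinear_op (Q j)" and X: "(n, X) \<in> nc_ball Q"
  shows "pencil_bound Q n X 1"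
proof -
  have lin: "bounded_linear (Q j)" for j using bdd by (simp add: bounded_clinear_op_def)
  have "\<forall>j. \<exists>K. \<forall>x. norm (Q j x) \<le> norm x * K"
    using bounded_linear.bounded[OF lin] by blast
  then obtain K where K: "norm (Q j x) \<le> norm x * K j" for j x by metis
  have K0: "norm (Q j x) \<le> \<bar>K j\<bar>" if "norm x \<le> 1" for j x
  proof -
    have "norm (Q j x) \<le> norm x * \<bar>K j\<bar>" by (rule order.trans[OF K]) (simp add: mult_left_mono)
    also have "\<dots> \<le> \<bar>K j\<bar>" using mult_right_mono[OF that, of "\<bar>K j\<bar>"] by simp
    finally show ?thesis .
  qed
  have bd: "bdd_above ((\<lambda>v. l2n n (pencil Q (n, X) v)) ` {v. l2n n v \<le> 1})"
  proof (rule bdd_aboveI2)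
    fix v :: "nat \<Rightarrow> 'b" assume "v \<in> {v. l2n n v \<le> 1}"
    then have v: "norm (v b) \<le> 1" if "b < n" for b using norm_le_l2n[OF that, of v] by auto
    have "l2n n (pencil Q (n, X) v) \<le> (\<Sum>i<n. norm (pencil Q (n, X) v i))"
      by (rule L2_set_le_sum) auto
    also have "\<dots> \<le> (\<Sum>i<n. \<Sum>j\<in>UNIV. \<Sum>b<n. norm (X j $$ (i, b)) * \<bar>K j\<bar>)"
      unfolding pencil.simps
      by (intro sum_mono order.trans[OF norm_sum]) (auto simp: norm_scaleC v intro!: mult_left_mono K0)
    finally show "l2n n (pencil Q (n, X) v) \<le> (\<Sum>i<n. \<Sum>j\<in>UNIV. \<Sum>b<n. norm (X j $$ (i, b)) * \<bar>K j\<bar>)" .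
  qed
  have "l2n n (pencil Q (n, X) v) \<le> l2n n v" for v
  proof (cases "l2n n v = 0")
    case True
    then have "v b = 0" if "b < n" for b using that by (simp add: l2n_eq_0)
    then have "pencil Q (n, X) v i = 0" for i
      by (auto simp: linear_0[OF bounded_linear.linear[OF lin]] intro!: sum.neutral)
    then show ?thesis using True by (simp del: pencil.simps)
  next
    case False
    define c where "c = l2n n v"
    have c: "c > 0" using False l2n_nonneg[where f = v and n = n] unfolding c_def by linarith
    let ?w = "\<lambda>b. (1 / c) *\<^sub>R v b"
    have w: "l2n n ?w = 1" using c unfolding l2n_scaleR by (simp add: c_def)
    have "pencil Q (n, X) ?w i = (1 / c) *\<^sub>R pencil Q (n, X) v i" for i
      by (simp only: pencil.simps scaleR_sum_right linear_scale[OF bounded_linear.linear[OF lin]] scaleC_scaleR)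
    then have "l2n n (pencil Q (n, X) ?w) = l2n n (\<lambda>i. (1 / c) *\<^sub>R pencil Q (n, X) v i)"
      by presburger
    also have "\<dots> = l2n n (pencil Q (n, X) v) / c"
      unfolding l2n_scaleR using c by (simp del: pencil.simps)
    finally have "l2n n (pencil Q (n, X) ?w) = l2n n (pencil Q (n, X) v) / c" .
    moreover have "l2n n (pencil Q (n, X) ?w) \<le> pencil_norm Q (n, X)"
      unfolding pencil_norm_def fst_conv by (rule cSUP_upper[OF _ bd]) (use w in simp)
    moreover have "pencil_norm Q (n, X) < 1" using X by (simp add: nc_ball_def)
    ultimately have "l2n n (pencil Q (n, X) v) / c < 1" by linarith
    then show ?thesis using c by (simp add: c_def[symmetric] divide_less_eq_1 del: pencil.simps)
  qed
  then show ?thesis using X by (simp add: pencil_bound_def nc_ball_def nc_universe_def del: pencil.simps)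
qed

lemma pencil_bound_scale:
  assumes X: "pencil_bound Q n X \<rho>"
  shows "pencil_bound Q n (\<lambda>j. c \<cdot>\<^sub>m X j) (norm c * \<rho>)"
proof -
  have car: "X j \<in> carrier_mat n n" for j using X by (simp add: pencil_bound_def)
  have "l2n n (pencil Q (n, \<lambda>j. c \<cdot>\<^sub>m X j) v) \<le> norm c * \<rho> * l2n n v" for v
  proof -
    have "pencil Q (n, \<lambda>j. c \<cdot>\<^sub>m X j) v i = scaleC c (pencil Q (n, X) v i)" if "i < n" for i
    proof -
      have "(c \<cdot>\<^sub>m X j) $$ (i, b) = c * X j $$ (i, b)" if "b < n" for j b
        using that \<open>i < n\<close> car[of j] by auto
      then show ?thesis by (simp add: scaleC_sum scaleC_scaleC)
    qed
    then have "l2n n (pencil Q (n, \<lambda>j. c \<cdot>\<^sub>m X j) v) = l2n n (\<lambda>i. scaleC c (pencil Q (n, X) v i))"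
      by (intro l2n_cong)
    also have "\<dots> = norm c * l2n n (pencil Q (n, X) v)"
      by (simp add: norm_scaleC L2_set_right_distrib del: pencil.simps)
    also have "\<dots> \<le> norm c * (\<rho> * l2n n v)"
      using X by (intro mult_left_mono) (auto simp: pencil_bound_def simp del: pencil.simps)
    finally show ?thesis by (simp add: mult.assoc)
  qed
  then show ?thesis using car by (simp add: pencil_bound_def del: pencil.simps)
qed

text \<open>The tuple whose only nonzero coordinate is \<open>d\<close> times the identity, in place \<open>j\<close>.\<close>

abbreviation coord :: "complex \<Rightarrow> nat \<Rightarrow> 'd \<Rightarrow> 'd \<Rightarrow> complex mat" where
  "coord d n j \<equiv> \<lambda>l. if l = j then d \<cdot>\<^sub>m 1\<^sub>m n else 0\<^sub>m n n"

abbreviation dil :: "real \<Rightarrow> ('d \<Rightarrow> complex mat) \<Rightarrow> 'd \<Rightarrow> complex mat" where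
  "dil r X \<equiv> \<lambda>j. complex_of_real r \<cdot>\<^sub>m X j"

lemma pencil_bound_single:
  assumes K: "\<And>x. norm (Q j x) \<le> K * norm x" and d: "norm d * K \<le> 1" and lin: "\<forall>j. bounded_clinear_op (Q j)"
  shows "pencil_bound Q n (coord d n j) 1"
proof -
  have "l2n n (pencil Q (n, coord d n j) v) \<le> l2n n v" for v
  proof (rule L2_set_mono)
    fix i assume i: "i \<in> {..<n}"
    have "pencil Q (n, coord d n j) v i =
        (\<Sum>l\<in>UNIV. if l = j then (\<Sum>b<n. if b = i then scaleC d (Q j (v i)) else 0) else 0)"
      unfolding pencil.simps
    proof (rule sum.cong[OF refl])
      fix l
      have "(\<Sum>b<n. scaleC ((d \<cdot>\<^sub>m 1\<^sub>m n) $$ (i, b)) (Q j (v b))) = (\<Sum>b<n. if b = i then scaleC d (Q j (v i)) else 0)"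
        by (rule sum.cong[OF refl]) (use i in auto)
      then show "(\<Sum>b<n. scaleC ((if l = j then d \<cdot>\<^sub>m 1\<^sub>m n else 0\<^sub>m n n) $$ (i, b)) (Q l (v b))) =
          (if l = j then (\<Sum>b<n. if b = i then scaleC d (Q j (v i)) else 0) else 0)"
        using i by auto
    qed
    also have "\<dots> = scaleC d (Q j (v i))" using i by simp
    finally have "norm (pencil Q (n, coord d n j) v i) = norm d * norm (Q j (v i))"
      by (simp add: norm_scaleC)
    also have "\<dots> \<le> norm d * (K * norm (v i))" by (intro mult_left_mono K) auto
    also have "\<dots> \<le> 1 * norm (v i)" unfolding mult.assoc[symmetric] by (intro mult_right_mono d) auto
    finally show "norm (pencil Q (n, coord d n j) v i) \<le> norm (v i)" by simp
  qed simp
  then show ?thesis by (simp add: pencil_bound_def del: pencil.simps)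
qed

text \<open>The matrix \<open>\<xi> \<eta>\<^sup>* M\<close>.\<close>

definition rank_one_compress :: "nat \<Rightarrow> (nat \<Rightarrow> complex) \<Rightarrow> (nat \<Rightarrow> complex) \<Rightarrow> complex mat \<Rightarrow> complex mat" where
  "rank_one_compress n \<xi> \<eta> M = mat n n (\<lambda>(a, b). \<xi> a * (\<Sum>c<n. cnj (\<eta> c) * M $$ (c, b)))"

lemma pencil_bound_rank_one_compress:
  assumes X: "pencil_bound Q n X 1" and u: "l2n n \<xi> \<le> 1" "l2n n \<eta> \<le> 1"
  shows "pencil_bound Q n (\<lambda>j. rank_one_compress n \<xi> \<eta> (X j)) 1"
proof -
  let ?Y = "\<lambda>j. rank_one_compress n \<xi> \<eta> (X j)"
  have "l2n n (pencil Q (n, ?Y) v) \<le> l2n n v" for v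
  proof -
    define s where "s = (\<Sum>c<n. scaleC (cnj (\<eta> c)) (pencil Q (n, X) v c))"
    have "pencil Q (n, ?Y) v a = scaleC (\<xi> a) s" if a: "a < n" for a
    proof -
      have "pencil Q (n, ?Y) v a = (\<Sum>j\<in>UNIV. \<Sum>b<n. \<Sum>c<n. scaleC (\<xi> a) (scaleC (cnj (\<eta> c)) (scaleC (X j $$ (c, b)) (Q j (v b)))))"
        using a by (simp add: rank_one_compress_def scaleC_scaleC sum_distrib_left scaleC_sum_left mult.assoc)
      also have "\<dots> = (\<Sum>j\<in>UNIV. \<Sum>c<n. \<Sum>b<n. scaleC (\<xi> a) (scaleC (cnj (\<eta> c)) (scaleC (X j $$ (c, b)) (Q j (v b)))))"
        by (rule sum.cong[OF refl], rule sum.swap)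
      also have "\<dots> = (\<Sum>c<n. \<Sum>j\<in>UNIV. \<Sum>b<n. scaleC (\<xi> a) (scaleC (cnj (\<eta> c)) (scaleC (X j $$ (c, b)) (Q j (v b)))))"
        by (rule sum.swap)
      finally show ?thesis by (simp add: s_def scaleC_sum)
    qed
    then have "l2n n (pencil Q (n, ?Y) v) = l2n n (\<lambda>a. scaleC (\<xi> a) s)" by (intro l2n_cong)
    also have "\<dots> = l2n n \<xi> * norm s" by (simp add: norm_scaleC L2_set_left_distrib)
    also have "\<dots> \<le> norm s" using u(1) by (simp add: mult_left_le_one_le l2n_nonneg)
    also have "\<dots> \<le> l2n n (\<lambda>c. cnj (\<eta> c)) * l2n n (pencil Q (n, X) v)"
      unfolding s_def by (rule norm_scaleC_sum_le)
    also have "\<dots> \<le> l2n n (pencil Q (n, X) v)" using u(2) by (simp add: mult_left_le_one_le l2n_nonneg del: pencil.simps)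
    also have "\<dots> \<le> l2n n v" using X by (simp add: pencil_bound_def del: pencil.simps)
    finally show ?thesis .
  qed
  then show ?thesis by (simp add: pencil_bound_def rank_one_compress_def del: pencil.simps)
qed

section \<open>The cyclic construction\<close>

text \<open>The operator \<open>A(X) = \<Sum> A\<^sub>j \<otimes> X\<^sub>j\<close> on \<open>\<complex>\<^sup>m \<otimes> \<complex>\<^sup>n\<close>. Vectors are functions of the two indices; the result
  vanishes outside the index range, so that identities between supported vectors are identities of
  functions.\<close>

definition act :: "nat \<Rightarrow> nat \<Rightarrow> ('d::finite \<Rightarrow> complex mat) \<Rightarrow> ('d \<Rightarrow> complex mat) \<Rightarrow>
    (nat \<Rightarrow> nat \<Rightarrow> complex) \<Rightarrow> nat \<Rightarrow> nat \<Rightarrow> complex" where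
  "act m n A X y p a = (if p < m \<and> a < n then
     (\<Sum>q<m. \<Sum>b<n. (\<Sum>j\<in>UNIV. A j $$ (p, q) * X j $$ (a, b)) * y q b) else 0)"

definition supported :: "nat \<Rightarrow> nat \<Rightarrow> (nat \<Rightarrow> nat \<Rightarrow> complex) \<Rightarrow> bool" where
  "supported m n y \<longleftrightarrow> (\<forall>p a. \<not> (p < m \<and> a < n) \<longrightarrow> y p a = 0)"

lemma supported_act[simp]: "supported m n (act m n A X y)"
  by (auto simp: supported_def act_def)

lemma act_add: "act m n A X (\<lambda>p a. y p a + z p a) = (\<lambda>p a. act m n A X y p a + act m n A X z p a)"
  by (intro ext) (simp add: act_def distrib_left sum.distrib)

lemma act_mult: "act m n A X (\<lambda>p a. c * y p a) = (\<lambda>p a. c * act m n A X y p a)"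
  by (intro ext) (simp add: act_def sum_distrib_left mult.left_commute)

lemma act_scale_point:
  assumes "\<forall>j. X j \<in> carrier_mat n n"
  shows "act m n A (\<lambda>j. c \<cdot>\<^sub>m X j) y = (\<lambda>p a. c * act m n A X y p a)"
proof -
  have "(c \<cdot>\<^sub>m X j) $$ (a, b) = c * X j $$ (a, b)" if "a < n" "b < n" for j a b
    using assms[rule_format, of j] that by auto
  then show ?thesis
    by (intro ext) (simp add: act_def sum_distrib_left sum_distrib_right mult_ac)
qed

definition no_fixed_vectors :: "('d::finite \<Rightarrow> 'h::complex_hilbert \<Rightarrow> 'h) \<Rightarrow> nat \<Rightarrow> ('d \<Rightarrow> complex mat) \<Rightarrow> bool" where
  "no_fixed_vectors Q m A \<longleftrightarrow> (\<forall>n X y. (n, X) \<in> nc_ball Q \<longrightarrow> supported m n y \<longrightarrow> act m n A X y = y \<longrightarrow> y = (\<lambda>p a. 0))"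

lemma no_large_eigenvalue:
  assumes nf: "no_fixed_vectors Q m A" and X: "pencil_bound Q n X 1" and n: "n \<ge> 1"
    and lam: "norm lam > 1" and y: "supported m n y" "act m n A X y = (\<lambda>p a. lam * y p a)"
  shows "y = (\<lambda>p a. 0)"
proof -
  have lam0: "lam \<noteq> 0" using lam by auto
  have "pencil_bound Q n (\<lambda>j. (1 / lam) \<cdot>\<^sub>m X j) (norm (1 / lam) * 1)"
    by (rule pencil_bound_scale[OF X])
  then have "(n, \<lambda>j. (1 / lam) \<cdot>\<^sub>m X j) \<in> nc_ball Q"
    by (rule pencil_bound_less_one_imp_ball[OF n]) (use lam in \<open>auto simp: norm_divide divide_less_eq_1\<close>)
  moreover have "act m n A (\<lambda>j. (1 / lam) \<cdot>\<^sub>m X j) y = y"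
    using X lam0 by (subst act_scale_point) (auto simp: pencil_bound_def y(2))
  ultimately show ?thesis using nf y(1) unfolding no_fixed_vectors_def by blast
qed

lemma sum_bij_pred:
  assumes "L \<ge> (1::nat)"
  shows "(\<Sum>t<L. g (if t = 0 then L - 1 else t - 1)) = (\<Sum>t<L. (g t :: 'a::comm_monoid_add))"
  by (rule sum.reindex_bij_witness[where i = "\<lambda>t. if t = L - 1 then 0 else t + 1"
        and j = "\<lambda>t. if t = 0 then L - 1 else t - 1"]) (use assms in \<open>auto split: if_splits\<close>)

text \<open>Let \<open>Y\<close> be the cyclic block matrix that carries the points of the list on its off-diagonal. It lies
  in the closed ball again. If \<open>z\<close> is an eigenvector of the product for \<open>\<mu> = \<lambda>\<^sup>L\<close>, then the
  partial products applied to \<open>z\<close>, weighted by powers of \<open>\<lambda>\<close>, form an eigenvector of \<open>A(Y)\<close> for \<open>\<lambda>\<close>.\<close>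

lemma product_no_large_eigenvalue:
  assumes nf: "no_fixed_vectors Q m A" and Xs: "\<And>X. X \<in> set Xs \<Longrightarrow> pencil_bound Q n X 1"
    and n: "n \<ge> 1" and ne: "Xs \<noteq> []" and mu: "norm mu > 1" and z: "supported m n z"
    and eig: "fold (act m n A) Xs z = (\<lambda>p a. mu * z p a)"
  shows "z = (\<lambda>p a. 0)"
proof -
  define L where "L = length Xs"
  have L: "L \<ge> 1" using ne by (cases Xs) (auto simp: L_def)
  define lam where "lam = (complex_of_real (root L (norm mu))) * cis (Arg mu / L)"
  have lamL: "lam ^ L = mu"
    using L rcis_cmod_Arg[of mu] by (simp add: lam_def power_mult_distrib DeMoivre rcis_def real_root_pow_pos2 flip: of_real_power)
  have "norm lam ^ L > 1" using mu by (simp add: lamL flip: norm_power)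
  then have lam: "norm lam > 1" using power_le_one[of "norm lam" L] by (meson norm_ge_zero not_le)
  then have lam0: "lam \<noteq> 0" by auto
  \<comment> \<open>Block row \<open>t\<close> of \<open>Y\<close> has its only nonzero block in block column \<open>\<sigma> t\<close>, the cyclic predecessor of \<open>t\<close>.\<close>
  define \<sigma> where "\<sigma> t = (if t = 0 then L - 1 else t - 1)" for t
  have \<sigma>L: "\<sigma> t < L" if "t < L" for t using that by (auto simp: \<sigma>_def)
  define Y where "Y j = mat (L * n) (L * n) (\<lambda>(r, c). if c div n = \<sigma> (r div n) then (Xs ! (c div n)) j $$ (r mod n, c mod n) else 0)" for j
  define f where "f s = fold (act m n A) (take s Xs) z" for s
  define y where "y p r = (if p < m \<and> r < L * n then f (r div n) p (r mod n) / lam ^ (r div n) else 0)" for p r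
  have Xsb: "pencil_bound Q n (Xs ! s) 1" if "s < L" for s using Xs that by (simp add: L_def)
  have fSuc: "f (Suc s) = act m n A (Xs ! s) (f s)" if "s < L" for s
    using that by (simp add: f_def L_def take_Suc_conv_app_nth)
  have "pencil_bound Q (L * n) Y 1"
  proof -
    have "l2n (L * n) (pencil Q (L * n, Y) v) \<le> l2n (L * n) v" for v
    proof -
      let ?v = "\<lambda>s b. v (s * n + b)"
      have p: "pencil Q (L * n, Y) v r = pencil Q (n, Xs ! \<sigma> (r div n)) (?v (\<sigma> (r div n))) (r mod n)"
        if r: "r < L * n" for r
      proof -
        note rd = div_mod_less[OF r]
        have "pencil Q (L * n, Y) v r = (\<Sum>j\<in>UNIV. \<Sum>c<L * n. 
           (\<lambda>s b. if s = \<sigma> (r div n) then scaleC ((Xs ! s) j $$ (r mod n, b)) (Q j (v (s * n + b))) else 0) (c div n) (c mod n))"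
          unfolding pencil.simps
        proof (intro sum.cong refl)
          fix j c assume "c \<in> {..<L * n}"
          then show "scaleC (Y j $$ (r, c)) (Q j (v c)) = (\<lambda>s b. if s = \<sigma> (r div n) then scaleC ((Xs ! s) j $$ (r mod n, b)) (Q j (v (s * n + b))) else 0) (c div n) (c mod n)"
            using r div_mult_mod_eq[of c n] by (cases "c div n = \<sigma> (r div n)") (simp_all add: Y_def)
        qed
        also have "\<dots> = (\<Sum>j\<in>UNIV. \<Sum>s<L. \<Sum>b<n. if s = \<sigma> (r div n) then scaleC ((Xs ! s) j $$ (r mod n, b)) (Q j (v (s * n + b))) else 0)"
          by (rule sum.cong[OF refl], rule sum_div_mod)
        also have "\<dots> = (\<Sum>j\<in>UNIV. \<Sum>s<L. if s = \<sigma> (r div n) then (\<Sum>b<n. scaleC ((Xs ! s) j $$ (r mod n, b)) (Q j (v (s * n + b)))) else 0)"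
          by (intro sum.cong refl) auto
        also have "\<dots> = pencil Q (n, Xs ! \<sigma> (r div n)) (?v (\<sigma> (r div n))) (r mod n)"
          using \<sigma>L[OF rd(1)] by simp
        finally show ?thesis .
      qed
      have "(\<Sum>r<L * n. (norm (pencil Q (L * n, Y) v r))\<^sup>2) =
         (\<Sum>r<L * n. (\<lambda>t a. (norm (pencil Q (n, Xs ! \<sigma> t) (?v (\<sigma> t)) a))\<^sup>2) (r div n) (r mod n))"
        by (intro sum.cong refl) (simp add: p del: pencil.simps)
      also have "\<dots> = (\<Sum>t<L. \<Sum>a<n. (norm (pencil Q (n, Xs ! \<sigma> t) (?v (\<sigma> t)) a))\<^sup>2)"
        by (rule sum_div_mod)
      also have "\<dots> \<le> (\<Sum>t<L. \<Sum>a<n. (norm (?v (\<sigma> t) a))\<^sup>2)"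
      proof (rule sum_mono)
        fix t assume "t \<in> {..<L}"
        then have "l2n n (pencil Q (n, Xs ! \<sigma> t) (?v (\<sigma> t))) \<le> l2n n (?v (\<sigma> t))"
          using Xsb[OF \<sigma>L[of t]] by (simp add: pencil_bound_def del: pencil.simps)
        then show "(\<Sum>a<n. (norm (pencil Q (n, Xs ! \<sigma> t) (?v (\<sigma> t)) a))\<^sup>2) \<le> (\<Sum>a<n. (norm (?v (\<sigma> t) a))\<^sup>2)"
          unfolding l2n_le_iff .
      qed
      also have "\<dots> = (\<Sum>t<L. \<Sum>a<n. (norm (?v t a))\<^sup>2)"
        unfolding \<sigma>_def by (rule sum_bij_pred[OF L, of "\<lambda>t. \<Sum>a<n. (norm (?v t a))\<^sup>2"])
      also have "\<dots> = (\<Sum>r<L * n. (norm (?v (r div n) (r mod n)))\<^sup>2)"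
        by (rule sum_div_mod[symmetric])
      finally show ?thesis unfolding l2n_le_iff by simp
    qed
    then show ?thesis by (simp add: pencil_bound_def Y_def del: pencil.simps)
  qed
  moreover have "L * n \<ge> 1" using L n by simp
  moreover have "supported m (L * n) y" by (auto simp: supported_def y_def)
  moreover have "act m (L * n) A Y y = (\<lambda>p r. lam * y p r)"
  proof (intro ext)
    fix p r
    show "act m (L * n) A Y y p r = lam * y p r"
    proof (cases "p < m \<and> r < L * n")
      case True
      then have pr: "p < m" "r < L * n" by auto
      note rd = div_mod_less[OF pr(2)]
      define s where "s = \<sigma> (r div n)"
      have s: "s < L" using \<sigma>L[OF rd(1)] by (simp add: s_def)
      have "act m (L * n) A Y y p r = (\<Sum>q<m. \<Sum>c<L * n. 
         (\<lambda>t b. if t = s then (\<Sum>j\<in>UNIV. A j $$ (p, q) * (Xs ! s) j $$ (r mod n, b)) * (f s q b / lam ^ s) else 0) (c div n) (c mod n))"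
        using pr unfolding act_def
        by (auto simp: Y_def y_def s_def intro!: sum.cong)
      also have "\<dots> = (\<Sum>q<m. \<Sum>t<L. \<Sum>b<n. if t = s then (\<Sum>j\<in>UNIV. A j $$ (p, q) * (Xs ! s) j $$ (r mod n, b)) * (f s q b / lam ^ s) else 0)"
        by (rule sum.cong[OF refl], rule sum_div_mod)
      also have "\<dots> = (\<Sum>q<m. \<Sum>t<L. if t = s then (\<Sum>b<n. (\<Sum>j\<in>UNIV. A j $$ (p, q) * (Xs ! s) j $$ (r mod n, b)) * (f s q b / lam ^ s)) else 0)"
        by (intro sum.cong refl) auto
      also have "\<dots> = act m n A (Xs ! s) (f s) p (r mod n) / lam ^ s"
        using s pr rd by (simp add: act_def sum_divide_distrib)
      also have "\<dots> = f (Suc s) p (r mod n) / lam ^ s" using fSuc[OF s] by simp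
      also have "\<dots> = lam * y p r"
      proof (cases "r div n = 0")
        case r0: True
        then have "Suc s = L" using L by (simp add: s_def \<sigma>_def)
        then have "f (Suc s) p (r mod n) = mu * z p (r mod n)"
          using eig by (simp add: f_def L_def)
        also have "mu = lam * lam ^ s" using lamL \<open>Suc s = L\<close> by auto
        finally show ?thesis using True r0 lam0 by (simp add: y_def f_def)
      next
        case False
        then have "Suc s = r div n" by (simp add: s_def \<sigma>_def)
        then show ?thesis using True lam0 by (simp add: y_def flip: \<open>Suc s = r div n\<close>)
      qed
      finally show ?thesis .
    qed (auto simp: act_def y_def)
  qed
  ultimately have y0: "y = (\<lambda>p a. 0)" by (intro no_large_eigenvalue[OF nf _ _ lam])
  show ?thesis
  proof (intro ext)
    fix p a
    show "z p a = 0"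
    proof (cases "p < m \<and> a < n")
      case True
      have "a < L * n" using True L by (metis less_le_trans mult_le_mono1 nat_mult_1)
      then have "z p a = y p a" using True by (simp add: y_def f_def)
      then show ?thesis by (simp add: y0)
    qed (use z in \<open>auto simp: supported_def\<close>)
  qed
qed

section \<open>Uniform power boundedness\<close>

text \<open>The elementary tensor of \<open>x \<in> \<complex>\<^sup>m\<close> and \<open>\<xi> \<in> \<complex>\<^sup>n\<close>.\<close>

definition ten :: "nat \<Rightarrow> nat \<Rightarrow> complex vec \<Rightarrow> (nat \<Rightarrow> complex) \<Rightarrow> nat \<Rightarrow> nat \<Rightarrow> complex" where
  "ten m n x \<xi> p a = (if p < m \<and> a < n then x $ p * \<xi> a else 0)"

lemma supported_ten: "supported m n (ten m n x \<xi>)"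
  by (auto simp: supported_def ten_def)

text \<open>The \<open>l\<^sup>1\<close> sum of the norms of the blocks. It is equivalent to the Hilbert space norm with constants
  that depend on \<open>m\<close> only and not on \<open>n\<close>, and it makes blockwise estimates additive.\<close>

definition mixed_norm :: "nat \<Rightarrow> nat \<Rightarrow> (nat \<Rightarrow> nat \<Rightarrow> complex) \<Rightarrow> real" where
  "mixed_norm m n y = (\<Sum>p<m. l2n n (y p))"

lemma mixed_norm_nonneg: "0 \<le> mixed_norm m n y"
  by (simp add: mixed_norm_def sum_nonneg l2n_nonneg)

lemma mixed_norm_triangle: "mixed_norm m n (\<lambda>p a. y p a + z p a) \<le> mixed_norm m n y + mixed_norm m n z"
  unfolding mixed_norm_def sum.distrib[symmetric] by (intro sum_mono l2n_triangle)

lemma mixed_norm_mult: "mixed_norm m n (\<lambda>p a. c * y p a) = norm c * mixed_norm m n y"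
  by (simp add: mixed_norm_def l2n_mult sum_distrib_left)

lemma act_zero: "act m n A X (\<lambda>p a. 0) = (\<lambda>p a. 0)"
  using act_mult[of m n A X 0 "\<lambda>p a. 0"] by simp

lemma act_power_sum:
  "(act m n A X ^^ l) (\<lambda>p a. \<Sum>s\<in>S. c s * f s p a) = (\<lambda>p a. \<Sum>s\<in>S. c s * (act m n A X ^^ l) (f s) p a)"
proof (induction l)
  case (Suc l)
  have "act m n A X (\<lambda>p a. \<Sum>s\<in>S. c s * g s p a) = (\<lambda>p a. \<Sum>s\<in>S. c s * act m n A X (g s) p a)" for g
    by (induction S rule: infinite_finite_induct) (simp_all add: act_zero act_add act_mult)
  then show ?case by (simp add: Suc)
qed simp

lemma ten_decompose:
  "ten m n x \<xi> = (\<lambda>p a. \<Sum>q<m. x $ q * ten m n (unit_vec m q) \<xi> p a)"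
proof (intro ext)
  fix p a
  have "(\<Sum>q<m. x $ q * ten m n (unit_vec m q) \<xi> p a) = (\<Sum>q<m. if q = p then ten m n x \<xi> p a else 0)"
    by (intro sum.cong refl) (auto simp: ten_def)
  then show "ten m n x \<xi> p a = (\<Sum>q<m. x $ q * ten m n (unit_vec m q) \<xi> p a)"
    by (simp add: ten_def)
qed

lemma act_ten_single:
  assumes A: "\<forall>j. A j \<in> carrier_mat m m" and x: "x \<in> carrier_vec m"
  shows "act m n A (coord d n j) (ten m n x \<xi>) = ten m n (d \<cdot>\<^sub>v (A j *\<^sub>v x)) \<xi>"
proof (intro ext)
  fix p a
  show "act m n A (coord d n j) (ten m n x \<xi>) p a = ten m n (d \<cdot>\<^sub>v (A j *\<^sub>v x)) \<xi> p a"
  proof (cases "p < m \<and> a < n")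
    case True
    have s: "(\<Sum>l\<in>UNIV. A l $$ (p, q) * (if l = j then d \<cdot>\<^sub>m 1\<^sub>m n else 0\<^sub>m n n) $$ (a, b)) = (if b = a then A j $$ (p, q) * d else 0)"
      if "b < n" for q b
    proof -
      have "(\<Sum>l\<in>UNIV. A l $$ (p, q) * (if l = j then d \<cdot>\<^sub>m 1\<^sub>m n else 0\<^sub>m n n) $$ (a, b)) =
          (\<Sum>l\<in>UNIV. if l = j then (if b = a then A j $$ (p, q) * d else 0) else 0)"
        by (intro sum.cong refl) (use True that in auto)
      then show ?thesis by simp
    qed
    have "act m n A (coord d n j) (ten m n x \<xi>) p a =
        (\<Sum>q<m. \<Sum>b<n. if b = a then A j $$ (p, q) * d * (x $ q * \<xi> a) else 0)"
    proof -
      have "act m n A (coord d n j) (ten m n x \<xi>) p a =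
          (\<Sum>q<m. \<Sum>b<n. (\<Sum>l\<in>UNIV. A l $$ (p, q) * (if l = j then d \<cdot>\<^sub>m 1\<^sub>m n else 0\<^sub>m n n) $$ (a, b)) * ten m n x \<xi> q b)"
        using True by (simp add: act_def)
      also have "\<dots> = (\<Sum>q<m. \<Sum>b<n. if b = a then A j $$ (p, q) * d * (x $ q * \<xi> a) else 0)"
      proof (intro sum.cong refl)
        fix q b assume "q \<in> {..<m}" "b \<in> {..<n}"
        then show "(\<Sum>l\<in>UNIV. A l $$ (p, q) * (if l = j then d \<cdot>\<^sub>m 1\<^sub>m n else 0\<^sub>m n n) $$ (a, b)) * ten m n x \<xi> q b =
            (if b = a then A j $$ (p, q) * d * (x $ q * \<xi> a) else 0)"
          by (subst s) (auto simp: ten_def)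
      qed
      finally show ?thesis .
    qed
    also have "\<dots> = d * (\<Sum>q<m. A j $$ (p, q) * x $ q) * \<xi> a"
      using True by (simp add: sum_distrib_left sum_distrib_right mult_ac)
    also have "(\<Sum>q<m. A j $$ (p, q) * x $ q) = (A j *\<^sub>v x) $ p"
      using True A[rule_format, of j] x by (simp add: scalar_prod_def lessThan_atLeast0)
    also have "d * (A j *\<^sub>v x) $ p * \<xi> a = ten m n (d \<cdot>\<^sub>v (A j *\<^sub>v x)) \<xi> p a"
      using True A[rule_format, of j] by (simp add: ten_def)
    finally show ?thesis .
  qed (auto simp: act_def ten_def)
qed

lemma foldr_act_ten_word:
  assumes A: "\<forall>j. A j \<in> carrier_mat m m" and x: "x \<in> carrier_vec m"
  shows "foldr (\<lambda>j. act m n A (coord d n j)) w (ten m n x \<xi>) =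
    ten m n (d ^ length w \<cdot>\<^sub>v (word_eval m A (NCWord w) *\<^sub>v x)) \<xi>"
proof (induction w)
  case Nil
  then show ?case using x by (simp add: word_eval_Nil)
next
  case (Cons j w)
  note W = word_eval_carrier[OF A, of "NCWord w"]
  have Aj: "A j \<in> carrier_mat m m" using A by blast
  have "A j *\<^sub>v (d ^ length w \<cdot>\<^sub>v (word_eval m A (NCWord w) *\<^sub>v x)) = d ^ length w \<cdot>\<^sub>v (word_eval m A (NCWord (j # w)) *\<^sub>v x)"
    unfolding word_eval_Cons assoc_mult_mat_vec[OF Aj W x] using Aj W x by (intro mult_mat_vec) auto
  then show ?case using Cons W x by (simp add: act_ten_single[OF A] smult_smult_assoc)
qed

lemma act_rank_one_compress:
  "act m n A (\<lambda>j. rank_one_compress n \<xi> \<eta> (X j)) y =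
    ten m n (vec m (\<lambda>p. \<Sum>c<n. cnj (\<eta> c) * act m n A X y p c)) \<xi>"
proof (intro ext)
  fix p a
  show "act m n A (\<lambda>j. rank_one_compress n \<xi> \<eta> (X j)) y p a =
    ten m n (vec m (\<lambda>p. \<Sum>c<n. cnj (\<eta> c) * act m n A X y p c)) \<xi> p a"
  proof (cases "p < m \<and> a < n")
    case True
    have s: "(\<Sum>j\<in>UNIV. A j $$ (p, q) * rank_one_compress n \<xi> \<eta> (X j) $$ (a, b)) =
        \<xi> a * (\<Sum>c<n. cnj (\<eta> c) * (\<Sum>j\<in>UNIV. A j $$ (p, q) * X j $$ (c, b)))" if "b < n" for q b
    proof -
      have "(\<Sum>j\<in>UNIV. A j $$ (p, q) * rank_one_compress n \<xi> \<eta> (X j) $$ (a, b)) =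
          (\<Sum>j\<in>UNIV. \<Sum>c<n. \<xi> a * (cnj (\<eta> c) * (A j $$ (p, q) * X j $$ (c, b))))"
        using True that by (simp add: rank_one_compress_def sum_distrib_left mult_ac)
      also have "\<dots> = (\<Sum>c<n. \<Sum>j\<in>UNIV. \<xi> a * (cnj (\<eta> c) * (A j $$ (p, q) * X j $$ (c, b))))"
        by (rule sum.swap)
      finally show ?thesis by (simp add: sum_distrib_left)
    qed
    let ?S = "\<lambda>q b c. \<Sum>j\<in>UNIV. A j $$ (p, q) * X j $$ (c, b)"
    have "act m n A (\<lambda>j. rank_one_compress n \<xi> \<eta> (X j)) y p a =
        (\<Sum>q<m. \<Sum>b<n. \<xi> a * (\<Sum>c<n. cnj (\<eta> c) * ?S q b c) * y q b)"
      unfolding act_def using True by (simp add: s)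
    also have "\<dots> = (\<Sum>q<m. \<Sum>b<n. \<Sum>c<n. \<xi> a * (cnj (\<eta> c) * (?S q b c * y q b)))"
      by (simp only: sum_distrib_left sum_distrib_right mult.assoc)
    also have "\<dots> = (\<Sum>q<m. \<Sum>c<n. \<Sum>b<n. \<xi> a * (cnj (\<eta> c) * (?S q b c * y q b)))"
      by (rule sum.cong[OF refl], rule sum.swap)
    also have "\<dots> = (\<Sum>c<n. \<Sum>q<m. \<Sum>b<n. \<xi> a * (cnj (\<eta> c) * (?S q b c * y q b)))"
      by (rule sum.swap)
    also have "\<dots> = (\<Sum>c<n. cnj (\<eta> c) * act m n A X y p c) * \<xi> a"
      using True by (simp add: act_def sum_distrib_left sum_distrib_right mult_ac)
    finally show ?thesis using True by (simp add: ten_def)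
  qed (auto simp: act_def ten_def)
qed

lemma fold_replicate_funpow: "fold f (replicate k x) = f x ^^ k"
  by (induction k) (auto simp: funpow_Suc_right simp del: funpow.simps(2))

text \<open>The \<open>m \<times> m\<close> matrix \<open>(1 \<otimes> \<eta>\<^sup>*) T (1 \<otimes> \<xi>)\<close>.\<close>

definition compression :: "nat \<Rightarrow> nat \<Rightarrow> ((nat \<Rightarrow> nat \<Rightarrow> complex) \<Rightarrow> nat \<Rightarrow> nat \<Rightarrow> complex) \<Rightarrow>
    (nat \<Rightarrow> complex) \<Rightarrow> (nat \<Rightarrow> complex) \<Rightarrow> complex mat" where
  "compression m n T \<xi> \<eta> = mat m m (\<lambda>(p, q). \<Sum>a<n. cnj (\<eta> a) * T (ten m n (unit_vec m q) \<xi>) p a)"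

lemma compression_mult_vec:
  assumes x: "x \<in> carrier_vec m"
  shows "compression m n (act m n A X ^^ l) \<xi> \<eta> *\<^sub>v x =
    vec m (\<lambda>p. \<Sum>a<n. cnj (\<eta> a) * (act m n A X ^^ l) (ten m n x \<xi>) p a)"
proof (rule eq_vecI)
  fix p assume "p < dim_vec (vec m (\<lambda>p. \<Sum>a<n. cnj (\<eta> a) * (act m n A X ^^ l) (ten m n x \<xi>) p a))"
  then have p: "p < m" by simp
  let ?T = "act m n A X ^^ l"
  have "(compression m n ?T \<xi> \<eta> *\<^sub>v x) $ p = (\<Sum>q<m. (\<Sum>a<n. cnj (\<eta> a) * ?T (ten m n (unit_vec m q) \<xi>) p a) * x $ q)"
    using p x by (simp add: compression_def scalar_prod_def lessThan_atLeast0)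
  also have "\<dots> = (\<Sum>q<m. \<Sum>a<n. cnj (\<eta> a) * (x $ q * ?T (ten m n (unit_vec m q) \<xi>) p a))"
    by (simp add: sum_distrib_left sum_distrib_right mult_ac)
  also have "\<dots> = (\<Sum>a<n. \<Sum>q<m. cnj (\<eta> a) * (x $ q * ?T (ten m n (unit_vec m q) \<xi>) p a))"
    by (rule sum.swap)
  also have "\<dots> = (\<Sum>a<n. cnj (\<eta> a) * ?T (ten m n x \<xi>) p a)"
    by (subst ten_decompose[of m n x]) (simp only: act_power_sum sum_distrib_left)
  finally show "(compression m n ?T \<xi> \<eta> *\<^sub>v x) $ p = vec m (\<lambda>p. \<Sum>a<n. cnj (\<eta> a) * ?T (ten m n x \<xi>) p a) $ p"
    using p by simp
qed (simp add: compression_def)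

text \<open>If \<open>x\<close> is an eigenvector of \<open>T\<^bsub>\<xi>\<eta>\<^esub> A\<^sup>w\<close>, then \<open>x \<otimes> \<xi>\<close> is an eigenvector of a product of
  operators \<open>A(X\<^sub>i)\<close> with all \<open>X\<^sub>i\<close> in the closed ball, for \<open>T = A(X)\<^bsup>l+1\<^esup>\<close>: first the letters of \<open>w\<close> as points with one
  coordinate \<open>d\<close>, then \<open>l\<close> times \<open>X\<close>, and finally the compressed point \<open>\<xi> \<eta>\<^sup>* X\<close>, which accounts for
  one more factor \<open>A(X)\<close>.\<close>

lemma compression_word_eigenvalue:
  fixes A :: "'d::finite \<Rightarrow> complex mat"
  assumes nf: "no_fixed_vectors Q m A" and A: "\<forall>j. A j \<in> carrier_mat m m"
    and bdd: "\<forall>j. bounded_clinear_op (Q j)" and K: "\<And>j x. norm (Q j x) \<le> K * norm x"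
    and d: "d > 0" "d * K \<le> 1"
    and X: "pencil_bound Q n X 1" and n: "n \<ge> 1"
    and u: "l2n n \<xi> \<le> 1" "l2n n \<eta> \<le> 1" and nz: "l2n n \<xi> \<noteq> 0"
    and ev: "eigenvalue (compression m n (act m n A X ^^ Suc l) \<xi> \<eta> * word_eval m A (NCWord w)) \<mu>"
  shows "norm \<mu> \<le> (1 / d) ^ length w"
proof (rule ccontr)
  assume "\<not> norm \<mu> \<le> (1 / d) ^ length w"
  then have big: "norm (complex_of_real d ^ length w * \<mu>) > 1"
    using d by (simp add: norm_mult norm_power power_one_over divide_simps mult.commute split: if_splits)
  let ?C = "compression m n (act m n A X ^^ Suc l) \<xi> \<eta>" and ?W = "word_eval m A (NCWord w)"
  have C: "?C \<in> carrier_mat m m" by (simp add: compression_def)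
  note W = word_eval_carrier[OF A, of "NCWord w"]
  obtain x where x: "x \<in> carrier_vec m" "x \<noteq> 0\<^sub>v m" "(?C * ?W) *\<^sub>v x = \<mu> \<cdot>\<^sub>v x"
    using ev C W by (auto simp: eigenvalue_def eigenvector_def simp del: assoc_mult_mat_vec)
  define D :: "'d \<Rightarrow> 'd \<Rightarrow> complex mat" where "D = coord (complex_of_real d) n"
  define R where "R = (\<lambda>j. rank_one_compress n \<xi> \<eta> (X j))"
  define Xs where "Xs = map D (rev w) @ replicate l X @ [R]"
  define x' where "x' = complex_of_real d ^ length w \<cdot>\<^sub>v (?W *\<^sub>v x)"
  have x': "x' \<in> carrier_vec m" using W x by (auto simp: x'_def)
  have "fold (act m n A) (map D (rev w)) (ten m n x \<xi>) = ten m n x' \<xi>"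
    using foldr_act_ten_word[OF A x(1), of n "complex_of_real d" w \<xi>]
    by (simp add: foldr_conv_fold fold_map comp_def D_def x'_def)
  then have "fold (act m n A) Xs (ten m n x \<xi>) = act m n A R ((act m n A X ^^ l) (ten m n x' \<xi>))"
    by (simp add: Xs_def fold_replicate_funpow)
  also have "\<dots> = ten m n (vec m (\<lambda>p. \<Sum>c<n. cnj (\<eta> c) * (act m n A X ^^ Suc l) (ten m n x' \<xi>) p c)) \<xi>"
    unfolding R_def act_rank_one_compress by simp
  also have "\<dots> = ten m n (?C *\<^sub>v x') \<xi>"
    by (simp only: compression_mult_vec[OF x'])
  also have "?C *\<^sub>v x' = complex_of_real d ^ length w \<cdot>\<^sub>v (\<mu> \<cdot>\<^sub>v x)"
    unfolding x'_def x(3)[symmetric] assoc_mult_mat_vec[OF C W x(1)]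
    using C W x(1) by (intro mult_mat_vec) auto
  also have "ten m n (complex_of_real d ^ length w \<cdot>\<^sub>v (\<mu> \<cdot>\<^sub>v x)) \<xi> =
      (\<lambda>p a. (complex_of_real d ^ length w * \<mu>) * ten m n x \<xi> p a)"
    using x(1) by (intro ext) (auto simp: ten_def)
  finally have eig: "fold (act m n A) Xs (ten m n x \<xi>) = (\<lambda>p a. (complex_of_real d ^ length w * \<mu>) * ten m n x \<xi> p a)" .
  have Db: "pencil_bound Q n (D j) 1" for j
    unfolding D_def by (rule pencil_bound_single[OF K _ bdd]) (use d in simp)
  have Rb: "pencil_bound Q n R 1"
    unfolding R_def by (rule pencil_bound_rank_one_compress[OF X u])
  have "ten m n x \<xi> = (\<lambda>p a. 0)"
    by (rule product_no_large_eigenvalue[OF nf _ n _ big supported_ten eig])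
      (use X Db Rb in \<open>auto simp: Xs_def\<close>)
  moreover obtain a where "a < n" "\<xi> a \<noteq> 0" using nz by (auto simp: l2n_eq_0)
  ultimately have "x $ p = 0" if "p < m" for p
    using that by (metis (no_types, lifting) mult_eq_0_iff ten_def)
  then have "x = 0\<^sub>v m" using x(1) by (intro eq_vecI) auto
  then show False using x(2) by simp
qed

lemma l2n_le_if_pairing_le:
  fixes u :: "nat \<Rightarrow> complex"
  assumes "\<And>\<eta>. l2n n \<eta> \<le> 1 \<Longrightarrow> norm (\<Sum>a<n. cnj (\<eta> a) * u a) \<le> c"
  shows "l2n n u \<le> c"
proof (cases "l2n n u = 0")
  case True
  then show ?thesis using assms[of "\<lambda>_. 0"] by simp
next
  case False
  then have pos: "l2n n u > 0" using l2n_nonneg[where f = u and n = n] by linarith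
  let ?e = "\<lambda>a. complex_of_real (1 / l2n n u) * u a"
  have "l2n n ?e \<le> 1" unfolding l2n_mult using pos by (simp add: norm_divide)
  then have "norm (\<Sum>a<n. cnj (?e a) * u a) \<le> c" by (rule assms)
  moreover have "(\<Sum>a<n. cnj (?e a) * u a) = complex_of_real ((1 / l2n n u) * (l2n n u)\<^sup>2)"
    unfolding l2n_power2 of_real_mult of_real_sum sum_distrib_left complex_norm_square
    by (intro sum.cong refl) (simp add: mult_ac)
  ultimately have "\<bar>(1 / l2n n u) * (l2n n u)\<^sup>2\<bar> \<le> c" by (simp only: norm_of_real)
  then show ?thesis using pos by (simp add: power2_eq_square)
qed

text \<open>Each entry of \<open>T\<^bsub>\<xi>\<eta>\<^esub>\<close> is the trace of \<open>T\<^bsub>\<xi>\<eta>\<^esub>\<close> times a matrix unit. By Burnside's theorem the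
  matrix unit is a fixed linear combination of words in \<open>A\<close>, and for words the trace is bounded by the
  eigenvalue estimate. The bounds do not involve \<open>n\<close>, \<open>X\<close> or the exponent.\<close>

theorem irreducible_power_bounded:
  fixes Q :: "'d::finite \<Rightarrow> 'h::complex_hilbert \<Rightarrow> 'h"
  assumes nf: "no_fixed_vectors Q m A" and irr: "irreducible_tuple m A"
    and bdd: "\<forall>j. bounded_clinear_op (Q j)"
  obtains C where "C \<ge> 1" "\<And>n X l y. n \<ge> 1 \<Longrightarrow> pencil_bound Q n X 1 \<Longrightarrow> supported m n y \<Longrightarrow>
    mixed_norm m n ((act m n A X ^^ l) y) \<le> C * mixed_norm m n y"
proof -
  have A: "\<forall>j. A j \<in> carrier_mat m m" using irr by (simp add: irreducible_tuple_def)
  have "\<forall>j. \<exists>K. \<forall>x. norm (Q j x) \<le> norm x * K"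
    using bdd bounded_linear.bounded unfolding bounded_clinear_op_def by blast
  then obtain k where k: "norm (Q j x) \<le> norm x * k j" for j x by metis
  define K where "K = 1 + (\<Sum>j\<in>UNIV. \<bar>k j\<bar>)"
  have K1: "K \<ge> 1" by (simp add: K_def sum_nonneg)
  have K: "norm (Q j x) \<le> K * norm x" for j x
  proof -
    have "k j \<le> K" unfolding K_def using member_le_sum[of j UNIV "\<lambda>j. \<bar>k j\<bar>"] by simp
    then have "norm x * k j \<le> norm x * K" by (intro mult_left_mono) auto
    then show ?thesis using k[of j x] by (simp add: mult.commute)
  qed
  \<comment> \<open>This makes the one-letter points of size \<open>d\<close> lie in the closed ball.\<close>
  define d where "d = 1 / K"
  have d: "d > 0" "d * K \<le> 1" using K1 by (auto simp: d_def)
  have "\<forall>p q. \<exists>f :: 'd nc_poly. p < m \<longrightarrow> q < m \<longrightarrow>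
      (\<forall>i<m. \<forall>j<m. ev m A f $$ (i, j) = (if i = q \<and> j = p then 1 else 0))"
    using irreducible_tuple_matrix_unit[OF irr] by metis
  then obtain f :: "nat \<Rightarrow> nat \<Rightarrow> 'd nc_poly" where
    f: "\<And>p q i j. p < m \<Longrightarrow> q < m \<Longrightarrow> i < m \<Longrightarrow> j < m \<Longrightarrow> ev m A (f p q) $$ (i, j) = (if i = q \<and> j = p then 1 else 0)"
    by metis
  define c where "c p q = (\<Sum>w\<in>Poly_Mapping.keys (f p q). norm (Poly_Mapping.lookup (f p q) w) * (real m * (1 / d) ^ length (letters w)))" for p q
  have c0: "c p q \<ge> 0" for p q using d by (auto simp: c_def intro!: sum_nonneg)
  have entry: "norm (compression m n (act m n A X ^^ Suc l) \<xi> \<eta> $$ (p, q)) \<le> c p q"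
    if n: "n \<ge> 1" and X: "pencil_bound Q n X 1" and pq: "p < m" "q < m"
      and u: "l2n n \<xi> \<le> 1" "l2n n \<eta> \<le> 1" "l2n n \<xi> \<noteq> 0" for n X l \<xi> \<eta> p q
  proof -
    let ?C = "compression m n (act m n A X ^^ Suc l) \<xi> \<eta>"
    have C: "?C \<in> carrier_mat m m" by (simp add: compression_def)
    have W: "word_eval m A w \<in> carrier_mat m m" for w by (rule word_eval_carrier[OF A])
    have tr: "norm (\<Sum>i<m. (?C * word_eval m A w) $$ (i, i)) \<le> real m * (1 / d) ^ length (letters w)" for w
    proof (rule trace_eigenvalue_bound)
      show "?C * word_eval m A w \<in> carrier_mat m m" using C W by auto
      show "norm \<mu> \<le> (1 / d) ^ length (letters w)" if "eigenvalue (?C * word_eval m A w) \<mu>" for \<mu>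
        by (rule compression_word_eigenvalue[OF nf A bdd K d X n u(1,2,3)]) (use that in simp)
    qed
    have "?C $$ (p, q) = (\<Sum>i<m. \<Sum>s<m. ?C $$ (i, s) * ev m A (f p q) $$ (s, i))"
    proof -
      have "(\<Sum>i<m. \<Sum>s<m. ?C $$ (i, s) * ev m A (f p q) $$ (s, i)) = (\<Sum>i<m. \<Sum>s<m. if s = q then (if i = p then ?C $$ (p, q) else 0) else 0)"
        by (intro sum.cong refl) (use pq in \<open>auto simp: f\<close>)
      then show ?thesis using pq by simp
    qed
    also have "\<dots> = (\<Sum>i<m. \<Sum>s<m. \<Sum>w\<in>Poly_Mapping.keys (f p q). Poly_Mapping.lookup (f p q) w * (?C $$ (i, s) * word_eval m A w $$ (s, i)))"
      by (simp add: ev_def sum_distrib_left mult.left_commute)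
    also have "\<dots> = (\<Sum>i<m. \<Sum>w\<in>Poly_Mapping.keys (f p q). \<Sum>s<m. Poly_Mapping.lookup (f p q) w * (?C $$ (i, s) * word_eval m A w $$ (s, i)))"
      by (rule sum.cong[OF refl], rule sum.swap)
    also have "\<dots> = (\<Sum>w\<in>Poly_Mapping.keys (f p q). \<Sum>i<m. \<Sum>s<m. Poly_Mapping.lookup (f p q) w * (?C $$ (i, s) * word_eval m A w $$ (s, i)))"
      by (rule sum.swap)
    also have "\<dots> = (\<Sum>w\<in>Poly_Mapping.keys (f p q). Poly_Mapping.lookup (f p q) w * (\<Sum>i<m. (?C * word_eval m A w) $$ (i, i)))"
      by (simp add: mat_mult_index_sum[OF C W] sum_distrib_left del: index_mult_mat(1) funpow.simps)
    finally have "norm (?C $$ (p, q)) \<le> (\<Sum>w\<in>Poly_Mapping.keys (f p q). norm (Poly_Mapping.lookup (f p q) w * (\<Sum>i<m. (?C * word_eval m A w) $$ (i, i))))"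
      by (simp only: norm_sum)
    also have "\<dots> \<le> c p q"
      unfolding c_def norm_mult by (intro sum_mono mult_left_mono tr) auto
    finally show ?thesis .
  qed
  have column: "l2n n ((act m n A X ^^ Suc l) (ten m n (unit_vec m q) \<xi>) p) \<le> c p q * l2n n \<xi>"
    if n: "n \<ge> 1" and X: "pencil_bound Q n X 1" and pq: "p < m" "q < m" for n X l \<xi> p q
  proof (cases "l2n n \<xi> = 0")
    case True
    then have "ten m n (unit_vec m q) \<xi> = (\<lambda>p a. 0)" by (auto simp: ten_def l2n_eq_0 fun_eq_iff)
    moreover have "(act m n A X ^^ Suc l) (\<lambda>p a. 0) = (\<lambda>p a. 0)"
      using act_power_sum[of "Suc l" m n A X "\<lambda>_. 0" "\<lambda>_ _ _. 0" "{}"] by simp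
    ultimately show ?thesis using True by simp
  next
    case False
    then have pos: "l2n n \<xi> > 0" using l2n_nonneg[where f = \<xi> and n = n] by linarith
    define t where "t = l2n n \<xi>"
    define \<xi>' where "\<xi>' a = complex_of_real (1 / t) * \<xi> a" for a
    have t: "t > 0" using pos by (simp add: t_def)
    have \<xi>': "l2n n \<xi>' = 1" unfolding \<xi>'_def l2n_mult using t by (simp add: norm_divide flip: t_def)
    have "l2n n ((act m n A X ^^ Suc l) (ten m n (unit_vec m q) \<xi>') p) \<le> c p q"
    proof (rule l2n_le_if_pairing_le)
      fix \<eta> :: "nat \<Rightarrow> complex" assume "l2n n \<eta> \<le> 1"
      then show "norm (\<Sum>a<n. cnj (\<eta> a) * (act m n A X ^^ Suc l) (ten m n (unit_vec m q) \<xi>') p a) \<le> c p q"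
        using entry[OF n X pq, of \<xi>' \<eta> l] \<xi>' pq by (simp add: compression_def)
    qed
    moreover have "(act m n A X ^^ Suc l) (ten m n (unit_vec m q) \<xi>) p = (\<lambda>a. complex_of_real t * (act m n A X ^^ Suc l) (ten m n (unit_vec m q) \<xi>') p a)"
    proof -
      have "ten m n (unit_vec m q) \<xi> = (\<lambda>p a. \<Sum>s\<in>{()}. complex_of_real t * ten m n (unit_vec m q) \<xi>' p a)"
        using t by (auto simp: ten_def \<xi>'_def fun_eq_iff)
      then show ?thesis by (simp only: act_power_sum) simp
    qed
    ultimately have "l2n n ((act m n A X ^^ Suc l) (ten m n (unit_vec m q) \<xi>) p) \<le> t * c p q"
      using t by (simp only: l2n_mult) (simp add: mult_left_mono)
    then show ?thesis by (simp add: t_def mult.commute)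
  qed
  define C where "C = 1 + (\<Sum>p<m. \<Sum>q<m. c p q)"
  have C1: "C \<ge> 1" using c0 by (simp add: C_def sum_nonneg)
  have main: "mixed_norm m n ((act m n A X ^^ l) y) \<le> C * mixed_norm m n y"
    if n: "n \<ge> 1" and X: "pencil_bound Q n X 1" and y: "supported m n y" for n X l y
  proof (cases l)
    case 0
    then show ?thesis using C1 mult_right_mono[OF C1 mixed_norm_nonneg[of m n y]] by simp
  next
    case (Suc l)
    have dec: "y = (\<lambda>p a. \<Sum>q<m. 1 * ten m n (unit_vec m q) (y q) p a)"
    proof (intro ext)
      fix p a
      have "(\<Sum>q<m. ten m n (unit_vec m q) (y q) p a) = (\<Sum>q<m. if q = p then ten m n (unit_vec m p) (y p) p a else 0)"
        by (intro sum.cong refl) (auto simp: ten_def)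
      then show "y p a = (\<Sum>q<m. 1 * ten m n (unit_vec m q) (y q) p a)"
        using y by (auto simp: ten_def supported_def)
    qed
    have "mixed_norm m n ((act m n A X ^^ Suc l) y) = (\<Sum>p<m. l2n n (\<lambda>a. \<Sum>q<m. 1 * (act m n A X ^^ Suc l) (ten m n (unit_vec m q) (y q)) p a))"
      unfolding mixed_norm_def by (subst dec) (simp only: act_power_sum)
    also have "\<dots> \<le> (\<Sum>p<m. \<Sum>q<m. l2n n ((act m n A X ^^ Suc l) (ten m n (unit_vec m q) (y q)) p))"
      by (intro sum_mono order.trans[OF l2n_sum]) simp
    also have "\<dots> \<le> (\<Sum>p<m. \<Sum>q<m. c p q * mixed_norm m n y)"
    proof (intro sum_mono)
      fix p q assume pq: "p \<in> {..<m}" "q \<in> {..<m}"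
      have "l2n n ((act m n A X ^^ Suc l) (ten m n (unit_vec m q) (y q)) p) \<le> c p q * l2n n (y q)"
        using column[OF n X] pq by auto
      also have "\<dots> \<le> c p q * mixed_norm m n y"
        unfolding mixed_norm_def using pq
        by (intro mult_left_mono c0 member_le_sum[of q "{..<m}" "\<lambda>q. l2n n (y q)"]) (auto simp: l2n_nonneg)
      finally show "l2n n ((act m n A X ^^ Suc l) (ten m n (unit_vec m q) (y q)) p) \<le> c p q * mixed_norm m n y" .
    qed
    also have "\<dots> = (\<Sum>p<m. \<Sum>q<m. c p q) * mixed_norm m n y"
      by (simp add: sum_distrib_right)
    also have "\<dots> \<le> C * mixed_norm m n y"
      by (intro mult_right_mono mixed_norm_nonneg) (simp add: C_def)
    finally show ?thesis using Suc by simp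
  qed
  show ?thesis by (rule that[OF C1 main])
qed

text \<open>With \<open>T = A(X)\<close> and \<open>g = y - r T y\<close> one has \<open>y = \<Sum>\<^bsub>i<L\<^esub> r\<^sup>i T\<^sup>i g + r\<^sup>L T\<^sup>L y\<close>; let \<open>L\<close> tend to infinity.
  Only finite sums of vectors occur.\<close>

lemma resolvent_bound:
  assumes pb: "\<And>l y. supported m n y \<Longrightarrow> mixed_norm m n ((act m n A X ^^ l) y) \<le> C * mixed_norm m n y"
    and r: "0 \<le> r" "r < 1" and y: "supported m n y" and C: "C \<ge> 1"
  shows "mixed_norm m n y \<le> C / (1 - r) * mixed_norm m n (\<lambda>p a. y p a - complex_of_real r * act m n A X y p a)"
proof -
  let ?T = "act m n A X"
  define g where "g = (\<lambda>p a. y p a - complex_of_real r * ?T y p a)"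
  have g: "supported m n g" using y by (auto simp: supported_def g_def act_def)
  have step: "mixed_norm m n y \<le> (\<Sum>i<L. r ^ i * (C * mixed_norm m n g)) + r ^ L * (C * mixed_norm m n y)" for L
  proof -
    have eq: "y = (\<lambda>p a. (\<Sum>i<L. complex_of_real (r ^ i) * (?T ^^ i) g p a) + complex_of_real (r ^ L) * (?T ^^ L) y p a)" for L
    proof (induction L)
      case (Suc L)
      have y_eq: "y = (\<lambda>p a. g p a + complex_of_real r * ?T y p a)" by (simp add: g_def)
      have lin: "(?T ^^ L) (\<lambda>p a. u p a + c * v p a) = (\<lambda>p a. (?T ^^ L) u p a + c * (?T ^^ L) v p a)" for u v c
        by (induction L) (simp_all add: act_add act_mult)
      have "(?T ^^ L) y = (\<lambda>p a. (?T ^^ L) g p a + complex_of_real r * (?T ^^ L) (?T y) p a)"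
        by (subst y_eq) (simp only: lin)
      then have "complex_of_real (r ^ L) * (?T ^^ L) y p a =
          complex_of_real (r ^ L) * (?T ^^ L) g p a + complex_of_real (r ^ Suc L) * (?T ^^ Suc L) y p a" for p a
        unfolding funpow_Suc_right comp_apply
        by (simp add: algebra_simps del: funpow.simps)
      note expand = this
      show ?case
      proof (intro ext)
        fix p a
        have "y p a = (\<Sum>i<L. complex_of_real (r ^ i) * (?T ^^ i) g p a) + complex_of_real (r ^ L) * (?T ^^ L) y p a"
          by (rule fun_cong[OF fun_cong[OF Suc]])
        then show "y p a = (\<Sum>i<Suc L. complex_of_real (r ^ i) * (?T ^^ i) g p a) + complex_of_real (r ^ Suc L) * (?T ^^ Suc L) y p a"
          unfolding expand by (simp only: sum.lessThan_Suc add.assoc)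
      qed
    qed simp
    have sm: "mixed_norm m n (\<lambda>p a. \<Sum>i\<in>S. f i p a) \<le> (\<Sum>i\<in>S. mixed_norm m n (f i))" for f and S :: "nat set"
      unfolding mixed_norm_def by (subst sum.swap) (intro sum_mono l2n_sum)
    have "mixed_norm m n y = mixed_norm m n (\<lambda>p a. (\<Sum>i<L. complex_of_real (r ^ i) * (?T ^^ i) g p a) + complex_of_real (r ^ L) * (?T ^^ L) y p a)"
      by (rule arg_cong[OF eq])
    also have "\<dots> \<le> mixed_norm m n (\<lambda>p a. \<Sum>i<L. complex_of_real (r ^ i) * (?T ^^ i) g p a) + mixed_norm m n (\<lambda>p a. complex_of_real (r ^ L) * (?T ^^ L) y p a)"
      by (rule mixed_norm_triangle)
    also have "\<dots> \<le> (\<Sum>i<L. mixed_norm m n (\<lambda>p a. complex_of_real (r ^ i) * (?T ^^ i) g p a)) + mixed_norm m n (\<lambda>p a. complex_of_real (r ^ L) * (?T ^^ L) y p a)"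
      by (intro add_right_mono sm)
    also have "\<dots> \<le> (\<Sum>i<L. r ^ i * (C * mixed_norm m n g)) + r ^ L * (C * mixed_norm m n y)"
      unfolding mixed_norm_mult norm_of_real using r
      by (intro add_mono sum_mono mult_mono pb g y) (auto simp: mixed_norm_nonneg)
    finally show ?thesis .
  qed
  have "(\<lambda>L. (\<Sum>i<L. r ^ i * (C * mixed_norm m n g)) + r ^ L * (C * mixed_norm m n y)) \<longlonglongrightarrow> C / (1 - r) * mixed_norm m n g + 0"
  proof (rule tendsto_add)
    have "(\<lambda>i. r ^ i * (C * mixed_norm m n g)) sums (1 / (1 - r) * (C * mixed_norm m n g))"
      using r by (intro sums_mult2 geometric_sums) auto
    then show "(\<lambda>L. \<Sum>i<L. r ^ i * (C * mixed_norm m n g)) \<longlonglongrightarrow> C / (1 - r) * mixed_norm m n g"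
      by (simp add: sums_def)
    show "(\<lambda>L. r ^ L * (C * mixed_norm m n y)) \<longlonglongrightarrow> 0"
      using r by (intro tendsto_mult_left_zero LIMSEQ_realpow_zero) auto
  qed
  then have "mixed_norm m n y \<le> C / (1 - r) * mixed_norm m n g + 0"
    by (rule LIMSEQ_le_const) (use step in blast)
  then show ?thesis by (simp add: g_def)
qed

text \<open>The coefficient vectors \<open>s\<close> for which \<open>\<Sum> s\<^sub>j X\<^sub>j\<close> is bounded on the closed ball, uniformly in \<open>n\<close>, form
  a subspace \<open>W\<close>. It contains all vectors of matrix coefficients \<open>\<langle>Q\<^sub>j x, y\<rangle>\<close>, because slicing \<open>Q(X)\<close>
  by \<open>x\<close> and \<open>y\<close> does not increase norms beyond \<open>\<parallel>x\<parallel> \<parallel>y\<parallel>\<close>. A functional vanishing on \<open>W\<close> is therefore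
  a linear relation between the \<open>Q\<^sub>j\<close>, so \<open>W\<close> is everything.\<close>

lemma coordinates_bounded_on_ball:
  fixes Q :: "'d::finite \<Rightarrow> 'h::complex_hilbert \<Rightarrow> 'h"
  assumes basis: "operator_space_basis \<E> Q"
  obtains \<kappa> where "\<kappa> \<ge> 1" "\<And>n X j \<xi>. pencil_bound Q n X 1 \<Longrightarrow>
    l2n n (\<lambda>a. \<Sum>b<n. X j $$ (a, b) * \<xi> b) \<le> \<kappa> * l2n n \<xi>"
proof -
  have lin: "\<And>j a x. Q j (scaleC a x) = scaleC a (Q j x)"
    and indep: "\<And>c. (\<And>x. (\<Sum>j\<in>UNIV. scaleC (c j) (Q j x)) = 0) \<Longrightarrow> \<forall>j. c j = 0"
    using basis unfolding operator_space_basis_def bounded_clinear_op_def by auto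
  define c where "c = card (UNIV :: 'd set)"
  obtain e :: "nat \<Rightarrow> 'd" where e: "bij_betw e {..<c} UNIV"
    using ex_bij_betw_nat_finite[of "UNIV :: 'd set"] by (auto simp: c_def lessThan_atLeast0)
  define M where "M s n X \<xi> = (\<lambda>a. \<Sum>b<n. (\<Sum>i<c. s $ i * X (e i) $$ (a, b)) * \<xi> b)"
    for s :: "complex vec" and n :: nat and X :: "'d \<Rightarrow> complex mat" and \<xi> :: "nat \<Rightarrow> complex"
  define W where "W = {s \<in> carrier_vec c. \<exists>\<kappa>\<ge>0. \<forall>n X \<xi>. pencil_bound Q n X 1 \<longrightarrow> l2n n (M s n X \<xi>) \<le> \<kappa> * l2n n \<xi>}"
  have "vsubspace c W"
    unfolding vsubspace_def
  proof (intro conjI ballI allI)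
    show "0\<^sub>v c \<in> W" by (auto simp: W_def M_def intro!: exI[of _ 0])
  next
    fix s t assume st: "s \<in> W" "t \<in> W"
    then obtain k1 k2 where k: "k1 \<ge> 0" "k2 \<ge> 0"
      "\<And>n X \<xi>. pencil_bound Q n X 1 \<Longrightarrow> l2n n (M s n X \<xi>) \<le> k1 * l2n n \<xi>"
      "\<And>n X \<xi>. pencil_bound Q n X 1 \<Longrightarrow> l2n n (M t n X \<xi>) \<le> k2 * l2n n \<xi>"
      unfolding W_def by blast
    have stc: "s \<in> carrier_vec c" "t \<in> carrier_vec c" using st by (auto simp: W_def)
    have "l2n n (M (s + t) n X \<xi>) \<le> (k1 + k2) * l2n n \<xi>" if "pencil_bound Q n X 1" for n X \<xi>
    proof -
      have "M (s + t) n X \<xi> = (\<lambda>a. M s n X \<xi> a + M t n X \<xi> a)"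
        using stc by (simp add: M_def distrib_right sum.distrib)
      then have "l2n n (M (s + t) n X \<xi>) \<le> l2n n (M s n X \<xi>) + l2n n (M t n X \<xi>)"
        using l2n_triangle by simp
      then show ?thesis using k(3,4)[OF that, of \<xi>] by (simp add: distrib_right)
    qed
    then show "s + t \<in> W" using stc k unfolding W_def
      by (intro CollectI conjI exI[of _ "k1 + k2"]) auto
  next
    fix s a assume s: "s \<in> W"
    then obtain k where k: "k \<ge> 0"
      "\<And>n X \<xi>. pencil_bound Q n X 1 \<Longrightarrow> l2n n (M s n X \<xi>) \<le> k * l2n n \<xi>"
      unfolding W_def by blast
    have sc: "s \<in> carrier_vec c" using s by (auto simp: W_def)
    have "l2n n (M (a \<cdot>\<^sub>v s) n X \<xi>) \<le> (norm a * k) * l2n n \<xi>" if "pencil_bound Q n X 1" for n X \<xi>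
    proof -
      have "M (a \<cdot>\<^sub>v s) n X \<xi> = (\<lambda>i. a * M s n X \<xi> i)"
        using sc by (simp add: M_def sum_distrib_left sum_distrib_right mult.assoc)
      then have "l2n n (M (a \<cdot>\<^sub>v s) n X \<xi>) = norm a * l2n n (M s n X \<xi>)"
        using l2n_mult by simp
      then show ?thesis using mult_left_mono[OF k(2)[OF that, of \<xi>], of "norm a"] by (simp add: mult.assoc)
    qed
    then show "a \<cdot>\<^sub>v s \<in> W" using sc k unfolding W_def
      by (intro CollectI conjI exI[of _ "norm a * k"]) auto
  qed (auto simp: W_def)
  have mem: "vec c (\<lambda>i. cinner (Q (e i) x) y) \<in> W" for x y
  proof -
    have "l2n n (M (vec c (\<lambda>i. cinner (Q (e i) x) y)) n X \<xi>) \<le> (norm x * norm y) * l2n n \<xi>" if X: "pencil_bound Q n X 1" for n X \<xi>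
    proof -
      let ?v = "\<lambda>b. scaleC (\<xi> b) x"
      have "M (vec c (\<lambda>i. cinner (Q (e i) x) y)) n X \<xi> a = cinner (pencil Q (n, X) ?v a) y" for a
      proof -
        have "M (vec c (\<lambda>i. cinner (Q (e i) x) y)) n X \<xi> a = (\<Sum>b<n. (\<Sum>i<c. cinner (Q (e i) x) y * X (e i) $$ (a, b)) * \<xi> b)"
          by (simp add: M_def)
        also have "\<dots> = (\<Sum>b<n. (\<Sum>j\<in>UNIV. cinner (Q j x) y * X j $$ (a, b)) * \<xi> b)"
          using sum.reindex_bij_betw[OF e, of "\<lambda>j. cinner (Q j x) y * X j $$ (a, _)"] by simp
        also have "\<dots> = (\<Sum>b<n. \<Sum>j\<in>UNIV. X j $$ (a, b) * (\<xi> b * cinner (Q j x) y))"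
          by (simp add: sum_distrib_left sum_distrib_right mult_ac)
        also have "\<dots> = (\<Sum>j\<in>UNIV. \<Sum>b<n. X j $$ (a, b) * (\<xi> b * cinner (Q j x) y))"
          by (rule sum.swap)
        finally show ?thesis by (simp add: cinner_sum_left cinner_scaleC_left lin)
      qed
      then have "l2n n (M (vec c (\<lambda>i. cinner (Q (e i) x) y)) n X \<xi>) = l2n n (\<lambda>a. cinner (pencil Q (n, X) ?v a) y)" by simp
      also have "\<dots> \<le> L2_set (\<lambda>a. norm (pencil Q (n, X) ?v a) * norm y) {..<n}"
        by (intro L2_set_mono cinner_cauchy_schwarz) auto
      also have "\<dots> = l2n n (pencil Q (n, X) ?v) * norm y" by (rule L2_set_left_distrib[symmetric]) simp
      also have "\<dots> \<le> l2n n ?v * norm y"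
        using X by (intro mult_right_mono) (auto simp: pencil_bound_def simp del: pencil.simps)
      also have "l2n n ?v = l2n n \<xi> * norm x"
        by (simp add: norm_scaleC L2_set_left_distrib)
      finally show ?thesis by (simp add: mult_ac)
    qed
    then show ?thesis unfolding W_def
      by (intro CollectI conjI exI[of _ "norm x * norm y"]) auto
  qed
  have W: "W = carrier_vec c"
  proof (rule ccontr)
    assume "W \<noteq> carrier_vec c"
    with \<open>vsubspace c W\<close> obtain f where f: "f \<in> carrier_vec c" "f \<noteq> 0\<^sub>v c" "\<And>w. w \<in> W \<Longrightarrow> f \<bullet> w = 0"
      using vsubspace_functional by metis
    define g where "g j = f $ (the_inv_into {..<c} e j)" for j
    have ge: "g (e i) = f $ i" if "i < c" for i
      using that e unfolding g_def by (simp add: bij_betw_def the_inv_into_f_f)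
    have "(\<Sum>j\<in>UNIV. scaleC (g j) (Q j x)) = 0" for x
    proof -
      let ?z = "\<Sum>j\<in>UNIV. scaleC (g j) (Q j x)"
      have "cinner ?z y = 0" for y
      proof -
        have "cinner ?z y = (\<Sum>j\<in>UNIV. g j * cinner (Q j x) y)"
          by (simp add: cinner_sum_left cinner_scaleC_left)
        also have "\<dots> = (\<Sum>i<c. g (e i) * cinner (Q (e i) x) y)"
          by (rule sum.reindex_bij_betw[OF e, symmetric])
        also have "\<dots> = f \<bullet> vec c (\<lambda>i. cinner (Q (e i) x) y)"
          by (simp add: scalar_prod_def ge lessThan_atLeast0)
        also have "\<dots> = 0" by (rule f(3)[OF mem])
        finally show ?thesis .
      qed
      then have "complex_of_real ((norm ?z)\<^sup>2) = 0" by (simp only: cinner_self[symmetric])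
      then show ?thesis by simp
    qed
    then have "\<forall>j. g j = 0" by (rule indep)
    then have "f $ i = 0" if "i < c" for i using ge[OF that] by simp
    then have "f = 0\<^sub>v c" using f(1) by (intro eq_vecI) auto
    then show False using f(2) by simp
  qed
  have "\<forall>i. \<exists>k\<ge>0. \<forall>n X \<xi>. pencil_bound Q n X 1 \<longrightarrow> l2n n (M (unit_vec c i) n X \<xi>) \<le> k * l2n n \<xi>"
  proof
    fix i
    have "unit_vec c i \<in> W" using W by simp
    then show "\<exists>k\<ge>0. \<forall>n X \<xi>. pencil_bound Q n X 1 \<longrightarrow> l2n n (M (unit_vec c i) n X \<xi>) \<le> k * l2n n \<xi>"
      unfolding W_def by blast
  qed
  then obtain k where k: "\<And>i. k i \<ge> 0"
    "\<And>i n X \<xi>. pencil_bound Q n X 1 \<Longrightarrow> l2n n (M (unit_vec c i) n X \<xi>) \<le> k i * l2n n \<xi>" by metis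
  define \<kappa> where "\<kappa> = 1 + (\<Sum>i<c. k i)"
  have "l2n n (\<lambda>a. \<Sum>b<n. X j $$ (a, b) * \<xi> b) \<le> \<kappa> * l2n n \<xi>" if X: "pencil_bound Q n X 1" for n X j \<xi>
  proof -
    obtain i where i: "i < c" "e i = j" using e by (metis UNIV_I bij_betw_iff_bijections lessThan_iff)
    have "M (unit_vec c i) n X \<xi> = (\<lambda>a. \<Sum>b<n. X j $$ (a, b) * \<xi> b)"
    proof -
      have "(\<Sum>l<c. unit_vec c i $ l * X (e l) $$ (a, b)) = (\<Sum>l<c. if l = i then X j $$ (a, b) else 0)" for a b
        by (intro sum.cong refl) (use i in auto)
      then show ?thesis using i by (simp add: M_def)
    qed
    then have "l2n n (\<lambda>a. \<Sum>b<n. X j $$ (a, b) * \<xi> b) \<le> k i * l2n n \<xi>" using k(2)[OF X, of i \<xi>] by simp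
    also have "\<dots> \<le> \<kappa> * l2n n \<xi>"
      using member_le_sum[of i "{..<c}" k] i k(1) by (intro mult_right_mono) (auto simp: \<kappa>_def l2n_nonneg)
    finally show ?thesis .
  qed
  moreover have "\<kappa> \<ge> 1" using k(1) by (simp add: \<kappa>_def sum_nonneg)
  ultimately show ?thesis using that by blast
qed

section \<open>Evaluated polynomial matrices as operators on block vectors\<close>

text \<open>The operator \<open>G(X)\<close> in the two-index notation of \<open>act\<close>.\<close>

definition pact :: "nat \<Rightarrow> nat \<Rightarrow> 'd nc_poly mat \<Rightarrow> ('d \<Rightarrow> complex mat) \<Rightarrow>
    (nat \<Rightarrow> nat \<Rightarrow> complex) \<Rightarrow> nat \<Rightarrow> nat \<Rightarrow> complex" where
  "pact N n G X y p a = (if p < N \<and> a < n then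
     (\<Sum>q<N. \<Sum>b<n. ev n X (G $$ (p, q)) $$ (a, b) * y q b) else 0)"

lemma supported_pact[simp]: "supported N n (pact N n G X y)"
  by (auto simp: supported_def pact_def)

lemma pact_diff: "pact N n G X (\<lambda>p a. y p a - z p a) = (\<lambda>p a. pact N n G X y p a - pact N n G X z p a)"
  by (intro ext) (simp add: pact_def right_diff_distrib sum_subtractf)

lemma pact_mult:
  assumes X: "\<forall>j. X j \<in> carrier_mat n n" and G: "G \<in> carrier_mat N N" "H \<in> carrier_mat N N"
  shows "pact N n (G * H) X y = pact N n G X (pact N n H X y)"
proof (intro ext)
  fix p a
  show "pact N n (G * H) X y p a = pact N n G X (pact N n H X y) p a"
  proof (cases "p < N \<and> a < n")
    case True
    let ?g = "\<lambda>p q a b. ev n X (G $$ (p, q)) $$ (a, b)" and ?h = "\<lambda>p q a b. ev n X (H $$ (p, q)) $$ (a, b)"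
    have e: "ev n X ((G * H) $$ (p, q)) $$ (a, b) = (\<Sum>s<N. \<Sum>c<n. ?g p s a c * ?h s q c b)"
      if "q < N" "b < n" for q b
      using True that
      by (simp add: mat_mult_index_sum[OF G] ev_sum ev_mult[OF X] scalar_prod_def lessThan_atLeast0
          del: index_mult_mat(1)) (simp add: scalar_prod_def)
    have "pact N n (G * H) X y p a = (\<Sum>q<N. \<Sum>b<n. \<Sum>s<N. \<Sum>c<n. ?g p s a c * (?h s q c b * y q b))"
      using True by (simp add: pact_def e sum_distrib_right mult.assoc)
    also have "\<dots> = (\<Sum>q<N. \<Sum>s<N. \<Sum>b<n. \<Sum>c<n. ?g p s a c * (?h s q c b * y q b))"
      by (rule sum.cong[OF refl], rule sum.swap)
    also have "\<dots> = (\<Sum>s<N. \<Sum>q<N. \<Sum>b<n. \<Sum>c<n. ?g p s a c * (?h s q c b * y q b))"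
      by (rule sum.swap)
    also have "\<dots> = (\<Sum>s<N. \<Sum>q<N. \<Sum>c<n. \<Sum>b<n. ?g p s a c * (?h s q c b * y q b))"
      by (rule sum.cong[OF refl], rule sum.cong[OF refl], rule sum.swap)
    also have "\<dots> = (\<Sum>s<N. \<Sum>c<n. \<Sum>q<N. \<Sum>b<n. ?g p s a c * (?h s q c b * y q b))"
      by (rule sum.cong[OF refl], rule sum.swap)
    also have "\<dots> = pact N n G X (pact N n H X y) p a"
      using True by (simp add: pact_def sum_distrib_left)
    finally show ?thesis .
  qed (auto simp: pact_def)
qed

lemma pact_pad:
  assumes A: "A \<in> carrier_mat k k" and k: "k \<le> N" and y: "supported N n y"
  shows "pact N n (pad N A) X y = (\<lambda>p a. if p < k then pact k n A X y p a else y p a)"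
proof (intro ext)
  fix p a
  show "pact N n (pad N A) X y p a = (if p < k then pact k n A X y p a else y p a)"
  proof (cases "p < N \<and> a < n")
    case True
    have one: "ev n X 1 $$ (a, b) = (if b = a then 1 else 0)" if "b < n" for b
      using True that by (simp add: ev_one)
    show ?thesis
    proof (cases "p < k")
      case pk: True
      have "(\<Sum>q<N. \<Sum>b<n. ev n X (pad N A $$ (p, q)) $$ (a, b) * y q b) =
          (\<Sum>q<k. \<Sum>b<n. ev n X (A $$ (p, q)) $$ (a, b) * y q b)"
        by (rule sum.mono_neutral_cong_right) (use True pk A k in \<open>auto simp: pad_def intro!: sum.neutral sum.cong\<close>)
      then show ?thesis using True pk by (simp add: pact_def)
    next
      case False
      have "(\<Sum>q<N. \<Sum>b<n. ev n X (pad N A $$ (p, q)) $$ (a, b) * y q b) =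
          (\<Sum>q<N. if q = p then (\<Sum>b<n. if b = a then y p a else 0) else 0)"
        by (intro sum.cong refl) (use True False A in \<open>auto simp: pad_def one sum_mult_delta intro!: sum.neutral sum.cong\<close>)
      then show ?thesis using True False by (simp add: pact_def)
    qed
  next
    case False
    then show ?thesis using y k by (auto simp: pact_def supported_def)
  qed
qed

lemma pact_one:
  assumes "supported N n y"
  shows "pact N n (1\<^sub>m N) X y = y"
proof -
  have "pad N (1\<^sub>m 0 :: 'a nc_poly mat) = 1\<^sub>m N" by (rule pad_one) simp
  then show ?thesis using pact_pad[of "1\<^sub>m 0 :: 'a nc_poly mat" 0 N n y X] assms by simp
qed

lemma pact_one_minus_lin:
  fixes A X :: "'d::finite \<Rightarrow> complex mat"
  assumes X: "\<forall>j. X j \<in> carrier_mat n n" and y: "supported m n y"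
  shows "pact m n (1\<^sub>m m - lin m A) X y = (\<lambda>p a. y p a - act m n A X y p a)"
proof (intro ext)
  fix p a
  show "pact m n (1\<^sub>m m - lin m A) X y p a = y p a - act m n A X y p a"
  proof (cases "p < m \<and> a < n")
    case True
    have Xc: "X j * 1\<^sub>m n = X j" for j using X[rule_format, of j] by simp
    have "(1\<^sub>m m - lin m A) $$ (p, q) = 1\<^sub>m m $$ (p, q) - lin m A $$ (p, q)" if "q < m" for q
      using True that by simp
    moreover have "ev n X (lin m A $$ (p, q)) $$ (a, b) = (\<Sum>j\<in>UNIV. A j $$ (p, q) * X j $$ (a, b))" if "q < m" "b < n" for q b
      using True that by (simp add: lin_def ev_sum ev_single word_eval_Cons word_eval_Nil Xc)
    ultimately have "pact m n (1\<^sub>m m - lin m A) X y p a = pact m n (1\<^sub>m m) X y p a - act m n A X y p a"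
      using True by (simp add: pact_def act_def ev_diff left_diff_distrib sum_subtractf del: index_minus_mat)
    then show ?thesis by (simp add: pact_one[OF y])
  qed (use y in \<open>auto simp: pact_def act_def supported_def\<close>)
qed

definition unblock :: "nat \<Rightarrow> nat \<Rightarrow> complex vec \<Rightarrow> nat \<Rightarrow> nat \<Rightarrow> complex" where
  "unblock N n v p a = (if p < N \<and> a < n then v $ (p * n + a) else 0)"

lemma supported_unblock: "supported N n (unblock N n v)"
  by (auto simp: supported_def unblock_def)

lemma block_index_less: 
  fixes p :: nat
  assumes "p < N" "a < n" shows "p * n + a < N * n"
proof -
  have "p * n + a < Suc p * n" using assms by simp
  also have "\<dots> \<le> N * n" using assms by (intro mult_le_mono1) simp
  finally show ?thesis .
qed

lemma unblock_nc_eval: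
  assumes X: "\<forall>j. X j \<in> carrier_mat n n" and G: "G \<in> carrier_mat N N" and v: "v \<in> carrier_vec (N * n)"
  shows "unblock N n (nc_eval G (n, X) *\<^sub>v v) = pact N n G X (unblock N n v)"
proof (intro ext)
  fix p a
  show "unblock N n (nc_eval G (n, X) *\<^sub>v v) p a = pact N n G X (unblock N n v) p a"
  proof (cases "p < N \<and> a < n")
    case True
    then have i: "p * n + a < N * n" using block_index_less by blast
    have d: "(p * n + a) div n = p" "(p * n + a) mod n = a" using True by auto
    have "(nc_eval G (n, X) *\<^sub>v v) $ (p * n + a) = (\<Sum>l<N * n. nc_eval G (n, X) $$ (p * n + a, l) * v $ l)"
      using i G v by (simp add: scalar_prod_def lessThan_atLeast0 del: nc_eval.simps)
    also have "\<dots> = (\<Sum>l<N * n. (\<lambda>q b. ev n X (G $$ (p, q)) $$ (a, b) * unblock N n v q b) (l div n) (l mod n))"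
    proof (intro sum.cong refl)
      fix l assume "l \<in> {..<N * n}"
      then have l: "l < N * n" by simp
      note ld = div_mod_less[OF l]
      show "nc_eval G (n, X) $$ (p * n + a, l) * v $ l = (\<lambda>q b. ev n X (G $$ (p, q)) $$ (a, b) * unblock N n v q b) (l div n) (l mod n)"
        using nc_eval_index[OF X, of "p * n + a" G l] G i l ld True by (simp add: d unblock_def del: nc_eval.simps)
    qed
    also have "\<dots> = (\<Sum>q<N. \<Sum>b<n. ev n X (G $$ (p, q)) $$ (a, b) * unblock N n v q b)"
      by (rule sum_div_mod)
    finally show ?thesis using True by (simp add: unblock_def pact_def del: nc_eval.simps)
  qed (auto simp: unblock_def pact_def)
qed

lemma cvec_norm_le_mixed_norm:
  assumes v: "v \<in> carrier_vec (N * n)"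
  shows "cvec_norm v \<le> mixed_norm N n (unblock N n v)" "mixed_norm N n (unblock N n v) \<le> real N * cvec_norm v"
proof -
  have sq: "(cvec_norm v)\<^sup>2 = (\<Sum>p<N. (l2n n (unblock N n v p))\<^sup>2)"
  proof -
    have "(cvec_norm v)\<^sup>2 = (\<Sum>i<N * n. (\<lambda>p a. (norm (unblock N n v p a))\<^sup>2) (i div n) (i mod n))"
      unfolding cvec_norm_def l2n_power2 using v
      by (intro sum.cong) (auto simp: unblock_def div_mod_less)
    also have "\<dots> = (\<Sum>p<N. \<Sum>a<n. (norm (unblock N n v p a))\<^sup>2)" by (rule sum_div_mod)
    finally show ?thesis by (simp only: l2n_power2)
  qed
  have c0: "0 \<le> cvec_norm v" by (simp add: cvec_norm_def l2n_nonneg)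
  have "(cvec_norm v)\<^sup>2 = (L2_set (\<lambda>p. l2n n (unblock N n v p)) {..<N})\<^sup>2"
    unfolding sq by (simp add: L2_set_def[of "\<lambda>p. l2n n (unblock N n v p)"] sum_nonneg)
  then have "cvec_norm v = L2_set (\<lambda>p. l2n n (unblock N n v p)) {..<N}"
    using c0 by (simp add: power2_eq_iff_nonneg L2_set_nonneg)
  also have "\<dots> \<le> mixed_norm N n (unblock N n v)"
    unfolding mixed_norm_def by (rule L2_set_le_sum) (simp add: l2n_nonneg)
  finally show "cvec_norm v \<le> mixed_norm N n (unblock N n v)" .
  have "l2n n (unblock N n v p) \<le> cvec_norm v" if "p < N" for p
  proof (rule power2_le_imp_le[OF _ c0])
    show "(l2n n (unblock N n v p))\<^sup>2 \<le> (cvec_norm v)\<^sup>2"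
      unfolding sq using that by (intro member_le_sum[of p "{..<N}" "\<lambda>p. (l2n n (unblock N n v p))\<^sup>2"]) auto
  qed
  then have "mixed_norm N n (unblock N n v) \<le> (\<Sum>p<N. cvec_norm v)"
    unfolding mixed_norm_def by (intro sum_mono) auto
  then show "mixed_norm N n (unblock N n v) \<le> real N * cvec_norm v" by simp
qed

lemma mixed_norm_enlarge:
  assumes "supported k n y" "k \<le> N"
  shows "mixed_norm N n y = mixed_norm k n y"
  unfolding mixed_norm_def
  by (rule sum.mono_neutral_right) (use assms in \<open>auto simp: supported_def l2n_eq_0\<close>)

lemma mixed_norm_split:
  assumes "m \<le> N"
  shows "mixed_norm N n y = mixed_norm m n y + (\<Sum>p\<in>{m..<N}. l2n n (y p))"
proof -
  have "{..<N} = {..<m} \<union> {m..<N}" using assms by auto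
  then show ?thesis unfolding mixed_norm_def by (simp add: sum.union_disjoint ivl_disj_int)
qed

section \<open>Uniform bounds for polynomial matrices\<close>

lemma word_eval_scale:
  assumes X: "\<forall>j. X j \<in> carrier_mat n n"
  shows "word_eval n (\<lambda>j. c \<cdot>\<^sub>m X j) (NCWord w) = c ^ length w \<cdot>\<^sub>m word_eval n X (NCWord w)"
proof (induction w)
  case Nil
  then show ?case by (simp add: word_eval_Nil) (rule eq_matI, auto)
next
  case (Cons j w)
  have Xj: "X j \<in> carrier_mat n n" using X by blast
  note W = word_eval_carrier[OF X, of "NCWord w"]
  have "word_eval n (\<lambda>j. c \<cdot>\<^sub>m X j) (NCWord (j # w)) = (c \<cdot>\<^sub>m X j) * (c ^ length w \<cdot>\<^sub>m word_eval n X (NCWord w))"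
    by (simp add: word_eval_Cons Cons)
  also have "\<dots> = c ^ length (j # w) \<cdot>\<^sub>m (X j * word_eval n X (NCWord w))"
    by (rule eq_matI) (use Xj W in \<open>auto simp: scalar_prod_def sum_distrib_left mult_ac\<close>)
  finally show ?case by (simp add: word_eval_Cons)
qed

lemma word_eval_bound:
  assumes X: "\<forall>j. X j \<in> carrier_mat n n" and \<kappa>: "\<kappa> \<ge> 0"
    and b: "\<And>j \<xi>. l2n n (\<lambda>a. \<Sum>b<n. X j $$ (a, b) * \<xi> b) \<le> \<kappa> * l2n n \<xi>"
  shows "l2n n (\<lambda>a. \<Sum>b<n. word_eval n X (NCWord w) $$ (a, b) * \<xi> b) \<le> \<kappa> ^ length w * l2n n \<xi>"
proof (induction w)
  case Nil
  have "l2n n (\<lambda>a. \<Sum>b<n. word_eval n X (NCWord []) $$ (a, b) * \<xi> b) = l2n n \<xi>"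
  proof (rule l2n_cong)
    fix a assume a: "a < n"
    have "(\<Sum>b<n. word_eval n X (NCWord []) $$ (a, b) * \<xi> b) = (\<Sum>b<n. if b = a then \<xi> a else 0)"
      by (intro sum.cong refl) (use a in \<open>auto simp: word_eval_Nil\<close>)
    then show "(\<Sum>b<n. word_eval n X (NCWord []) $$ (a, b) * \<xi> b) = \<xi> a" using a by simp
  qed
  then show ?case by simp
next
  case (Cons j w)
  have Xj: "X j \<in> carrier_mat n n" using X by blast
  note W = word_eval_carrier[OF X, of "NCWord w"]
  let ?\<zeta> = "\<lambda>c. \<Sum>b<n. word_eval n X (NCWord w) $$ (c, b) * \<xi> b"
  have "l2n n (\<lambda>a. \<Sum>b<n. word_eval n X (NCWord (j # w)) $$ (a, b) * \<xi> b) = l2n n (\<lambda>a. \<Sum>c<n. X j $$ (a, c) * ?\<zeta> c)"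
  proof (rule l2n_cong)
    fix a assume a: "a < n"
    have "(\<Sum>b<n. word_eval n X (NCWord (j # w)) $$ (a, b) * \<xi> b) = (\<Sum>b<n. \<Sum>c<n. X j $$ (a, c) * (word_eval n X (NCWord w) $$ (c, b) * \<xi> b))"
      using a by (simp add: word_eval_Cons mat_mult_index_sum[OF Xj W] sum_distrib_right mult.assoc del: index_mult_mat(1))
    also have "\<dots> = (\<Sum>c<n. \<Sum>b<n. X j $$ (a, c) * (word_eval n X (NCWord w) $$ (c, b) * \<xi> b))"
      by (rule sum.swap)
    finally show "(\<Sum>b<n. word_eval n X (NCWord (j # w)) $$ (a, b) * \<xi> b) = (\<Sum>c<n. X j $$ (a, c) * ?\<zeta> c)"
      by (simp add: sum_distrib_left)
  qed
  also have "\<dots> \<le> \<kappa> * l2n n ?\<zeta>" by (rule b)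
  also have "\<dots> \<le> \<kappa> * (\<kappa> ^ length w * l2n n \<xi>)" using Cons \<kappa> by (rule mult_left_mono)
  finally show ?case by (simp add: mult.assoc)
qed

text \<open>The operator \<open>\<Sum> \<gamma>(|w|) G\<^sub>w \<otimes> X\<^sup>w\<close>. The weights \<open>1\<close>, \<open>r\<^sup>l\<close> and \<open>1 - r\<^sup>l\<close> give \<open>G(X)\<close>, \<open>G(rX)\<close> and
  \<open>G(X) - G(rX)\<close>, so one estimate covers all three.\<close>

definition weighted_act :: "nat \<Rightarrow> nat \<Rightarrow> 'd nc_poly mat \<Rightarrow> ('d \<Rightarrow> complex mat) \<Rightarrow> (nat \<Rightarrow> real) \<Rightarrow>
    (nat \<Rightarrow> nat \<Rightarrow> complex) \<Rightarrow> nat \<Rightarrow> nat \<Rightarrow> complex" where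
  "weighted_act N n G X \<gamma> y p a = (if p < N \<and> a < n then
     (\<Sum>q<N. \<Sum>w\<in>Poly_Mapping.keys (G $$ (p, q)). Poly_Mapping.lookup (G $$ (p, q)) w * complex_of_real (\<gamma> (length (letters w))) *
        (\<Sum>b<n. word_eval n X w $$ (a, b) * y q b)) else 0)"

lemma pact_dilate_weighted:
  assumes X: "\<forall>j. X j \<in> carrier_mat n n"
  shows "pact N n G (dil r X) y = weighted_act N n G X (\<lambda>l. r ^ l) y"
proof (intro ext)
  fix p a
  show "pact N n G (dil r X) y p a = weighted_act N n G X (\<lambda>l. r ^ l) y p a"
  proof (cases "p < N \<and> a < n")
    case True
    have W: "word_eval n (dil r X) w $$ (a, b) = complex_of_real (r ^ length (letters w)) * word_eval n X w $$ (a, b)"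
      if "b < n" for w b
      using word_eval_scale[OF X, of "complex_of_real r" "letters w"] word_eval_carrier[OF X, of w] True that by (cases w) auto
    have "pact N n G (dil r X) y p a = (\<Sum>q<N. \<Sum>b<n. \<Sum>w\<in>Poly_Mapping.keys (G $$ (p, q)).
        Poly_Mapping.lookup (G $$ (p, q)) w * complex_of_real (r ^ length (letters w)) * (word_eval n X w $$ (a, b) * y q b))"
      using True by (simp add: pact_def ev_def W sum_distrib_right mult.assoc)
    also have "\<dots> = (\<Sum>q<N. \<Sum>w\<in>Poly_Mapping.keys (G $$ (p, q)). \<Sum>b<n.
        Poly_Mapping.lookup (G $$ (p, q)) w * complex_of_real (r ^ length (letters w)) * (word_eval n X w $$ (a, b) * y q b))"
      by (rule sum.cong[OF refl], rule sum.swap)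
    finally show ?thesis using True by (simp add: weighted_act_def sum_distrib_left)
  qed (auto simp: pact_def weighted_act_def)
qed

lemma weighted_act_bound:
  assumes X: "\<forall>j. X j \<in> carrier_mat n n" and \<kappa>: "\<kappa> \<ge> 0"
    and b: "\<And>j \<xi>. l2n n (\<lambda>a. \<Sum>b<n. X j $$ (a, b) * \<xi> b) \<le> \<kappa> * l2n n \<xi>"
    and g: "\<And>l. \<bar>\<gamma> l\<bar> \<le> t * (1 + real l)" and t: "t \<ge> 0"
  shows "mixed_norm N n (weighted_act N n G X \<gamma> y) \<le>
    t * (\<Sum>p<N. \<Sum>q<N. \<Sum>w\<in>Poly_Mapping.keys (G $$ (p, q)). norm (Poly_Mapping.lookup (G $$ (p, q)) w) * (1 + real (length (letters w))) * \<kappa> ^ length (letters w)) * mixed_norm N n y"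
proof -
  let ?c = "\<lambda>p q w. norm (Poly_Mapping.lookup (G $$ (p, q)) w) * (1 + real (length (letters w))) * \<kappa> ^ length (letters w)"
  have "mixed_norm N n (weighted_act N n G X \<gamma> y) \<le> (\<Sum>p<N. \<Sum>q<N. \<Sum>w\<in>Poly_Mapping.keys (G $$ (p, q)). t * ?c p q w * mixed_norm N n y)"
    unfolding mixed_norm_def[of N n "weighted_act N n G X \<gamma> y"]
  proof (rule sum_mono)
    fix p assume "p \<in> {..<N}"
    then have p: "p < N" by simp
    have "l2n n (weighted_act N n G X \<gamma> y p) = l2n n (\<lambda>a. \<Sum>q<N. \<Sum>w\<in>Poly_Mapping.keys (G $$ (p, q)).
        Poly_Mapping.lookup (G $$ (p, q)) w * complex_of_real (\<gamma> (length (letters w))) * (\<Sum>b<n. word_eval n X w $$ (a, b) * y q b))"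
      by (rule l2n_cong) (use p in \<open>simp add: weighted_act_def\<close>)
    also have "\<dots> \<le> (\<Sum>q<N. l2n n (\<lambda>a. \<Sum>w\<in>Poly_Mapping.keys (G $$ (p, q)).
        Poly_Mapping.lookup (G $$ (p, q)) w * complex_of_real (\<gamma> (length (letters w))) * (\<Sum>b<n. word_eval n X w $$ (a, b) * y q b)))"
      by (rule l2n_sum)
    also have "\<dots> \<le> (\<Sum>q<N. \<Sum>w\<in>Poly_Mapping.keys (G $$ (p, q)). l2n n (\<lambda>a.
        Poly_Mapping.lookup (G $$ (p, q)) w * complex_of_real (\<gamma> (length (letters w))) * (\<Sum>b<n. word_eval n X w $$ (a, b) * y q b)))"
      by (intro sum_mono l2n_sum)
    also have "\<dots> \<le> (\<Sum>q<N. \<Sum>w\<in>Poly_Mapping.keys (G $$ (p, q)). t * ?c p q w * mixed_norm N n y)"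
    proof (intro sum_mono)
      fix q w assume q: "q \<in> {..<N}"
      let ?l = "length (letters w)" and ?k = "norm (Poly_Mapping.lookup (G $$ (p, q)) w)"
      have "l2n n (\<lambda>a. Poly_Mapping.lookup (G $$ (p, q)) w * complex_of_real (\<gamma> ?l) * (\<Sum>b<n. word_eval n X w $$ (a, b) * y q b)) =
          ?k * \<bar>\<gamma> ?l\<bar> * l2n n (\<lambda>a. \<Sum>b<n. word_eval n X w $$ (a, b) * y q b)"
        unfolding l2n_mult by (simp add: norm_mult)
      also have "\<dots> \<le> ?k * (t * (1 + real ?l)) * (\<kappa> ^ ?l * l2n n (y q))"
        using word_eval_bound[OF X \<kappa> b, where w = "letters w" and \<xi> = "y q"] t
        by (intro mult_mono mult_left_mono g) (auto simp: l2n_nonneg)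
      also have "\<dots> \<le> ?k * (t * (1 + real ?l)) * (\<kappa> ^ ?l * mixed_norm N n y)"
      proof -
        have "l2n n (y q) \<le> mixed_norm N n y"
          unfolding mixed_norm_def using q by (intro member_le_sum[of q "{..<N}" "\<lambda>q. l2n n (y q)"]) (auto simp: l2n_nonneg)
        then show ?thesis using t \<kappa> by (intro mult_left_mono) auto
      qed
      also have "\<dots> = t * ?c p q w * mixed_norm N n y" by (simp only: mult_ac)
      finally show "l2n n (\<lambda>a. Poly_Mapping.lookup (G $$ (p, q)) w * complex_of_real (\<gamma> ?l) * (\<Sum>b<n. word_eval n X w $$ (a, b) * y q b)) \<le> t * ?c p q w * mixed_norm N n y" .
    qed
    finally show "l2n n (weighted_act N n G X \<gamma> y p) \<le> (\<Sum>q<N. \<Sum>w\<in>Poly_Mapping.keys (G $$ (p, q)). t * ?c p q w * mixed_norm N n y)" .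
  qed
  also have "\<dots> = t * (\<Sum>p<N. \<Sum>q<N. \<Sum>w\<in>Poly_Mapping.keys (G $$ (p, q)). ?c p q w) * mixed_norm N n y"
    by (simp only: sum_distrib_left sum_distrib_right)
  finally show ?thesis .
qed

text \<open>Both \<open>G(X)\<close> and \<open>G(rX)\<close> have norm at most \<open>K\<close>, and \<open>G(X) - G(rX)\<close> at most \<open>(1 - r) K\<close>.\<close>

definition dilation_bound :: "nat \<Rightarrow> nat \<Rightarrow> ('d \<Rightarrow> complex mat) \<Rightarrow> real \<Rightarrow> real \<Rightarrow> 'd nc_poly mat \<Rightarrow> bool" where
  "dilation_bound N n X r K G \<longleftrightarrow> (\<forall>y.
     mixed_norm N n (pact N n G X y) \<le> K * mixed_norm N n y \<and>
     mixed_norm N n (pact N n G (dil r X) y) \<le> K * mixed_norm N n y \<and>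
     mixed_norm N n (\<lambda>p a. pact N n G X y p a - pact N n G (dil r X) y p a) \<le> (1 - r) * K * mixed_norm N n y)"

lemma dilation_bound_mono: "dilation_bound N n X r K G \<Longrightarrow> K \<le> K' \<Longrightarrow> r \<le> 1 \<Longrightarrow> dilation_bound N n X r K' G"
  unfolding dilation_bound_def
  by (meson mixed_norm_nonneg mult_left_mono mult_right_mono order.trans diff_ge_0_iff_ge)

lemma dilation_bound_exists:
  fixes Q :: "'d::finite \<Rightarrow> 'h::complex_hilbert \<Rightarrow> 'h" and G :: "'d nc_poly mat"
  assumes basis: "operator_space_basis \<E> Q"
  shows "\<exists>K\<ge>0. \<forall>n X r. pencil_bound Q n X 1 \<longrightarrow> 0 \<le> r \<longrightarrow> r \<le> 1 \<longrightarrow> dilation_bound N n X r K G"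
proof -
  obtain \<kappa> where \<kappa>: "\<kappa> \<ge> 1" "\<And>n X j \<xi>. pencil_bound Q n X 1 \<Longrightarrow>
    l2n n (\<lambda>a. \<Sum>b<n. X j $$ (a, b) * \<xi> b) \<le> \<kappa> * l2n n \<xi>"
    using coordinates_bounded_on_ball[OF basis] by blast
  have \<kappa>0: "\<kappa> \<ge> 0" using \<kappa> by simp
  define K where "K = (\<Sum>p<N. \<Sum>q<N. \<Sum>w\<in>Poly_Mapping.keys (G $$ (p, q)). norm (Poly_Mapping.lookup (G $$ (p, q)) w) * (1 + real (length (letters w))) * \<kappa> ^ length (letters w))"
  have K: "K \<ge> 0" unfolding K_def using \<kappa> by (intro sum_nonneg) auto
  have "dilation_bound N n X r K G" if X: "pencil_bound Q n X 1" and r: "0 \<le> r" "r \<le> 1" for n X r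
  proof -
    have Xc: "\<forall>j. X j \<in> carrier_mat n n" using X by (simp add: pencil_bound_def)
    have p1: "pact N n G X y = weighted_act N n G X (\<lambda>l. 1) y" for y
    proof -
      have "(\<lambda>j. complex_of_real 1 \<cdot>\<^sub>m X j) = X" by (intro ext eq_matI) auto
      then show ?thesis using pact_dilate_weighted[OF Xc, of N G 1 y] by simp
    qed
    note pr = pact_dilate_weighted[OF Xc, of N G r]
    have diff: "(\<lambda>p a. weighted_act N n G X (\<lambda>l. 1) y p a - weighted_act N n G X (\<lambda>l. r ^ l) y p a) = weighted_act N n G X (\<lambda>l. 1 - r ^ l) y" for y
      by (intro ext) (simp add: weighted_act_def left_diff_distrib right_diff_distrib sum_subtractf)
    have 1: "mixed_norm N n (weighted_act N n G X (\<lambda>l. 1) y) \<le> 1 * K * mixed_norm N n y" for y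
      unfolding K_def by (rule weighted_act_bound[OF Xc \<kappa>0 \<kappa>(2)[OF X]]) auto
    have 2: "mixed_norm N n (weighted_act N n G X (\<lambda>l. r ^ l) y) \<le> 1 * K * mixed_norm N n y" for y
      unfolding K_def
    proof (rule weighted_act_bound[OF Xc \<kappa>0 \<kappa>(2)[OF X]])
      show "\<bar>r ^ l\<bar> \<le> 1 * (1 + real l)" for l
        using power_le_one[OF r, of l] r by (simp add: add_increasing2)
    qed auto
    have 3: "mixed_norm N n (weighted_act N n G X (\<lambda>l. 1 - r ^ l) y) \<le> (1 - r) * K * mixed_norm N n y" for y
      unfolding K_def
    proof (rule weighted_act_bound[OF Xc \<kappa>0 \<kappa>(2)[OF X]])
      fix l
      \<comment> \<open>Bernoulli's inequality supplies the factor \<open>1 - r\<close>, at the price of the word length.\<close>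
      have "1 + real l * (r - 1) \<le> (1 + (r - 1)) ^ l" by (rule Bernoulli_inequality) (use r in simp)
      then have "1 - r ^ l \<le> (1 - r) * real l" by (simp add: algebra_simps)
      also have "\<dots> \<le> (1 - r) * (1 + real l)" using r by (intro mult_left_mono) auto
      finally show "\<bar>1 - r ^ l\<bar> \<le> (1 - r) * (1 + real l)" using power_le_one[OF r, of l] by simp
    qed (use r in auto)
    show ?thesis unfolding dilation_bound_def p1 pr diff using 1 2 3 by simp
  qed
  with K show ?thesis by blast
qed

section \<open>The dilation estimates\<close>

lemma mixed_norm_diff_le: "mixed_norm m n y \<le> mixed_norm m n z + mixed_norm m n (\<lambda>p a. y p a - z p a)"
  using mixed_norm_triangle[of m n z "\<lambda>p a. y p a - z p a"] by simp

text \<open>Here \<open>P = E L F\<close>, with \<open>E'\<close>, \<open>F'\<close> inverse to \<open>E\<close>, \<open>F\<close>. For the first estimate put \<open>u' = F(rX) u\<close> and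
  \<open>v' = F(X) v\<close>; then
  \<open>L(rX) (u' - v') = (E'(rX) E(X) - 1) L(X) v' + (L(X) - L(rX)) v'\<close>, and both terms are \<open>O(1 - r)\<close>,
  which cancels the factor \<open>1 / (1 - r)\<close> of the resolvent. For the second estimate \<open>L(rX) u'\<close> is
  controlled by \<open>v\<close>, and passing from \<open>L(rX) u'\<close> to \<open>L(X) F(X) u\<close> costs only \<open>O(1 - r) \<parallel>u'\<parallel>\<close>.\<close>

lemma dilation_estimates:
  fixes E F E' F' L :: "'d nc_poly mat"
  assumes X: "\<forall>j. X j \<in> carrier_mat n n" and r: "r < 1"
    and car: "E \<in> carrier_mat N N" "F \<in> carrier_mat N N" "E' \<in> carrier_mat N N" "F' \<in> carrier_mat N N" "L \<in> carrier_mat N N"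
    and inv: "E' * E = 1\<^sub>m N" "F' * F = 1\<^sub>m N"
    and bd: "\<And>G. G \<in> {E, F, E', F', L} \<Longrightarrow> dilation_bound N n X r K G" and K: "K \<ge> 0"
    and res: "\<And>y. supported N n y \<Longrightarrow>
      mixed_norm N n y \<le> C / (1 - r) * mixed_norm N n (pact N n L (dil r X) y)" and C: "C \<ge> 0"
    and u: "supported N n u"
  shows "pact N n (E * L * F) (dil r X) u = pact N n (E * L * F) X v \<Longrightarrow>
      mixed_norm N n u \<le> K * (1 + C * (K * K * K + K)) * K * mixed_norm N n v"
    and "pact N n (E * L * F) (dil r X) u = v \<Longrightarrow>
      mixed_norm N n (pact N n (E * L * F) X u) \<le> K * (1 + C * (K * K * K + K)) * K * mixed_norm N n v"
proof -
  let ?\<mu> = "mixed_norm N n"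
  define d where "d G = pact N n G (dil r X)" for G :: "'d nc_poly mat"
  define e where "e G = pact N n G X" for G :: "'d nc_poly mat"
  have rX: "\<forall>j. dil r X j \<in> carrier_mat n n" using X by simp
  have dm: "d (G * H) y = d G (d H y)" and em: "e (G * H) y = e G (e H y)"
    if "G \<in> carrier_mat N N" "H \<in> carrier_mat N N" for G H y
    using pact_mult[OF X that] pact_mult[OF rX that] by (auto simp: d_def e_def)
  have sd[simp]: "supported N n (d G y)" "supported N n (e G y)" for G y by (simp_all add: d_def e_def)
  have EL: "E * L \<in> carrier_mat N N" using car by auto
  have dELF: "d (E * L * F) y = d E (d L (d F y))" and eELF: "e (E * L * F) y = e E (e L (e F y))" for y
    using dm[OF EL car(2)] dm[OF car(1,5)] em[OF EL car(2)] em[OF car(1,5)] by auto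
  have dE: "d E' (d E y) = y" and dF: "d F' (d F y) = y" if "supported N n y" for y
  proof -
    have "d (1\<^sub>m N) y = y" unfolding d_def by (rule pact_one[OF that])
    then show "d E' (d E y) = y" "d F' (d F y) = y"
      using dm[OF car(3,1), of y] dm[OF car(4,2), of y] unfolding inv by simp_all
  qed
  have b1: "?\<mu> (e G y) \<le> K * ?\<mu> y" and b2: "?\<mu> (d G y) \<le> K * ?\<mu> y"
    and b3: "?\<mu> (\<lambda>p a. e G y p a - d G y p a) \<le> (1 - r) * K * ?\<mu> y" if "G \<in> {E, F, E', F', L}" for G y
    using bd[OF that] unfolding dilation_bound_def d_def e_def by blast+
  note m0 = mixed_norm_nonneg[of N n]
  have r1: "1 - r > 0" using r by simp
  have C': "C / (1 - r) \<ge> 0" using C r1 by simp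
  show "?\<mu> u \<le> K * (1 + C * (K * K * K + K)) * K * ?\<mu> v" if "pact N n (E * L * F) (dil r X) u = pact N n (E * L * F) X v"
  proof -
    have eq: "d E (d L (d F u)) = e E (e L (e F v))"
      using that unfolding d_def[symmetric] e_def[symmetric] dELF eELF .
    define u' where "u' = d F u"
    define v' where "v' = e F v"
    have Lu: "d L u' = d E' (e E (e L v'))"
      using arg_cong[OF eq, of "d E'"] dE[of "d L (d F u)"] by (simp add: u'_def v'_def)
    define z where "z p a = u' p a - v' p a" for p a
    have zs: "supported N n z" by (auto simp: z_def u'_def v'_def supported_def d_def e_def pact_def)
    define w1 where "w1 = d E' (\<lambda>p a. e E (e L v') p a - d E (e L v') p a)"
    have w1: "w1 = (\<lambda>p a. d E' (e E (e L v')) p a - e L v' p a)"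
      unfolding w1_def using pact_diff[of N n E' _ "e E (e L v')" "d E (e L v')"] dE[of "e L v'"]
      by (simp add: d_def[of E'])
    \<comment> \<open>\<open>w1\<close> is \<open>(E'(rX) E(X) - 1) L(X) v'\<close>.\<close>
    have Lz: "d L z = (\<lambda>p a. w1 p a + (e L v' p a - d L v' p a))"
    proof -
      have "d L z = (\<lambda>p a. d L u' p a - d L v' p a)" unfolding z_def d_def by (rule pact_diff)
      then show ?thesis by (simp add: w1 Lu)
    qed
    have "?\<mu> w1 \<le> K * ((1 - r) * K * (K * ?\<mu> v'))"
    proof -
      have "?\<mu> w1 \<le> K * ?\<mu> (\<lambda>p a. e E (e L v') p a - d E (e L v') p a)" unfolding w1_def by (rule b2) simp
      also have "\<dots> \<le> K * ((1 - r) * K * ?\<mu> (e L v'))" by (intro mult_left_mono b3 K) simp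
      also have "\<dots> \<le> K * ((1 - r) * K * (K * ?\<mu> v'))" using r1 K by (intro mult_left_mono b1) auto
      finally show ?thesis .
    qed
    moreover have "?\<mu> (\<lambda>p a. e L v' p a - d L v' p a) \<le> (1 - r) * K * ?\<mu> v'" by (rule b3) simp
    ultimately have "?\<mu> (d L z) \<le> K * ((1 - r) * K * (K * ?\<mu> v')) + (1 - r) * K * ?\<mu> v'"
      unfolding Lz by (rule order.trans[OF mixed_norm_triangle add_mono])
    also have "\<dots> = (1 - r) * ((K * K * K + K) * ?\<mu> v')" by (simp add: algebra_simps)
    finally have Lz_le: "?\<mu> (d L z) \<le> (1 - r) * ((K * K * K + K) * ?\<mu> v')" .
    have "?\<mu> z \<le> C / (1 - r) * ?\<mu> (d L z)" unfolding d_def by (rule res[OF zs])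
    also have "\<dots> \<le> C / (1 - r) * ((1 - r) * ((K * K * K + K) * ?\<mu> v'))" by (rule mult_left_mono[OF Lz_le C'])
    also have "\<dots> = C * (K * K * K + K) * ?\<mu> v'" using r1 by simp
    finally have zle: "?\<mu> z \<le> C * (K * K * K + K) * ?\<mu> v'" .
    have "?\<mu> u' \<le> ?\<mu> v' + ?\<mu> z" unfolding z_def by (rule mixed_norm_diff_le)
    also have "\<dots> \<le> (1 + C * (K * K * K + K)) * ?\<mu> v'" using zle by (simp add: algebra_simps)
    also have "\<dots> \<le> (1 + C * (K * K * K + K)) * (K * ?\<mu> v)"
      unfolding v'_def using C K by (intro mult_left_mono b1) auto
    finally have u'le: "?\<mu> u' \<le> (1 + C * (K * K * K + K)) * (K * ?\<mu> v)" .
    have "?\<mu> u = ?\<mu> (d F' u')" unfolding u'_def using dF[OF u] by simp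
    also have "\<dots> \<le> K * ?\<mu> u'" by (rule b2) simp
    also have "\<dots> \<le> K * ((1 + C * (K * K * K + K)) * (K * ?\<mu> v))" by (rule mult_left_mono[OF u'le K])
    finally show ?thesis by (simp add: mult.assoc)
  qed
  show "?\<mu> (pact N n (E * L * F) X u) \<le> K * (1 + C * (K * K * K + K)) * K * ?\<mu> v" if "pact N n (E * L * F) (dil r X) u = v"
  proof -
    have eq: "d E (d L (d F u)) = v" using that unfolding d_def[symmetric] dELF .
    define u' where "u' = d F u"
    define w where "w = d E' v"
    have Lu: "d L u' = w" using arg_cong[OF eq, of "d E'"] dE[of "d L (d F u)"] by (simp add: u'_def w_def)
    have su': "supported N n u'" by (simp add: u'_def)
    have ule: "(1 - r) * ?\<mu> u' \<le> C * ?\<mu> w"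
    proof -
      have "?\<mu> u' \<le> C / (1 - r) * ?\<mu> w" using res[OF su'] Lu by (simp add: d_def)
      then have "(1 - r) * ?\<mu> u' \<le> (1 - r) * (C / (1 - r) * ?\<mu> w)" using r1 by (intro mult_left_mono) auto
      then show ?thesis using r1 by simp
    qed
    define z where "z = (\<lambda>p a. e F u p a - d F u p a)"
    have "u = d F' u'" unfolding u'_def using dF[OF u] by simp
    then have "?\<mu> u \<le> K * ?\<mu> u'" using b2[of F' u'] by simp
    then have zle: "?\<mu> z \<le> (1 - r) * K * (K * ?\<mu> u')"
      unfolding z_def using r1 K by (intro order.trans[OF b3] mult_left_mono) auto
    have "e L z = (\<lambda>p a. e L (e F u) p a - e L u' p a)"
      unfolding z_def u'_def[symmetric] by (simp add: e_def[of L] pact_diff)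
    then have "?\<mu> (e L (e F u)) \<le> ?\<mu> (e L u') + ?\<mu> (e L z)"
      using mixed_norm_diff_le[of N n "e L (e F u)" "e L u'"] by simp
    also have "?\<mu> (e L u') \<le> ?\<mu> w + ?\<mu> (\<lambda>p a. e L u' p a - d L u' p a)"
      unfolding Lu[symmetric] by (rule mixed_norm_diff_le)
    also have "?\<mu> (\<lambda>p a. e L u' p a - d L u' p a) \<le> (1 - r) * K * ?\<mu> u'" by (rule b3) simp
    also have "?\<mu> (e L z) \<le> K * ((1 - r) * K * (K * ?\<mu> u'))"
      by (rule order.trans[OF b1 mult_left_mono[OF zle K]]) simp
    finally have "?\<mu> (e L (e F u)) \<le> ?\<mu> w + (K * K * K + K) * ((1 - r) * ?\<mu> u')"
      by (simp add: algebra_simps)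
    also have "\<dots> \<le> ?\<mu> w + (K * K * K + K) * (C * ?\<mu> w)"
      using K by (intro add_left_mono mult_left_mono ule) auto
    also have "\<dots> = (1 + C * (K * K * K + K)) * ?\<mu> w" by (simp add: algebra_simps)
    also have "\<dots> \<le> (1 + C * (K * K * K + K)) * (K * ?\<mu> v)"
      unfolding w_def using C K by (intro mult_left_mono b2) auto
    finally have le: "?\<mu> (e L (e F u)) \<le> (1 + C * (K * K * K + K)) * (K * ?\<mu> v)" .
    have "?\<mu> (e (E * L * F) u) \<le> K * ?\<mu> (e L (e F u))" unfolding eELF by (rule b1) simp
    also have "\<dots> \<le> K * ((1 + C * (K * K * K + K)) * (K * ?\<mu> v))" by (rule mult_left_mono[OF le K])
    finally show ?thesis by (simp add: e_def mult.assoc)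
  qed
qed

lemma mat_op_norm_le:
  assumes "\<And>v. v \<in> carrier_vec (dim_col A) \<Longrightarrow> cvec_norm (A *\<^sub>v v) \<le> K * cvec_norm v" and K: "K \<ge> 0"
  shows "mat_op_norm A \<le> K"
  unfolding mat_op_norm_def
proof (rule cSUP_least)
  have "0\<^sub>v (dim_col A) \<in> {v \<in> carrier_vec (dim_col A). cvec_norm v \<le> 1}"
    by (simp add: cvec_norm_def L2_set_def)
  then show "{v \<in> carrier_vec (dim_col A). cvec_norm v \<le> 1} \<noteq> {}" by (metis empty_iff)
  fix v assume "v \<in> {v \<in> carrier_vec (dim_col A). cvec_norm v \<le> 1}"
  then have v: "v \<in> carrier_vec (dim_col A)" "cvec_norm v \<le> 1" by auto
  have "cvec_norm (A *\<^sub>v v) \<le> K * cvec_norm v" by (rule assms(1)[OF v(1)])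
  also have "\<dots> \<le> K" using v(2) K by (simp add: mult_left_le)
  finally show "cvec_norm (A *\<^sub>v v) \<le> K" .
qed

text \<open>Stable association transports invertibility of \<open>P(X)\<close> to invertibility of \<open>1 - A(X)\<close>.\<close>

lemma Q_stable_imp_no_fixed_vectors:
  fixes A :: "'d::finite \<Rightarrow> complex mat" and Q :: "'d \<Rightarrow> 'h::complex_hilbert \<Rightarrow> 'h"
  assumes P: "P \<in> carrier_mat k k" and st: "Q_stable Q P"
    and PA: "stably_assoc P (1\<^sub>m m - lin m A)"
  shows "no_fixed_vectors Q m A"
  unfolding no_fixed_vectors_def
proof (intro allI impI)
  fix n X y assume X: "(n, X) \<in> nc_ball Q" and y: "supported m n y" and fp: "act m n A X y = y"
  have Xc: "\<forall>j. X j \<in> carrier_mat n n" using X by (auto simp: nc_ball_def nc_universe_def)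
  have L: "1\<^sub>m m - lin m A \<in> carrier_mat m m" by (simp add: minus_carrier_mat)
  have "invertible_mat (nc_eval P (n, X))"
    using st X unfolding Q_stable_def by (subst invertible_mat_iff_det[OF nc_eval_carrier[OF P]]) auto
  then have inv: "invertible_mat (nc_eval (1\<^sub>m m - lin m A) (n, X))"
    by (rule stably_assoc_eval_invertible[OF Xc P L PA])
  note Lc = nc_eval_carrier[OF L, of n X]
  obtain M where M: "M \<in> carrier_mat (m * n) (m * n)" "M * nc_eval (1\<^sub>m m - lin m A) (n, X) = 1\<^sub>m (m * n)"
    using invertible_matE[OF inv Lc] by blast
  define v where "v = vec (m * n) (\<lambda>i. y (i div n) (i mod n))"
  have v: "v \<in> carrier_vec (m * n)" by (simp add: v_def)
  have vy: "unblock m n v = y"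
    using y by (intro ext) (auto simp: unblock_def v_def supported_def block_index_less)
  let ?w = "nc_eval (1\<^sub>m m - lin m A) (n, X) *\<^sub>v v"
  have "unblock m n ?w = (\<lambda>p a. 0)"
    unfolding unblock_nc_eval[OF Xc L v] vy pact_one_minus_lin[OF Xc y] fp by simp
  have w: "?w \<in> carrier_vec (m * n)" by (rule mult_mat_vec_carrier[OF Lc v])
  have "?w = 0\<^sub>v (m * n)"
  proof (rule eq_vecI)
    fix i assume "i < dim_vec (0\<^sub>v (m * n) :: complex vec)"
    then have i: "i < m * n" by simp
    have "?w $ i = unblock m n ?w (i div n) (i mod n)"
      using div_mod_less[OF i] by (simp add: unblock_def del: nc_eval.simps index_mult_mat_vec)
    then show "?w $ i = 0\<^sub>v (m * n) $ i" using i \<open>unblock m n ?w = _\<close> by (simp del: nc_eval.simps)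
  qed (use w in auto)
  then have "M *\<^sub>v ?w = 0\<^sub>v (m * n)" using M by (auto intro!: eq_vecI)
  moreover have "M *\<^sub>v ?w = v" using assoc_mult_mat_vec[OF M(1) Lc v] M(2) v by simp
  ultimately have "v = 0\<^sub>v (m * n)" by simp
  then show "y = (\<lambda>p a. 0)" unfolding vy[symmetric]
    by (intro ext) (auto simp: unblock_def block_index_less)
qed

text \<open>The identity summand of the padded pencil does not affect the estimate since \<open>C / (1 - r) \<ge> 1\<close>.\<close>

lemma pad_resolvent_bound:
  fixes A X :: "'d::finite \<Rightarrow> complex mat"
  assumes X: "\<forall>j. X j \<in> carrier_mat n n"
    and pb: "\<And>l y. supported m n y \<Longrightarrow> mixed_norm m n ((act m n A X ^^ l) y) \<le> C * mixed_norm m n y"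
    and r: "0 \<le> r" "r < 1" and C: "C \<ge> 1" and m: "m \<le> N" and y: "supported N n y"
  shows "mixed_norm N n y \<le> C / (1 - r) *
    mixed_norm N n (pact N n (pad N (1\<^sub>m m - lin m A)) (dil r X) y)"
proof -
  have L: "1\<^sub>m m - lin m A \<in> carrier_mat m m" by (simp add: minus_carrier_mat)
  have rX: "\<forall>j. dil r X j \<in> carrier_mat n n" using X by simp
  define y1 where "y1 p a = (if p < m then y p a else 0)" for p a
  have y1: "supported m n y1" using y m by (auto simp: supported_def y1_def)
  let ?z = "pact N n (pad N (1\<^sub>m m - lin m A)) (dil r X) y"
  have "pact m n (1\<^sub>m m - lin m A) (dil r X) y = pact m n (1\<^sub>m m - lin m A) (dil r X) y1"
    by (intro ext) (simp add: pact_def y1_def)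
  also have "\<dots> = (\<lambda>p a. y1 p a - complex_of_real r * act m n A X y1 p a)"
    by (simp only: pact_one_minus_lin[OF rX y1] act_scale_point[OF X])
  finally have z: "?z = (\<lambda>p a. if p < m then y1 p a - complex_of_real r * act m n A X y1 p a else y p a)"
    by (simp only: pact_pad[OF L m y])
  have one: "C / (1 - r) \<ge> 1" using C r by (simp add: divide_simps)
  have "mixed_norm m n y = mixed_norm m n y1" unfolding mixed_norm_def by (intro sum.cong refl l2n_cong) (simp add: y1_def)
  also have "\<dots> \<le> C / (1 - r) * mixed_norm m n (\<lambda>p a. y1 p a - complex_of_real r * act m n A X y1 p a)"
    by (rule resolvent_bound[OF pb r y1 C])
  also have "mixed_norm m n (\<lambda>p a. y1 p a - complex_of_real r * act m n A X y1 p a) = mixed_norm m n ?z"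
    unfolding mixed_norm_def z by (intro sum.cong refl l2n_cong) simp
  finally have 1: "mixed_norm m n y \<le> C / (1 - r) * mixed_norm m n ?z" .
  have "(\<Sum>p\<in>{m..<N}. l2n n (y p)) = (\<Sum>p\<in>{m..<N}. l2n n (?z p))"
    unfolding z by (intro sum.cong refl) simp
  also have "\<dots> \<le> C / (1 - r) * (\<Sum>p\<in>{m..<N}. l2n n (?z p))"
    using mult_right_mono[OF one, of "\<Sum>p\<in>{m..<N}. l2n n (?z p)"] by (simp add: sum_nonneg l2n_nonneg)
  finally show ?thesis using 1 unfolding mixed_norm_split[OF m] by (simp add: distrib_left)
qed

text \<open>The bounds for \<open>P(rX)\<^sup>-\<^sup>1 P(X)\<close> and \<open>P(X) P(rX)\<^sup>-\<^sup>1\<close> in terms of vectors, without inverse matrices.\<close>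

theorem stable_atom_dilation_bounds:
  fixes Q :: "'d::finite \<Rightarrow> 'h::complex_hilbert \<Rightarrow> 'h" and P :: "'d nc_poly mat"
  assumes basis: "operator_space_basis \<E> Q" and P: "P \<in> carrier_mat k k"
    and st: "Q_stable Q P" and atom: "nc_atom k P"
  obtains K where "K \<ge> 0" "\<And>n X r u v. (n, X) \<in> nc_ball Q \<Longrightarrow> 0 \<le> r \<Longrightarrow> r < 1 \<Longrightarrow>
      u \<in> carrier_vec (k * n) \<Longrightarrow> v \<in> carrier_vec (k * n) \<Longrightarrow>
      nc_eval P (scale_point r (n, X)) *\<^sub>v u = nc_eval P (n, X) *\<^sub>v v \<Longrightarrow> cvec_norm u \<le> K * cvec_norm v"
    "\<And>n X r u. (n, X) \<in> nc_ball Q \<Longrightarrow> 0 \<le> r \<Longrightarrow> r < 1 \<Longrightarrow> u \<in> carrier_vec (k * n) \<Longrightarrow>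
      cvec_norm (nc_eval P (n, X) *\<^sub>v u) \<le> K * cvec_norm (nc_eval P (scale_point r (n, X)) *\<^sub>v u)"
proof -
  have bdd: "\<forall>j. bounded_clinear_op (Q j)" using basis by (simp add: operator_space_basis_def)
  have "l2n 1 (pencil Q (1, \<lambda>_. 0\<^sub>m 1 1) v) = 0" for v
    unfolding l2n_eq_0 by simp
  then have "pencil_bound Q 1 (\<lambda>_. 0\<^sub>m 1 1) 0" by (simp add: pencil_bound_def del: pencil.simps)
  then have "(1, \<lambda>_. 0\<^sub>m 1 1) \<in> nc_ball Q" by (rule pencil_bound_less_one_imp_ball[rotated]) auto
  then have "invertible_mat (nc_eval P (1, \<lambda>_. 0\<^sub>m 1 1))"
    using st unfolding Q_stable_def by (subst invertible_mat_iff_det[OF nc_eval_carrier[OF P]]) auto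
  from irreducible_linearization[OF atom this] obtain m A where
    irr: "irreducible_tuple m A" and PA: "stably_assoc P (1\<^sub>m m - lin m A)" by blast
  have nf: "no_fixed_vectors Q m A" by (rule Q_stable_imp_no_fixed_vectors[OF P st PA])
  obtain C where C: "C \<ge> 1" "\<And>n X l y. n \<ge> 1 \<Longrightarrow> pencil_bound Q n X 1 \<Longrightarrow> supported m n y \<Longrightarrow>
    mixed_norm m n ((act m n A X ^^ l) y) \<le> C * mixed_norm m n y"
    using irreducible_power_bounded[OF nf irr bdd] by blast
  obtain N E F where NEF: "k \<le> N" "m \<le> N" "E \<in> carrier_mat N N" "F \<in> carrier_mat N N"
    "invertible_mat E" "invertible_mat F" "pad N P = E * pad N (1\<^sub>m m - lin m A) * F"
    using PA P unfolding stably_assoc_def by (auto simp: minus_carrier_mat)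
  obtain E' where E': "E' \<in> carrier_mat N N" "E' * E = 1\<^sub>m N" using invertible_matE[OF NEF(5,3)] by blast
  obtain F' where F': "F' \<in> carrier_mat N N" "F' * F = 1\<^sub>m N" using invertible_matE[OF NEF(6,4)] by blast
  let ?L = "pad N (1\<^sub>m m - lin m A)"
  have "\<forall>G. \<exists>K\<ge>0. \<forall>n X r. pencil_bound Q n X 1 \<longrightarrow> 0 \<le> r \<longrightarrow> r \<le> 1 \<longrightarrow> dilation_bound N n X r K G"
    using dilation_bound_exists[OF basis] by blast
  then obtain \<kappa> where \<kappa>: "\<And>G. \<kappa> G \<ge> 0"
    "\<And>G n X r. pencil_bound Q n X 1 \<Longrightarrow> 0 \<le> r \<Longrightarrow> r \<le> 1 \<Longrightarrow> dilation_bound N n X r (\<kappa> G) G" by metis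
  define K where "K = \<kappa> E + \<kappa> F + \<kappa> E' + \<kappa> F' + \<kappa> ?L"
  have K: "K \<ge> 0" "\<And>G. G \<in> {E, F, E', F', ?L} \<Longrightarrow> \<kappa> G \<le> K"
    using \<kappa>(1)[of E] \<kappa>(1)[of F] \<kappa>(1)[of E'] \<kappa>(1)[of F'] \<kappa>(1)[of ?L] by (auto simp: K_def)
  define K1 where "K1 = K * (1 + C * (K * K * K + K)) * K"
  have K1: "K1 \<ge> 0" using K(1) C(1) by (simp add: K1_def)
  have C0: "C \<ge> 0" using C(1) by simp
  have main: "(pact k n P (dil r X) u = pact k n P X v \<longrightarrow> mixed_norm k n u \<le> K1 * mixed_norm k n v) \<and>
      (pact k n P (dil r X) u = v \<longrightarrow> mixed_norm k n (pact k n P X u) \<le> K1 * mixed_norm k n v)"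
    if X: "(n, X) \<in> nc_ball Q" and r: "0 \<le> r" "r < 1" and u: "supported k n u" and v: "supported k n v" for n X r u v
  proof -
    have pX: "pencil_bound Q n X 1" by (rule nc_ball_imp_pencil_bound[OF bdd X])
    have Xc: "\<forall>j. X j \<in> carrier_mat n n" and n: "n \<ge> 1" using X by (auto simp: nc_ball_def nc_universe_def)
    have sup: "supported N n y" if "supported k n y" for y using that NEF(1) by (auto simp: supported_def)
    have pp: "pact N n (pad N P) Y y = pact k n P Y y" if "supported k n y" for Y y
      unfolding pact_pad[OF P NEF(1) sup[OF that]] using that by (auto simp: pact_def supported_def fun_eq_iff)
    have bd: "dilation_bound N n X r K G" if "G \<in> {E, F, E', F', ?L}" for G
      using dilation_bound_mono[OF \<kappa>(2)[OF pX] K(2)[OF that]] r by simp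
    have res: "mixed_norm N n y \<le> C / (1 - r) * mixed_norm N n (pact N n ?L (dil r X) y)"
      if "supported N n y" for y
      by (rule pad_resolvent_bound[OF Xc C(2)[OF n pX] r C(1) NEF(2) that])
    note est = dilation_estimates[where v = v, OF Xc r(2) NEF(3,4) E'(1) F'(1) pad_carrier E'(2) F'(2) bd K(1) res C0 sup[OF u],
        folded NEF(7) K1_def]
    have "mixed_norm N n y = mixed_norm k n y" if "supported k n y" for y
      by (rule mixed_norm_enlarge[OF that NEF(1)])
    then show ?thesis using est u v by (simp add: pp)
  qed
  show ?thesis
  proof (rule that[of "K1 * real k"])
    show "K1 * real k \<ge> 0" using K1 by simp
  next
    fix n X r u v
    assume X: "(n, X) \<in> nc_ball Q" and r: "0 \<le> r" "r < 1" and u: "u \<in> carrier_vec (k * n)" and v: "v \<in> carrier_vec (k * n)"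
      and eq: "nc_eval P (scale_point r (n, X)) *\<^sub>v u = nc_eval P (n, X) *\<^sub>v v"
    have Xc: "\<forall>j. X j \<in> carrier_mat n n" using X by (auto simp: nc_ball_def nc_universe_def)
    have rX: "\<forall>j. dil r X j \<in> carrier_mat n n" using Xc by simp
    have "pact k n P (dil r X) (unblock k n u) = pact k n P X (unblock k n v)"
      unfolding unblock_nc_eval[OF Xc P v, symmetric] unblock_nc_eval[OF rX P u, symmetric]
      using eq by (simp only: scale_point.simps)
    then have "mixed_norm k n (unblock k n u) \<le> K1 * mixed_norm k n (unblock k n v)"
      using main[OF X r supported_unblock supported_unblock] by blast
    also have "\<dots> \<le> K1 * (real k * cvec_norm v)" by (intro mult_left_mono cvec_norm_le_mixed_norm v K1)
    finally show "cvec_norm u \<le> K1 * real k * cvec_norm v"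
      using cvec_norm_le_mixed_norm(1)[OF u] by (simp add: mult.assoc)
  next
    fix n X r and u :: "complex vec"
    assume X: "(n, X) \<in> nc_ball Q" and r: "0 \<le> r" "r < (1::real)" and u: "u \<in> carrier_vec (k * n)"
    have Xc: "\<forall>j. X j \<in> carrier_mat n n" using X by (auto simp: nc_ball_def nc_universe_def)
    have rX: "\<forall>j. dil r X j \<in> carrier_mat n n" using Xc by simp
    let ?v = "nc_eval P (scale_point r (n, X)) *\<^sub>v u" and ?w = "nc_eval P (n, X) *\<^sub>v u"
    have vw: "?v \<in> carrier_vec (k * n)" "?w \<in> carrier_vec (k * n)"
      unfolding scale_point.simps by (rule mult_mat_vec_carrier[OF nc_eval_carrier[OF P] u])+
    have "pact k n P (dil r X) (unblock k n u) = unblock k n ?v"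
      unfolding unblock_nc_eval[OF rX P u, symmetric] by (simp only: scale_point.simps)
    then have "mixed_norm k n (pact k n P X (unblock k n u)) \<le> K1 * mixed_norm k n (unblock k n ?v)"
      using main[OF X r supported_unblock supported_unblock] by blast
    also have "\<dots> \<le> K1 * (real k * cvec_norm ?v)" by (intro mult_left_mono cvec_norm_le_mixed_norm vw K1)
    finally show "cvec_norm ?w \<le> K1 * real k * cvec_norm ?v"
      using cvec_norm_le_mixed_norm(1)[OF vw(2)] unfolding unblock_nc_eval[OF Xc P u] by (simp add: mult.assoc)
  qed
qed

theorem theorem1:
  fixes k :: nat
    and \<E> :: "('h::complex_hilbert \<Rightarrow> 'h) set"
    and Q :: "'d::finite \<Rightarrow> 'h \<Rightarrow> 'h"
    and P :: "'d nc_poly mat"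
  assumes "k \<ge> 1"
    and "operator_space_basis \<E> Q"
    and "P \<in> carrier_mat k k"
    and "Q_stable Q P"
    and "nc_atom k P"
  shows "(SUP r\<in>{0..<1::real}. ball_norm Q
            (pointwise_mult (pointwise_inverse (nc_dilate r (nc_eval P))) (nc_eval P))) < \<infinity> \<and>
         (SUP r\<in>{0..<1::real}. ball_norm Q
            (pointwise_mult (nc_eval P) (pointwise_inverse (nc_dilate r (nc_eval P))))) < \<infinity>"
proof -
  obtain K where K: "K \<ge> 0" and left: "\<And>n X r u v. (n, X) \<in> nc_ball Q \<Longrightarrow> 0 \<le> r \<Longrightarrow> r < 1 \<Longrightarrow>
      u \<in> carrier_vec (k * n) \<Longrightarrow> v \<in> carrier_vec (k * n) \<Longrightarrow>
      nc_eval P (scale_point r (n, X)) *\<^sub>v u = nc_eval P (n, X) *\<^sub>v v \<Longrightarrow> cvec_norm u \<le> K * cvec_norm v"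
    and right: "\<And>n X r u. (n, X) \<in> nc_ball Q \<Longrightarrow> 0 \<le> r \<Longrightarrow> r < 1 \<Longrightarrow> u \<in> carrier_vec (k * n) \<Longrightarrow>
      cvec_norm (nc_eval P (n, X) *\<^sub>v u) \<le> K * cvec_norm (nc_eval P (scale_point r (n, X)) *\<^sub>v u)"
    using stable_atom_dilation_bounds[OF assms(2,3,4,5)] by blast
  have bdd: "\<forall>j. bounded_clinear_op (Q j)" using assms(2) by (simp add: operator_space_basis_def)
  have inverse: "\<exists>R\<in>carrier_mat (k * n) (k * n). pointwise_inverse (nc_dilate r (nc_eval P)) (n, X) = R \<and>
      nc_eval P (scale_point r (n, X)) * R = 1\<^sub>m (k * n)"
    if X: "(n, X) \<in> nc_ball Q" and r: "0 \<le> r" "r < 1" for n X and r :: real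
  proof -
    have n: "n \<ge> 1" using X by (auto simp: nc_ball_def nc_universe_def)
    have "pencil_bound Q n (dil r X) (norm (complex_of_real r) * 1)"
      by (rule pencil_bound_scale[OF nc_ball_imp_pencil_bound[OF bdd X]])
    then have "scale_point r (n, X) \<in> nc_ball Q"
      unfolding scale_point.simps by (rule pencil_bound_less_one_imp_ball[OF n]) (use r in auto)
    then have det: "det (nc_eval P (scale_point r (n, X))) \<noteq> 0" using assms(4) unfolding Q_stable_def by blast
    have car: "nc_eval P (scale_point r (n, X)) \<in> carrier_mat (k * n) (k * n)"
      unfolding scale_point.simps by (rule nc_eval_carrier[OF assms(3)])
    have "mat_inverse (nc_eval P (scale_point r (n, X))) \<noteq> None"
      using mat_inverse(1)[OF car, where b = "()"] det_non_zero_imp_unit[OF car det, where b = "()"] by blast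
    then obtain R where R: "mat_inverse (nc_eval P (scale_point r (n, X))) = Some R" by blast
    then show ?thesis using mat_inverse(2)[OF car R] by (simp add: pointwise_inverse_def nc_dilate_def)
  qed
  have "mat_op_norm (pointwise_mult (pointwise_inverse (nc_dilate r (nc_eval P))) (nc_eval P) Y) \<le> K \<and>
      mat_op_norm (pointwise_mult (nc_eval P) (pointwise_inverse (nc_dilate r (nc_eval P))) Y) \<le> K"
    if Y: "Y \<in> nc_ball Q" and r: "r \<in> {0..<1}" for Y and r :: real
  proof -
    obtain n X where YX: "Y = (n, X)" by (cases Y)
    note X = Y[unfolded YX]
    have r': "0 \<le> r" "r < 1" using r by auto
    let ?P = "nc_eval P (n, X)" and ?Pr = "nc_eval P (scale_point r (n, X))"
    obtain R where R: "R \<in> carrier_mat (k * n) (k * n)" "pointwise_inverse (nc_dilate r (nc_eval P)) (n, X) = R"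
      "?Pr * R = 1\<^sub>m (k * n)"
      using inverse[OF X r'] by blast
    have car: "?P \<in> carrier_mat (k * n) (k * n)" "?Pr \<in> carrier_mat (k * n) (k * n)"
      unfolding scale_point.simps by (rule nc_eval_carrier[OF assms(3)])+
    have solve: "?Pr *\<^sub>v (R *\<^sub>v w) = w" if w: "w \<in> carrier_vec (k * n)" for w
      using assoc_mult_mat_vec[OF car(2) R(1) w] unfolding R(3) one_mult_mat_vec[OF w] by (rule sym)
    have "mat_op_norm (R * ?P) \<le> K"
    proof (rule mat_op_norm_le[OF _ K])
      fix v :: "complex vec" assume "v \<in> carrier_vec (dim_col (R * ?P))"
      then have v: "v \<in> carrier_vec (k * n)" using assms(3) by simp
      have Pv: "?P *\<^sub>v v \<in> carrier_vec (k * n)" by (rule mult_mat_vec_carrier[OF car(1) v])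
      show "cvec_norm (R * ?P *\<^sub>v v) \<le> K * cvec_norm v"
        unfolding assoc_mult_mat_vec[OF R(1) car(1) v]
        by (rule left[OF X r' mult_mat_vec_carrier[OF R(1) Pv] v solve[OF Pv]])
    qed
    moreover have "mat_op_norm (?P * R) \<le> K"
    proof (rule mat_op_norm_le[OF _ K])
      fix v :: "complex vec" assume "v \<in> carrier_vec (dim_col (?P * R))"
      then have v: "v \<in> carrier_vec (k * n)" using R(1) by auto
      show "cvec_norm (?P * R *\<^sub>v v) \<le> K * cvec_norm v"
        unfolding assoc_mult_mat_vec[OF car(1) R(1) v]
        using right[OF X r' mult_mat_vec_carrier[OF R(1) v]] unfolding solve[OF v] .
    qed
    ultimately show ?thesis unfolding YX pointwise_mult_def R(2) by blast
  qed
  then have "(SUP r\<in>{0..<1::real}. ball_norm Q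
            (pointwise_mult (pointwise_inverse (nc_dilate r (nc_eval P))) (nc_eval P))) \<le> ennreal K"
    "(SUP r\<in>{0..<1::real}. ball_norm Q
            (pointwise_mult (nc_eval P) (pointwise_inverse (nc_dilate r (nc_eval P))))) \<le> ennreal K"
    unfolding ball_norm_def by (auto intro!: SUP_least ennreal_leI)
  then show ?thesis by (auto intro: le_less_trans)
qed

end
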